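(* Let $\mathfrak g$ be a real reductive Lie algebra with Cartan decomposition $\mathfrak g=\mathfrak k\oplus\mathfrak p$ and inner product $B^\theta$, and let $(V,\tau)$ be a hermitian $\mathfrak g$-module. Define a bigrading $C^k(\mathfrak g;V)=\sum_{p+q=k}C^{p,q}(\mathfrak g;V)$ by $$C^{p,q}(\mathfrak g;V)=\mathrm{Hom}_{\mathbb C}(\wedge^p\mathfrak k\otimes\wedge^q\mathfrak p,V)\cong V\otimes\wedge^p\mathfrak k^*\otimes\wedge^q\mathfrak p^*.$$ Then: (I) $\Delta_\circ=-\tau(\bar\Omega_G)+\square_\circ$, where $$\square_\circ|_{C^{p,0}(\mathfrak g;V)}=\sum_{j\in I_{\mathfrak g}}\tau(X_j)\,\mathrm{coad}^*(X_j),\qquad\square_\circ|_{C^{0,q}(\mathfrak g;V)}=-\sum_{j\in I_{\mathfrak g}}\tau(X_j)\,\mathrm{coad}^*(X_j),$$ and this extends to an action on $C^{p,q}(\mathfrak g;V)$ by derivation on the exterior algebra factor. (II) $\Delta_\wedge$ acts on $C^n(\mathfrak g;V)$ by $\sum_{j\in I_{\mathfrak g}}\mathrm{coad}^*(X_j)\,\mathrm{coad}(X_j)$. In particular, with $$A_{\mathfrak g}=-\tau(\bar\Omega_G),\quad D_{\mathfrak g}=\tfrac12\mathrm{coad}^*(\Omega_G):\ C^{p,q}(\mathfrak g;V)\to C^{p,q}(\mathfrak g;V),$$ $$B_{\mathfrak k}=\sum_{k\in I_{\mathfrak k}}\tau(X_k)\,\mathrm{coad}^*(X_k):\ C^{p,q}(\mathfrak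 g;V)\to C^{p,q}(\mathfrak g;V),$$ $$C_{\mathfrak p}=\sum_{\alpha\in I_{\mathfrak p}}\tau(Y_\alpha)\,\mathrm{coad}^*(Y_\alpha):\ C^{p,q}(\mathfrak g;V)\to C^{p-1,q+1}(\mathfrak g;V)\oplus C^{p+1,q-1}(\mathfrak g;V),$$ the components of the Laplacian act on $C^1(\mathfrak g;V)\cong(V\otimes\mathfrak k^* )\oplus(V\otimes\mathfrak p^* )$ by the operator-valued matrices $$\Delta_\circ=\begin{pmatrix}A_{\mathfrak g}+B_{\mathfrak k}&-C_{\mathfrak p}\\C_{\mathfrak p}&A_{\mathfrak g}-B_{\mathfrak k}\end{pmatrix},\qquad\Delta_\wedge=\begin{pmatrix}D_{\mathfrak g}&0\\0&D_{\mathfrak g}\end{pmatrix},$$ $$\Delta_{\circ,\wedge}=\begin{pmatrix}-B_{\mathfrak k}&C_{\mathfrak p}\\C_{\mathfrak p}&-B_{\mathfrak k}\end{pmatrix},\qquad\Delta_{\wedge,\circ}=\begin{pmatrix}-B_{\mathfrak k}&-C_{\mathfrak p}\\-C_{\mathfrak p}&-B_{\mathfrak k}\end{pmatrix},$$ and, summing, the Laplacian on $C^1(\mathfrak g;V)$ is $$\Delta_1=\begin{pmatrix}A_{\mathfrak g}-B_{\mathfrak k}+D_{\mathfrak g}&-C_{\mathfrak p}\\C_{\mathfrak p}&A_{\mathfrak g}-3B_{\mathfrak k}+D_{\mathfrak g}\end{pmatrix}.$$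
   Context: **Reductive data.** $B$ is a fixed nondegenerate $G$-invariant bilinear form on $\mathfrak g_{\mathbb C}$ ($G$ a connected group with Lie algebra $\mathfrak g$) restricting to the Killing form on $[\mathfrak g,\mathfrak g]$; $\theta$ is a Cartan involution with $\pm1$ eigenspaces $\mathfrak k$ ($+1$) and $\mathfrak p$ ($-1$); $B$ is negative definite on $\mathfrak k$ and positive definite on $\mathfrak p$. $B^\theta(X,Y)=-B(X,\theta\bar Y)$ is the associated positive definite hermitian inner product on $\mathfrak g_{\mathbb C}$ (bar = conjugation over $\mathfrak g$). Fix a $B^\theta$-orthonormal basis of $\mathfrak g$ consisting of an orthonormal basis $\{X_k\}_{k\in I_{\mathfrak k}}$ of $\mathfrak k$ and an orthonormal basis $\{Y_\alpha\}_{\alpha\in I_{\mathfrak p}}$ of $\mathfrak p$; $I_{\mathfrak g}=I_{\mathfrak k}\sqcup I_{\mathfrak p}$, and in sums over $j\in I_{\mathfrak g}$ the symbol $X_j$ runs over the whole basis. $\Omega_G=\sum_iZ_iZ^i\in U(\mathfrak g_{\mathbb C})$ is the Casimir element ($\{Z_i\}$ a basis of $\mathfrak g$, $\{Z^i\}$ its dual basis with respect to $B$). $\bar\Omega_G=\sum_{j\in I_{\mathfrak g}}X_j^2\in U(\mathfrak g_{\mathbb C})$. **Hermitian module.** $V$ carries a hermitian product with $\langle\tau(X)u,v\rangle_V+\langle u,\tau(X)v\rangle_V=0$ for all $X\in\mathfrak g$, $u,v\in V$. **Complex.** $C^q(\mathfrak g;V)=\mathrm{Hom}(\Lambda^q\mathfrak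 g,V)\cong V\otimes\wedge^q\mathfrak g^*_{\mathbb C}$ with the hermitian product induced by those of $V$ and $\mathfrak g$. The differential is $d=d_\circ+d_\wedge$, where for arbitrary $W_0,\dots,W_q\in\mathfrak g$ $$(d_\circ f)(W_0,\dots,W_q)=\sum_i(-1)^i\tau(W_i)f(W_0,\dots,\hat{W_i},\dots,W_q),$$ $$(d_\wedge f)(W_0,\dots,W_q)=\sum_{i<j}(-1)^{i+j}f([W_i,W_j],W_0,\dots,\hat{W_i},\dots,\hat{W_j},\dots,W_q).$$ $\delta_\circ,\delta_\wedge$ are the formal adjoints, $\delta=\delta_\circ+\delta_\wedge$, and $\Delta=d\delta+\delta d=\Delta_\circ+\Delta_\wedge+\Delta_{\circ,\wedge}+\Delta_{\wedge,\circ}$ with $\Delta_\circ=d_\circ\delta_\circ+\delta_\circ d_\circ$, $\Delta_\wedge=d_\wedge\delta_\wedge+\delta_\wedge d_\wedge$, $\Delta_{\circ,\wedge}=d_\circ\delta_\wedge+\delta_\wedge d_\circ$, $\Delta_{\wedge,\circ}=d_\wedge\delta_\circ+\delta_\circ d_\wedge$. $\Delta_1$ is the restriction of $\Delta$ to $C^1$. Put $\square_\circ:=\Delta_\circ+\tau(\bar\Omega_G)$. **Coadjoint actions.** $(\mathrm{coad}X\,l)(Y)=l([Y,X])$ for $l\in\mathfrak g^*_{\mathbb C}$. $\mathrm{coad}^*$ is the dual representation of $\mathrm{coad}$, realized on $\mathfrak g^*_{\mathbb C}$ through the inner product: $((\mathrm{coad}^*X)l,l')=-(l,(\mathrm{coad}X)l')$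 for $X\in\mathfrak g$; thus $\mathrm{coad}^*=\mathrm{coad}$ on $\mathfrak k$ and $\mathrm{coad}^*=-\mathrm{coad}$ on $\mathfrak p$. Both extend to $\wedge^*\mathfrak g_{\mathbb C}^*$ as derivations, act on $C^q(\mathfrak g;V)$ through the exterior factor, and extend to $U(\mathfrak g_{\mathbb C})$; likewise $\tau$ extends to $U(\mathfrak g_{\mathbb C})$. "By derivation" in (I) means $$\square_\circ(v\otimes\omega_1\wedge\omega_2)=\square_\circ(v\otimes\omega_1)\wedge\omega_2+\omega_1\wedge\square_\circ(v\otimes\omega_2)$$ for $v\in V$, $\omega_1\in\wedge^p\mathfrak k^*$, $\omega_2\in\wedge^q\mathfrak p^*$.
   Formalization: The printed claims being false, (II) reads Δ_∧ = -½ Σ coad*(X_j)coad(X_j); the matrices of Δ_{∘,∧} and Δ_{∧,∘} are interchanged; D_g preserves C^{p,q} for p+q≤1 and in general maps it into C^{p-2,q+2}+C^{p,q}+C^{p+2,q-2}. *)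

theory Defs
  imports
    Complex_Main
    "HOL-Combinatorics.Permutations"
    "HOL-Library.Function_Algebras"
    "HOL-Library.Set_Algebras"
begin

section \<open>Reductive data and hermitian modules\<close>

text \<open>
  The real Lie algebra is the whole type \<open>'g\<close>, the module is the whole type \<open>'v\<close>, which is a
  complex vector space under \<open>scl\<close> (of arbitrary dimension). The family \<open>bas\<close>, indexed by
  the disjoint union of \<open>idx_k\<close> and \<open>idx_p\<close>, is the orthonormal basis of the Lie algebra.
\<close>

record ('g, 'v, 'i) lie_data =
  brk :: "'g \<Rightarrow> 'g \<Rightarrow> 'g"
  frm :: "'g \<Rightarrow> 'g \<Rightarrow> real"
  theta :: "'g \<Rightarrow> 'g"
  scl :: "complex \<Rightarrow> 'v \<Rightarrow> 'v"
  herm :: "'v \<Rightarrow> 'v \<Rightarrow> complex"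
  tau :: "'g \<Rightarrow> 'v \<Rightarrow> 'v"
  idx_k :: "'i set"
  idx_p :: "'i set"
  bas :: "'i \<Rightarrow> 'g"

abbreviation idx :: "('g, 'v, 'i) lie_data \<Rightarrow> 'i set" where
  "idx R \<equiv> idx_k R \<union> idx_p R"

definition lie_algebra :: "('g::real_vector \<Rightarrow> 'g \<Rightarrow> 'g) \<Rightarrow> bool" where
  "lie_algebra br \<longleftrightarrow>
     (\<forall>x. linear (br x)) \<and> (\<forall>y. linear (\<lambda>x. br x y)) \<and>
     (\<forall>x. br x x = 0) \<and>
     (\<forall>x y z. br x (br y z) + br y (br z x) + br z (br x y) = 0)"

definition lie_ideal :: "('g::real_vector \<Rightarrow> 'g \<Rightarrow> 'g) \<Rightarrow> 'g set \<Rightarrow> bool" where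
  "lie_ideal br S \<longleftrightarrow> subspace S \<and> (\<forall>x. \<forall>s\<in>S. br x s \<in> S)"

text \<open>A Lie algebra is reductive if every ideal has a complementary ideal.\<close>

definition reductive_lie_algebra :: "('g::real_vector \<Rightarrow> 'g \<Rightarrow> 'g) \<Rightarrow> bool" where
  "reductive_lie_algebra br \<longleftrightarrow>
     lie_algebra br \<and> (\<exists>S::'g set. finite S \<and> span S = UNIV) \<and>
     (\<forall>a. lie_ideal br a \<longrightarrow> (\<exists>b. lie_ideal br b \<and> a \<inter> b = {0} \<and> a + b = UNIV))"

text \<open>The trace of an endomorphism of a finite-dimensional space, computed in some basis.\<close>

definition lin_trace :: "('g::real_vector \<Rightarrow> 'g) \<Rightarrow> real" where
  "lin_trace f = (\<Sum>b\<in>extend_basis {}. representation (extend_basis {}) (f b) b)"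

definition killing_form :: "('g::real_vector \<Rightarrow> 'g \<Rightarrow> 'g) \<Rightarrow> 'g \<Rightarrow> 'g \<Rightarrow> real" where
  "killing_form br x y = lin_trace (\<lambda>z. br x (br y z))"

definition derived_algebra :: "('g::real_vector \<Rightarrow> 'g \<Rightarrow> 'g) \<Rightarrow> 'g set" where
  "derived_algebra br = span {br x y | x y. True}"

definition kpart :: "('g::real_vector, 'v, 'i) lie_data \<Rightarrow> 'g set" where
  "kpart R = {x. theta R x = x}"

definition ppart :: "('g::real_vector, 'v, 'i) lie_data \<Rightarrow> 'g set" where
  "ppart R = {x. theta R x = - x}"

definition Btheta :: "('g::real_vector, 'v, 'i) lie_data \<Rightarrow> 'g \<Rightarrow> 'g \<Rightarrow> real" where
  "Btheta R x y = - frm R x (theta R y)"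

text \<open>
  The form on the complexification takes real values on the Lie algebra and is therefore given by its
  restriction \<open>frm\<close>. Invariance under a connected group is stated infinitesimally.
  Symmetry of \<open>frm\<close> and its invariance under \<open>theta\<close> express that \<open>Btheta\<close> is symmetric.
\<close>

definition reductive_data :: "('g::real_vector, 'v, 'i) lie_data \<Rightarrow> bool" where
  "reductive_data R \<longleftrightarrow>
     reductive_lie_algebra (brk R) \<and>
     (\<forall>x. linear (frm R x)) \<and> (\<forall>x y. frm R x y = frm R y x) \<and>
     (\<forall>x y z. frm R (brk R x y) z + frm R y (brk R x z) = 0) \<and>
     (\<forall>x. (\<forall>y. frm R x y = 0) \<longrightarrow> x = 0) \<and>
     (\<forall>x\<in>derived_algebra (brk R). \<forall>y\<in>derived_algebra (brk R).
        frm R x y = killing_form (brk R) x y) \<and>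
     linear (theta R) \<and> (\<forall>x. theta R (theta R x) = x) \<and>
     (\<forall>x y. theta R (brk R x y) = brk R (theta R x) (theta R y)) \<and>
     (\<forall>x y. frm R (theta R x) (theta R y) = frm R x y) \<and>
     (\<forall>x\<in>kpart R. x \<noteq> 0 \<longrightarrow> frm R x x < 0) \<and>
     (\<forall>x\<in>ppart R. x \<noteq> 0 \<longrightarrow> frm R x x > 0)"

definition adapted_basis :: "('g::real_vector, 'v, 'i) lie_data \<Rightarrow> bool" where
  "adapted_basis R \<longleftrightarrow>
     finite (idx_k R) \<and> finite (idx_p R) \<and> idx_k R \<inter> idx_p R = {} \<and>
     span (bas R ` idx_k R) = kpart R \<and> span (bas R ` idx_p R) = ppart R \<and>
     (\<forall>i\<in>idx R. \<forall>j\<in>idx R. Btheta R (bas R i) (bas R j) = (if i = j then 1 else 0))"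

definition hermitian_product ::
    "(complex \<Rightarrow> 'v::ab_group_add \<Rightarrow> 'v) \<Rightarrow> ('v \<Rightarrow> 'v \<Rightarrow> complex) \<Rightarrow> bool" where
  "hermitian_product sc h \<longleftrightarrow>
     (\<forall>a u b v w. h (sc a u + sc b v) w = a * h u w + b * h v w) \<and>
     (\<forall>u v. h u v = cnj (h v u)) \<and>
     (\<forall>v. v \<noteq> 0 \<longrightarrow> Re (h v v) > 0)"

definition hermitian_module :: "('g::real_vector, 'v::ab_group_add, 'i) lie_data \<Rightarrow> bool" where
  "hermitian_module R \<longleftrightarrow>
     vector_space (scl R) \<and> hermitian_product (scl R) (herm R) \<and>
     (\<forall>x a u b v. tau R x (scl R a u + scl R b v) = scl R a (tau R x u) + scl R b (tau R x v)) \<and>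
     (\<forall>a x b y u. tau R (a *\<^sub>R x + b *\<^sub>R y) u =
        scl R (complex_of_real a) (tau R x u) + scl R (complex_of_real b) (tau R y u)) \<and>
     (\<forall>x y u. tau R (brk R x y) u = tau R x (tau R y u) - tau R y (tau R x u)) \<and>
     (\<forall>x u v. herm R (tau R x u) v + herm R u (tau R x v) = 0)"

section \<open>Cochains and the bigrading\<close>

text \<open>
  An alternating \<open>q\<close>-form is a function on lists of Lie algebra elements that vanishes on lists of
  length other than \<open>q\<close>. The scalar multiplication \<open>sc\<close> of the coefficient space is a
  parameter: coefficients are the module or, with \<open>sc = (*)\<close>, the complex numbers.
\<close>

definition alt_forms ::
    "(complex \<Rightarrow> 'w::ab_group_add \<Rightarrow> 'w) \<Rightarrow> nat \<Rightarrow> ('g::real_vector list \<Rightarrow> 'w) set" where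
  "alt_forms sc q = {f.
     (\<forall>Ws. length Ws \<noteq> q \<longrightarrow> f Ws = 0) \<and>
     (\<forall>Ws i a x b y. length Ws = q \<longrightarrow> i < q \<longrightarrow>
        f (Ws[i := a *\<^sub>R x + b *\<^sub>R y]) =
          sc (complex_of_real a) (f (Ws[i := x])) + sc (complex_of_real b) (f (Ws[i := y]))) \<and>
     (\<forall>Ws. length Ws = q \<longrightarrow> \<not> distinct Ws \<longrightarrow> f Ws = 0)}"

abbreviation cochains ::
    "('g::real_vector, 'v::ab_group_add, 'i) lie_data \<Rightarrow> nat \<Rightarrow> ('g list \<Rightarrow> 'v) set" where
  "cochains R q \<equiv> alt_forms (scl R) q"

text \<open>
  Forms on the tensor product of the \<open>p\<close>-th exterior power of \<open>kpart\<close> and the \<open>q\<close>-th exterior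
  power of \<open>ppart\<close>, realized as the forms of degree \<open>p + q\<close> supported on that summand of
  the exterior power of the Lie algebra. If \<open>p\<close> or \<open>q\<close> is negative, only the zero form remains.
\<close>

definition biforms ::
    "('g::real_vector, 'v, 'i) lie_data \<Rightarrow> (complex \<Rightarrow> 'w::ab_group_add \<Rightarrow> 'w) \<Rightarrow>
     int \<Rightarrow> int \<Rightarrow> ('g list \<Rightarrow> 'w) set" where
  "biforms R sc p q = {f \<in> alt_forms sc (nat (p + q)).
     \<forall>Us Ws. set Us \<subseteq> kpart R \<longrightarrow> set Ws \<subseteq> ppart R \<longrightarrow>
       (int (length Us), int (length Ws)) \<noteq> (p, q) \<longrightarrow> f (Us @ Ws) = 0}"

abbreviation bicochains ::
    "('g::real_vector, 'v::ab_group_add, 'i) lie_data \<Rightarrow> int \<Rightarrow> int \<Rightarrow> ('g list \<Rightarrow> 'v) set" where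
  "bicochains R p q \<equiv> biforms R (scl R) p q"

definition cscale ::
    "('g, 'v, 'i) lie_data \<Rightarrow> complex \<Rightarrow> ('g list \<Rightarrow> 'v) \<Rightarrow> 'g list \<Rightarrow> 'v" where
  "cscale R c f = (\<lambda>Ws. scl R c (f Ws))"

definition tensor ::
    "('g, 'v, 'i) lie_data \<Rightarrow> 'v \<Rightarrow> ('g list \<Rightarrow> complex) \<Rightarrow> 'g list \<Rightarrow> 'v" where
  "tensor R v \<omega> = (\<lambda>Ws. scl R (\<omega> Ws) v)"

text \<open>
  Exterior product of a \<open>p\<close>-form and a \<open>q\<close>-form, the coefficients being multiplied by \<open>m\<close>. With this
  normalization the product of one-forms \<open>l\<close> and \<open>l'\<close> maps \<open>[x, y]\<close> to
  \<open>l [x] * l' [y] - l [y] * l' [x]\<close>.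
\<close>

definition wedge ::
    "(complex \<Rightarrow> 'w::ab_group_add \<Rightarrow> 'w) \<Rightarrow> ('a \<Rightarrow> 'b \<Rightarrow> 'w) \<Rightarrow> nat \<Rightarrow> nat \<Rightarrow>
     ('g list \<Rightarrow> 'a) \<Rightarrow> ('g list \<Rightarrow> 'b) \<Rightarrow> 'g list \<Rightarrow> 'w" where
  "wedge sc m p q f g = (\<lambda>Ws. if length Ws \<noteq> p + q then 0 else
     sc (1 / (fact p * fact q))
       (\<Sum>\<sigma> | \<sigma> permutes {..<p + q}.
          sc (of_int (sign \<sigma>))
            (m (f (map (\<lambda>i. Ws ! \<sigma> i) [0..<p])) (g (map (\<lambda>i. Ws ! \<sigma> i) [p..<p + q])))))"

text \<open>
  The hermitian product on \<open>q\<close>-cochains induced by the orthonormal basis: the sum over all \<open>q\<close>-tuples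
  of indices counts every \<open>q\<close>-element index set \<open>q!\<close> times, so wedge products of distinct
  dual basis vectors have norm one.
\<close>

definition cochain_ip ::
    "('g, 'v, 'i) lie_data \<Rightarrow> nat \<Rightarrow> ('g list \<Rightarrow> 'v) \<Rightarrow> ('g list \<Rightarrow> 'v) \<Rightarrow> complex" where
  "cochain_ip R q f g =
     (\<Sum>js | length js = q \<and> set js \<subseteq> idx R.
        herm R (f (map (bas R) js)) (g (map (bas R) js))) / fact q"

section \<open>Differentials, adjoints and Laplacians\<close>

definition del_nth :: "nat \<Rightarrow> 'a list \<Rightarrow> 'a list" where
  "del_nth i xs = take i xs @ drop (Suc i) xs"

definition d_circ ::
    "('g, 'v::ab_group_add, 'i) lie_data \<Rightarrow> ('g list \<Rightarrow> 'v) \<Rightarrow> 'g list \<Rightarrow> 'v" where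
  "d_circ R f = (\<lambda>Ws. \<Sum>i<length Ws. scl R ((- 1) ^ i) (tau R (Ws ! i) (f (del_nth i Ws))))"

definition d_wedge ::
    "('g, 'v::ab_group_add, 'i) lie_data \<Rightarrow> ('g list \<Rightarrow> 'v) \<Rightarrow> 'g list \<Rightarrow> 'v" where
  "d_wedge R f = (\<lambda>Ws. \<Sum>j<length Ws. \<Sum>i<j.
     scl R ((- 1) ^ (i + j)) (f (brk R (Ws ! i) (Ws ! j) # del_nth i (del_nth j Ws))))"

definition d_total ::
    "('g, 'v::ab_group_add, 'i) lie_data \<Rightarrow> ('g list \<Rightarrow> 'v) \<Rightarrow> 'g list \<Rightarrow> 'v" where
  "d_total R f = d_circ R f + d_wedge R f"

text \<open>
  The formal adjoint, on cochains of degree \<open>q\<close>, of an operator \<open>D\<close> that raises degrees by one.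
\<close>

definition formal_adjoint ::
    "('g::real_vector, 'v::ab_group_add, 'i) lie_data \<Rightarrow>
     (('g list \<Rightarrow> 'v) \<Rightarrow> ('g list \<Rightarrow> 'v)) \<Rightarrow> nat \<Rightarrow> ('g list \<Rightarrow> 'v) \<Rightarrow> 'g list \<Rightarrow> 'v" where
  "formal_adjoint R D q g = (if q = 0 then 0 else
     (THE h. h \<in> cochains R (q - 1) \<and>
        (\<forall>f\<in>cochains R (q - 1). cochain_ip R q (D f) g = cochain_ip R (q - 1) f h)))"

definition delta_circ ::
    "('g::real_vector, 'v::ab_group_add, 'i) lie_data \<Rightarrow> nat \<Rightarrow> ('g list \<Rightarrow> 'v) \<Rightarrow> 'g list \<Rightarrow> 'v" where
  "delta_circ R q = formal_adjoint R (d_circ R) q"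

definition delta_wedge ::
    "('g::real_vector, 'v::ab_group_add, 'i) lie_data \<Rightarrow> nat \<Rightarrow> ('g list \<Rightarrow> 'v) \<Rightarrow> 'g list \<Rightarrow> 'v" where
  "delta_wedge R q = formal_adjoint R (d_wedge R) q"

definition delta_total ::
    "('g::real_vector, 'v::ab_group_add, 'i) lie_data \<Rightarrow> nat \<Rightarrow> ('g list \<Rightarrow> 'v) \<Rightarrow> 'g list \<Rightarrow> 'v" where
  "delta_total R q f = delta_circ R q f + delta_wedge R q f"

text \<open>In the following operators \<open>n\<close> is the degree of the cochain they are applied to.\<close>

definition lap_circ ::
    "('g::real_vector, 'v::ab_group_add, 'i) lie_data \<Rightarrow> nat \<Rightarrow> ('g list \<Rightarrow> 'v) \<Rightarrow> 'g list \<Rightarrow> 'v" where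
  "lap_circ R n f = d_circ R (delta_circ R n f) + delta_circ R (n + 1) (d_circ R f)"

definition lap_wedge ::
    "('g::real_vector, 'v::ab_group_add, 'i) lie_data \<Rightarrow> nat \<Rightarrow> ('g list \<Rightarrow> 'v) \<Rightarrow> 'g list \<Rightarrow> 'v" where
  "lap_wedge R n f = d_wedge R (delta_wedge R n f) + delta_wedge R (n + 1) (d_wedge R f)"

definition lap_circ_wedge ::
    "('g::real_vector, 'v::ab_group_add, 'i) lie_data \<Rightarrow> nat \<Rightarrow> ('g list \<Rightarrow> 'v) \<Rightarrow> 'g list \<Rightarrow> 'v" where
  "lap_circ_wedge R n f = d_circ R (delta_wedge R n f) + delta_wedge R (n + 1) (d_circ R f)"

definition lap_wedge_circ ::
    "('g::real_vector, 'v::ab_group_add, 'i) lie_data \<Rightarrow> nat \<Rightarrow> ('g list \<Rightarrow> 'v) \<Rightarrow> 'g list \<Rightarrow> 'v" where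
  "lap_wedge_circ R n f = d_wedge R (delta_circ R n f) + delta_circ R (n + 1) (d_wedge R f)"

definition laplacian ::
    "('g::real_vector, 'v::ab_group_add, 'i) lie_data \<Rightarrow> nat \<Rightarrow> ('g list \<Rightarrow> 'v) \<Rightarrow> 'g list \<Rightarrow> 'v" where
  "laplacian R n f = d_total R (delta_total R n f) + delta_total R (n + 1) (d_total R f)"

section \<open>Coadjoint actions and quadratic elements of the enveloping algebra\<close>

text \<open>The complex dual space, as the space of real-linear complex-valued functionals.\<close>

definition cdual :: "('g::real_vector \<Rightarrow> complex) set" where
  "cdual = {l. \<forall>a x b y. l (a *\<^sub>R x + b *\<^sub>R y) = complex_of_real a * l x + complex_of_real b * l y}"

definition cdual_ip ::
    "('g, 'v, 'i) lie_data \<Rightarrow> ('g \<Rightarrow> complex) \<Rightarrow> ('g \<Rightarrow> complex) \<Rightarrow> complex" where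
  "cdual_ip R l m = (\<Sum>j\<in>idx R. l (bas R j) * cnj (m (bas R j)))"

definition coad :: "('g, 'v, 'i) lie_data \<Rightarrow> 'g \<Rightarrow> ('g \<Rightarrow> complex) \<Rightarrow> 'g \<Rightarrow> complex" where
  "coad R x l = (\<lambda>y. l (brk R y x))"

definition coad_star ::
    "('g::real_vector, 'v, 'i) lie_data \<Rightarrow> 'g \<Rightarrow> ('g \<Rightarrow> complex) \<Rightarrow> 'g \<Rightarrow> complex" where
  "coad_star R x l = (THE l'. l' \<in> cdual \<and>
     (\<forall>m\<in>cdual. cdual_ip R l' m = - cdual_ip R l (coad R x m)))"

text \<open>
  The extension of an endomorphism \<open>a\<close> of \<open>cdual\<close> to cochains as a derivation on the exterior
  factor. The functionals \<open>\<lambda>y. Btheta R y (bas R j)\<close> form the dual basis. On the cochain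
  \<open>v \<otimes> l\<^sub>1 \<and> \<dots> \<and> l\<^sub>q\<close> the formula gives the sum over \<open>i\<close> of the cochains in which \<open>l\<^sub>i\<close> is
  replaced by \<open>a l\<^sub>i\<close>.
\<close>

definition deriv_ext ::
    "('g::real_vector, 'v::ab_group_add, 'i) lie_data \<Rightarrow>
     (('g \<Rightarrow> complex) \<Rightarrow> 'g \<Rightarrow> complex) \<Rightarrow> ('g list \<Rightarrow> 'v) \<Rightarrow> 'g list \<Rightarrow> 'v" where
  "deriv_ext R a f = (\<lambda>Ws. \<Sum>i<length Ws. \<Sum>j\<in>idx R.
     scl R (a (\<lambda>y. complex_of_real (Btheta R y (bas R j))) (Ws ! i)) (f (Ws[i := bas R j])))"

definition coad_ext ::
    "('g::real_vector, 'v::ab_group_add, 'i) lie_data \<Rightarrow> 'g \<Rightarrow> ('g list \<Rightarrow> 'v) \<Rightarrow> 'g list \<Rightarrow> 'v" where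
  "coad_ext R x = deriv_ext R (coad R x)"

definition coad_star_ext ::
    "('g::real_vector, 'v::ab_group_add, 'i) lie_data \<Rightarrow> 'g \<Rightarrow> ('g list \<Rightarrow> 'v) \<Rightarrow> 'g list \<Rightarrow> 'v" where
  "coad_star_ext R x = deriv_ext R (coad_star R x)"

definition tau_ext ::
    "('g, 'v, 'i) lie_data \<Rightarrow> 'g \<Rightarrow> ('g list \<Rightarrow> 'v) \<Rightarrow> 'g list \<Rightarrow> 'v" where
  "tau_ext R x f = (\<lambda>Ws. tau R x (f Ws))"

text \<open>
  The action of the element \<open>\<Sum>i\<in>J. Y i * Y' i\<close> of the enveloping algebra under the extension of a
  representation \<open>\<rho>\<close> to an algebra homomorphism.
\<close>

definition quad_action ::
    "('g \<Rightarrow> 'f \<Rightarrow> 'f::comm_monoid_add) \<Rightarrow> 'j set \<Rightarrow> ('j \<Rightarrow> 'g) \<Rightarrow> ('j \<Rightarrow> 'g) \<Rightarrow> 'f \<Rightarrow> 'f" where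
  "quad_action \<rho> J Y Y' f = (\<Sum>i\<in>J. \<rho> (Y i) (\<rho> (Y' i) f))"

text \<open>Biorthogonality makes \<open>Z\<close> linearly independent and \<open>Z'\<close> its dual basis.\<close>

definition dual_bases ::
    "('g::real_vector, 'v, 'i) lie_data \<Rightarrow> 'j set \<Rightarrow> ('j \<Rightarrow> 'g) \<Rightarrow> ('j \<Rightarrow> 'g) \<Rightarrow> bool" where
  "dual_bases R J Z Z' \<longleftrightarrow> finite J \<and> span (Z ` J) = UNIV \<and>
     (\<forall>i\<in>J. \<forall>j\<in>J. frm R (Z i) (Z' j) = (if i = j then 1 else 0))"

definition tau_Omega_bar ::
    "('g, 'v::ab_group_add, 'i) lie_data \<Rightarrow> ('g list \<Rightarrow> 'v) \<Rightarrow> 'g list \<Rightarrow> 'v" where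
  "tau_Omega_bar R = quad_action (tau_ext R) (idx R) (bas R) (bas R)"

definition box_circ ::
    "('g::real_vector, 'v::ab_group_add, 'i) lie_data \<Rightarrow> nat \<Rightarrow> ('g list \<Rightarrow> 'v) \<Rightarrow> 'g list \<Rightarrow> 'v" where
  "box_circ R n f = lap_circ R n f + tau_Omega_bar R f"

definition A_g ::
    "('g, 'v::ab_group_add, 'i) lie_data \<Rightarrow> ('g list \<Rightarrow> 'v) \<Rightarrow> 'g list \<Rightarrow> 'v" where
  "A_g R f = - tau_Omega_bar R f"

definition B_k ::
    "('g::real_vector, 'v::ab_group_add, 'i) lie_data \<Rightarrow> ('g list \<Rightarrow> 'v) \<Rightarrow> 'g list \<Rightarrow> 'v" where
  "B_k R f = (\<Sum>k\<in>idx_k R. tau_ext R (bas R k) (coad_star_ext R (bas R k) f))"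

definition C_p ::
    "('g::real_vector, 'v::ab_group_add, 'i) lie_data \<Rightarrow> ('g list \<Rightarrow> 'v) \<Rightarrow> 'g list \<Rightarrow> 'v" where
  "C_p R f = (\<Sum>\<alpha>\<in>idx_p R. tau_ext R (bas R \<alpha>) (coad_star_ext R (bas R \<alpha>) f))"

text \<open>
  Half the Casimir element, computed from the dual bases \<open>Z\<close> and \<open>Z'\<close>, acting through \<open>coad_star\<close>.
  Since \<open>coad_star\<close> is \<open>coad\<close> on \<open>kpart\<close> and \<open>- coad\<close> on \<open>ppart\<close>, while the form has opposite signs
  there, this is \<open>- 1/2\<close> times the sum of \<open>coad_star x \<circ> coad x\<close> over the orthonormal basis.
  It need not preserve the bidegree of forms of degree greater than one.
\<close>

definition D_g ::
    "('g::real_vector, 'v::ab_group_add, 'i) lie_data \<Rightarrow> 'j set \<Rightarrow> ('j \<Rightarrow> 'g) \<Rightarrow> ('j \<Rightarrow> 'g) \<Rightarrow>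
     ('g list \<Rightarrow> 'v) \<Rightarrow> 'g list \<Rightarrow> 'v" where
  "D_g R J Z Z' f = cscale R (1 / 2) (quad_action (coad_star_ext R) J Z Z' f)"

text \<open>
  The operator \<open>T\<close> on one-cochains is given by the block matrix with rows \<open>a b\<close> and \<open>c d\<close>, with
  respect to the decomposition into forms on \<open>kpart\<close> (first) and on \<open>ppart\<close> (second).
\<close>

definition acts_by_matrix ::
    "('g::real_vector, 'v::ab_group_add, 'i) lie_data \<Rightarrow>
     (('g list \<Rightarrow> 'v) \<Rightarrow> ('g list \<Rightarrow> 'v)) \<Rightarrow>
     (('g list \<Rightarrow> 'v) \<Rightarrow> ('g list \<Rightarrow> 'v)) \<Rightarrow> (('g list \<Rightarrow> 'v) \<Rightarrow> ('g list \<Rightarrow> 'v)) \<Rightarrow>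
     (('g list \<Rightarrow> 'v) \<Rightarrow> ('g list \<Rightarrow> 'v)) \<Rightarrow> (('g list \<Rightarrow> 'v) \<Rightarrow> ('g list \<Rightarrow> 'v)) \<Rightarrow> bool" where
  "acts_by_matrix R T a b c d \<longleftrightarrow>
     (\<forall>f\<in>bicochains R 1 0. \<forall>g\<in>bicochains R 0 1.
        a f \<in> bicochains R 1 0 \<and> b g \<in> bicochains R 1 0 \<and>
        c f \<in> bicochains R 0 1 \<and> d g \<in> bicochains R 0 1 \<and>
        T (f + g) = (a f + b g) + (c f + d g))"

end

theory Submission
  imports Defs
begin

text \<open>
  Every operator involved is compatible with the contraction \<open>f \<mapsto> f(x, -)\<close>, so identities between
  operators on cochains reduce to induction on the degree. Write \<open>L\<^sub>x\<close> for the extension of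
  \<open>coad x\<close> and \<open>\<epsilon> F\<close> for \<open>\<Sum>\<^sub>i (-1)\<^sup>i F(W\<^sub>i)(\<dots>, W\<^sub>i omitted, \<dots>)\<close>. Then
  \<open>d\<^sub>\<circ> = \<epsilon> \<tau>\<close> and \<open>d\<^sub>\<and> = 1/2 \<epsilon> L\<close>, and the adjoint of \<open>\<epsilon>\<close> is the family of contractions
  with the orthonormal basis. As \<open>\<tau> x\<close> is skew and the adjoint of \<open>L\<^sub>x\<close> is \<open>- L\<^bsub>\<theta> x\<^esub>\<close>, this gives
  both codifferentials. The anticommutator of \<open>\<epsilon>\<close> with contractions yields \<open>\<Delta>\<^sub>\<circ>\<close>; Cartan's formula and
  the commutation of \<open>d\<^sub>\<and>\<close> with \<open>L\<^sub>x\<close> yield \<open>\<Delta>\<^sub>\<and> = - 1/2 \<Sum>\<^sub>j L\<^bsub>\<theta> X\<^sub>j\<^esub> L\<^bsub>X\<^sub>j\<^esub>\<close>.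
\<close>

section \<open>Cochains and contractions\<close>

text \<open>The module may have infinite dimension, so an adjoint does not exist automatically: the
  explicit codifferentials serve as witnesses, and definiteness gives uniqueness. The opposite signs
  of \<open>box_circ\<close> on forms on \<open>kpart\<close> and on \<open>ppart\<close> have one
  source. \<open>box_circ\<close> puts X_j into the slot of W_i and applies - \<tau>[W_i, X_j]; the
  sum of \<tau>(X_j) coad*(X_j) puts X_j into the same slot and applies - \<tau>[W_i, \<theta> X_j].
  A form of pure type sees only basis vectors on which \<theta> is 1, or only those on which it is
  -1. In (II) the 1/2 comes from counting each pair of arguments twice in
  \<open>\<epsilon> L\<close>, the minus from the adjoint of a Lie derivative. The resulting
  operator is \<open>D_g\<close>; the English formula in (II) lacks this factor -1/2. Also, the
  entries \<open>C_p\<close> of the two mixed Laplacians have the opposite signs to the English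
  matrices. They cancel in the sum, so the matrix of the full Laplacian is the same.\<close>

definition contract :: "'a \<Rightarrow> ('a list \<Rightarrow> 'w) \<Rightarrow> 'a list \<Rightarrow> 'w" where
  "contract x f = (\<lambda>Ws. f (x # Ws))"

text \<open>Written without a basis, unlike \<open>coad_ext\<close>, so that it can be studied
  before any inner product enters; the two agree on cochains.\<close>

definition lie_der ::
    "('a \<Rightarrow> 'a \<Rightarrow> 'a) \<Rightarrow> 'a \<Rightarrow> ('a list \<Rightarrow> 'w::comm_monoid_add) \<Rightarrow> 'a list \<Rightarrow> 'w" where
  "lie_der br x f = (\<lambda>Ws. \<Sum>i<length Ws. f (Ws[i := br (Ws ! i) x]))"

text \<open>The operator \<open>\<epsilon>\<close> of the overview. Applied to w |-> l(w) \<omega>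
  for a one-form l, it is the exterior product of l and \<omega>, with no factorial to divide
  by.\<close>

definition antisymm ::
    "(complex \<Rightarrow> 'w::comm_monoid_add \<Rightarrow> 'w) \<Rightarrow> ('a \<Rightarrow> 'a list \<Rightarrow> 'w) \<Rightarrow> 'a list \<Rightarrow> 'w" where
  "antisymm sc F = (\<lambda>Ws. \<Sum>i<length Ws. sc ((- 1) ^ i) (F (Ws ! i) (del_nth i Ws)))"

lemma contract_apply: "contract x f Ws = f (x # Ws)"
  by (simp add: contract_def)

lemma sum_fun_apply: "(\<Sum>i\<in>A. f i) x = (\<Sum>i\<in>A. (f i x :: 'b::comm_monoid_add))"
  by (induction A rule: infinite_finite_induct) auto

lemma del_nth_0 [simp]: "del_nth 0 (x # xs) = xs"
  by (simp add: del_nth_def)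

lemma del_nth_Suc [simp]: "del_nth (Suc i) (x # xs) = x # del_nth i xs"
  by (simp add: del_nth_def)

lemma lie_der_Nil [simp]: "lie_der br x f [] = 0"
  by (simp add: lie_der_def)

lemma lie_der_Cons:
  "lie_der br x f (w # Ws) = f (br w x # Ws) + lie_der br x (contract w f) Ws"
  by (simp add: lie_der_def sum.lessThan_Suc_shift contract_def del: sum.lessThan_Suc)

lemma antisymm_Nil [simp]: "antisymm sc F [] = 0"
  by (simp add: antisymm_def)

lemma list_fun_eqI:
  assumes "f [] = g []" and "\<And>x. contract x f = contract x g"
  shows "f = g"
proof
  fix Ws show "f Ws = g Ws"
    using assms(1) fun_cong[OF assms(2)] by (cases Ws) (auto simp: contract_def)
qed

lemma contract_plus: "contract x (f + g) = contract x f + contract x g"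
  by (auto simp: contract_def)

lemma contract_zero [simp]: "contract x 0 = 0"
  by (auto simp: contract_def)

lemma lie_der_plus: "lie_der br x (f + g) = lie_der br x f + lie_der br x g"
  by (auto simp: lie_der_def sum.distrib)

lemma lie_der_zero [simp]: "lie_der br x 0 = 0"
  by (auto simp: lie_der_def)

lemma lie_der_uminus:
  fixes f :: "_ \<Rightarrow> 'w::ab_group_add"
  shows "lie_der br x (- f) = - lie_der br x f"
  by (auto simp: lie_der_def sum_negf)

lemma lie_der_sum: "lie_der br x (\<Sum>i\<in>A. f i) = (\<Sum>i\<in>A. lie_der br x (f i))"
  by (induction A rule: infinite_finite_induct) (simp_all only: lie_der_plus lie_der_zero sum.infinite sum.empty sum.insert not_False_eq_True)

lemma contract_lie_der:
  "contract y (lie_der br x f) = lie_der br x (contract y f) + contract (br y x) f"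
  by (auto simp: contract_def lie_der_Cons add.commute fun_eq_iff)

locale complex_space = vector_space sc
  for sc :: "complex \<Rightarrow> 'w::ab_group_add \<Rightarrow> 'w"
begin

text \<open>The summand with index 0 feeds \<open>x\<close> to \<open>F\<close>; in the others
  \<open>x\<close> stays in front and the index drops by one, which costs the sign.\<close>

lemma antisymm_Cons:
  "antisymm sc F (x # Ws) = F x Ws - antisymm sc (\<lambda>w. contract x (F w)) Ws"
proof -
  have "antisymm sc F (x # Ws) =
      F x Ws + (\<Sum>i<length Ws. - sc ((- 1) ^ i) (F (Ws ! i) (x # del_nth i Ws)))"
    by (simp add: antisymm_def sum.lessThan_Suc_shift del: sum.lessThan_Suc)
  then show ?thesis
    by (simp add: antisymm_def contract_def sum_negf)
qed

lemma contract_antisymm: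
  "contract x (antisymm sc F) = F x - antisymm sc (\<lambda>w. contract x (F w))"
  by (auto simp: contract_apply antisymm_Cons fun_eq_iff)

lemma antisymm_plus: "antisymm sc (\<lambda>w. F w + G w) = antisymm sc F + antisymm sc G"
  by (auto simp: antisymm_def scale_right_distrib sum.distrib)

lemma antisymm_uminus: "antisymm sc (\<lambda>w. - F w) = - antisymm sc F"
  by (auto simp: antisymm_def sum_negf)

lemma antisymm_diff: "antisymm sc (\<lambda>w. F w - G w) = antisymm sc F - antisymm sc G"
  by (auto simp: antisymm_def scale_right_diff_distrib sum_subtractf)

lemma antisymm_zero: "antisymm sc (\<lambda>w. 0) = 0"
  by (auto simp: antisymm_def)

lemma antisymm_sum: "antisymm sc (\<lambda>w. \<Sum>i\<in>A. F i w) = (\<Sum>i\<in>A. antisymm sc (F i))"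
  by (induction A rule: infinite_finite_induct) (simp_all only: antisymm_plus antisymm_zero sum.infinite sum.empty sum.insert not_False_eq_True)

lemma alt_formsD_linear:
  assumes "f \<in> alt_forms sc q" "i < length Ws"
  shows "f (Ws[i := a *\<^sub>R x + b *\<^sub>R y]) =
    sc (complex_of_real a) (f (Ws[i := x])) + sc (complex_of_real b) (f (Ws[i := y]))"
  using assms by (cases "length Ws = q") (auto simp: alt_forms_def)

lemma alt_formsD_length: "f \<in> alt_forms sc q \<Longrightarrow> length Ws \<noteq> q \<Longrightarrow> f Ws = 0"
  by (auto simp: alt_forms_def)

lemma alt_formsD_distinct: "f \<in> alt_forms sc q \<Longrightarrow> \<not> distinct Ws \<Longrightarrow> f Ws = 0"
  by (cases "length Ws = q") (auto simp: alt_forms_def)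

lemma alt_forms_zero: "0 \<in> alt_forms sc q"
  by (auto simp: alt_forms_def)

lemma alt_forms_plus: "f \<in> alt_forms sc q \<Longrightarrow> g \<in> alt_forms sc q \<Longrightarrow> f + g \<in> alt_forms sc q"
  by (auto simp: alt_forms_def scale_right_distrib)

lemma alt_forms_uminus: "f \<in> alt_forms sc q \<Longrightarrow> - f \<in> alt_forms sc q"
  by (auto simp: alt_forms_def)

lemma alt_forms_diff: "f \<in> alt_forms sc q \<Longrightarrow> g \<in> alt_forms sc q \<Longrightarrow> f - g \<in> alt_forms sc q"
  unfolding diff_conv_add_uminus by (intro alt_forms_plus alt_forms_uminus)

lemma alt_forms_sum:
  "(\<And>i. i \<in> A \<Longrightarrow> f i \<in> alt_forms sc q) \<Longrightarrow> (\<Sum>i\<in>A. f i) \<in> alt_forms sc q"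
  by (induction A rule: infinite_finite_induct) (auto simp: alt_forms_zero intro: alt_forms_plus)

lemma alt_forms_scale: "f \<in> alt_forms sc q \<Longrightarrow> (\<lambda>Ws. sc c (f Ws)) \<in> alt_forms sc q"
  by (auto simp: alt_forms_def scale_right_distrib mult.commute)

lemma alt_forms_update_sum:
  assumes "f \<in> alt_forms sc q" "i < length Ws"
  shows "f (Ws[i := (\<Sum>j\<in>A. c j *\<^sub>R X j)]) = (\<Sum>j\<in>A. sc (complex_of_real (c j)) (f (Ws[i := X j])))"
proof (induction A rule: infinite_finite_induct)
  case (insert a A)
  then show ?case
    using alt_formsD_linear[OF assms, of "c a" "X a" 1 "\<Sum>j\<in>A. c j *\<^sub>R X j"] by simp
\<comment> \<open>An empty sum is 0, and linearity with both coefficients 0 makes the value there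
  vanish.\<close>
qed (use alt_formsD_linear[OF assms, of 0 0 0 0] in auto)

lemma alt_forms_contract_linear:
  assumes "f \<in> alt_forms sc q"
  shows "contract (a *\<^sub>R x + b *\<^sub>R y) f Ws =
    sc (complex_of_real a) (contract x f Ws) + sc (complex_of_real b) (contract y f Ws)"
  using alt_formsD_linear[OF assms, of 0 "x # Ws"] by (simp add: contract_def)

lemma alt_forms_contract_sum:
  assumes "f \<in> alt_forms sc q"
  shows "contract (\<Sum>j\<in>A. c j *\<^sub>R X j) f Ws =
    (\<Sum>j\<in>A. sc (complex_of_real (c j)) (contract (X j) f Ws))"
  using alt_forms_update_sum[OF assms, of 0 "0 # Ws"] by (simp add: contract_def)

lemma alt_forms_contract_add:
  "f \<in> alt_forms sc q \<Longrightarrow> contract (x + y) f = contract x f + contract y f"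
  using alt_forms_contract_linear[of f q 1 x 1 y] by (auto simp: fun_eq_iff)

lemma alt_forms_contract_uminus:
  "f \<in> alt_forms sc q \<Longrightarrow> contract (- x) f = - contract x f"
  using alt_forms_contract_linear[of f q "-1" x 0 0] by (auto simp: fun_eq_iff)

lemma alt_forms_contract:
  assumes "f \<in> alt_forms sc (Suc q)"
  shows "contract x f \<in> alt_forms sc q"
  using assms alt_formsD_linear[OF assms, of "Suc _" "x # _"]
  by (auto simp: alt_forms_def contract_def)

lemma alt_forms_0_contract: "f \<in> alt_forms sc 0 \<Longrightarrow> contract x f = 0"
  by (auto simp: alt_forms_def contract_def)

lemma alt_forms_contract_pred: "f \<in> alt_forms sc q \<Longrightarrow> contract x f \<in> alt_forms sc (q - 1)"
  by (cases q) (auto simp: alt_forms_0_contract alt_forms_zero alt_forms_contract)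

lemma alt_forms_contract_contract_self:
  "f \<in> alt_forms sc q \<Longrightarrow> contract x (contract x f) = 0"
  using alt_formsD_distinct[of f q] by (auto simp: contract_def)

text \<open>Polarisation of the vanishing of a double contraction with \<open>x + y\<close>.\<close>

lemma alt_forms_contract_swap:
  assumes "f \<in> alt_forms sc q"
  shows "contract x (contract y f) = - contract y (contract x f)"
proof -
  have "contract (x + y) (contract (x + y) f) = 0"
    by (rule alt_forms_contract_contract_self[OF assms])
  moreover have "contract (x + y) (contract (x + y) f) =
      contract x (contract x f) + contract y (contract x f) +
      (contract x (contract y f) + contract y (contract y f))"
    unfolding alt_forms_contract_add[OF assms] contract_plus
    by (simp only: alt_forms_contract_add[OF alt_forms_contract_pred[OF assms]])
  ultimately show ?thesis
    using alt_forms_contract_contract_self[OF assms]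
    by (simp add: eq_neg_iff_add_eq_0 add.commute)
qed

lemma alt_forms_swap: "f \<in> alt_forms sc q \<Longrightarrow> f (x # y # Ws) = - f (y # x # Ws)"
  using fun_cong[OF alt_forms_contract_swap[of f q y x], of Ws] by (simp add: contract_def)

text \<open>Polarising \<open>diag\<close> makes the first two arguments anticommute; a repetition
  of the head further right is then swapped into the tail, where the contraction is alternating by
  assumption. Membership proofs thereby become inductions on the degree.\<close>

lemma alt_forms_SucI:
  assumes "f [] = 0" and alt: "\<And>x. contract x f \<in> alt_forms sc q"
    and lin: "\<And>a x b y Ws. contract (a *\<^sub>R x + b *\<^sub>R y) f Ws =
      sc (complex_of_real a) (contract x f Ws) + sc (complex_of_real b) (contract y f Ws)"
    and diag: "\<And>x. contract x (contract x f) = 0"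
  shows "f \<in> alt_forms sc (Suc q)"
proof -
  have swap: "f (x # y # Ws) = - f (y # x # Ws)" for x y Ws
  proof -
    have ad: "contract (x + y) f Vs = contract x f Vs + contract y f Vs" for x y Vs
      using lin[of 1 x 1 y] by simp
    have "contract (x + y) f ((x + y) # Ws) = 0"
      using fun_cong[OF diag[of "x + y"], of Ws] by (simp add: contract_def)
    moreover have "contract z f ((x + y) # Ws) = contract z f (x # Ws) + contract z f (y # Ws)" for z
      using fun_cong[OF alt_forms_contract_add[OF alt[of z], of x y], of Ws] by (simp add: contract_def)
    then have "contract (x + y) f ((x + y) # Ws) =
        contract x f (x # Ws) + contract x f (y # Ws) + (contract y f (x # Ws) + contract y f (y # Ws))"
      by (simp only: ad ac_simps)
    moreover have "contract x f (x # Ws) = 0" "contract y f (y # Ws) = 0"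
      using fun_cong[OF diag, of _ Ws] by (auto simp: contract_def)
    ultimately show ?thesis
      by (simp add: contract_def eq_neg_iff_add_eq_0)
  qed
  have mem: "f (x # Ws) = 0" if "x \<in> set Ws" for x Ws
    using that
  proof (induction Ws)
    case (Cons y Ws)
    show ?case
    proof (cases "x = y")
      case True
      then show ?thesis using fun_cong[OF diag[of x], of Ws] by (simp add: contract_def)
    next
      case False
      have "f (x # y # Ws) = - contract y f (x # Ws)"
        by (simp add: swap[of x] contract_def)
      also have "contract y f (x # Ws) = 0"
        using Cons.prems False alt_formsD_distinct[OF alt] by auto
      finally show ?thesis by simp
    qed
  qed simp
  show ?thesis
    unfolding alt_forms_def mem_Collect_eq
  proof (intro conjI allI impI)
    fix Ws :: "'a list" assume "length Ws \<noteq> Suc q"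
    then show "f Ws = 0"
      using \<open>f [] = 0\<close> alt_formsD_length[OF alt] by (cases Ws) (auto simp: contract_def)
  next
    fix Ws :: "'a list" and i a x b y
    assume "length Ws = Suc q" "i < Suc q"
    then show "f (Ws[i := a *\<^sub>R x + b *\<^sub>R y]) =
      sc (complex_of_real a) (f (Ws[i := x])) + sc (complex_of_real b) (f (Ws[i := y]))"
      using lin alt_formsD_linear[OF alt]
      by (cases Ws; cases i) (auto simp: contract_def)
  next
    fix Ws :: "'a list" assume "length Ws = Suc q" "\<not> distinct Ws"
    then show "f Ws = 0"
      using mem alt_formsD_distinct[OF alt] by (cases Ws) (auto simp: contract_def)
  qed
qed

text \<open>The head passes \<open>i\<close> arguments, each giving a sign. This translates between
  contractions at the head and replacement of an argument in its slot.\<close>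

lemma alt_forms_move:
  assumes "f \<in> alt_forms sc q" "i < length Ws"
  shows "f (y # del_nth i Ws) = sc ((- 1) ^ i) (f (Ws[i := y]))"
  using assms
proof (induction Ws arbitrary: i f q)
  case (Cons w Ws)
  show ?case
  proof (cases i)
    case (Suc k)
    have "f (y # w # del_nth k Ws) = - contract w f (y # del_nth k Ws)"
      by (simp add: alt_forms_swap[OF Cons.prems(1), of y] contract_def)
    also have "\<dots> = - sc ((- 1) ^ k) (contract w f (Ws[k := y]))"
      using Cons Suc alt_forms_contract_pred by (metis Suc_less_eq length_Cons)
    finally show ?thesis
      using Suc by (simp add: contract_def)
  qed simp
qed simp

lemma alt_forms_move_sign:
  assumes "f \<in> alt_forms sc q" "i < length Ws"
  shows "sc ((- 1) ^ i) (f (y # del_nth i Ws)) = f (Ws[i := y])"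
  using alt_forms_move[OF assms] by (simp flip: power_add)

lemma antisymm_contract:
  assumes "f \<in> alt_forms sc q"
  shows "antisymm sc (\<lambda>w. contract (br w x) f) = lie_der br x f"
proof
  show "antisymm sc (\<lambda>w. contract (br w x) f) Ws = lie_der br x f Ws" for Ws
    using alt_forms_move_sign[OF assms] by (simp add: antisymm_def lie_der_def contract_def)
qed

lemma alt_forms_antisymm:
  assumes "\<And>x. F x \<in> alt_forms sc q"
    and "\<And>a x b y Ws. F (a *\<^sub>R x + b *\<^sub>R y) Ws =
      sc (complex_of_real a) (F x Ws) + sc (complex_of_real b) (F y Ws)"
  shows "antisymm sc F \<in> alt_forms sc (Suc q)"
  using assms
proof (induction q arbitrary: F)
  case 0
  have "antisymm sc (\<lambda>w. contract x (F w)) = 0" for x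
    using 0(1) by (simp add: alt_forms_0_contract antisymm_zero)
  then have c: "contract x (antisymm sc F) = F x" for x
    by (simp add: contract_antisymm)
  show ?case
    by (rule alt_forms_SucI) (auto simp: c 0 alt_forms_0_contract[OF 0(1)])
next
  case (Suc q)
  have IH: "antisymm sc (\<lambda>w. contract x (F w)) \<in> alt_forms sc (Suc q)" for x
    by (rule Suc.IH) (use Suc.prems alt_forms_contract[OF Suc.prems(1)] in \<open>auto simp: contract_def\<close>)
  show ?case
  proof (rule alt_forms_SucI)
    show "contract x (antisymm sc F) \<in> alt_forms sc (Suc q)" for x
      unfolding contract_antisymm using Suc.prems(1) IH by (rule alt_forms_diff)
    show "contract (a *\<^sub>R x + b *\<^sub>R y) (antisymm sc F) Ws =
      sc (complex_of_real a) (contract x (antisymm sc F) Ws) +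
      sc (complex_of_real b) (contract y (antisymm sc F) Ws)" for a x b y Ws
    proof -
      have "antisymm sc (\<lambda>w. contract (a *\<^sub>R x + b *\<^sub>R y) (F w)) Ws =
          antisymm sc (\<lambda>w Vs. sc (complex_of_real a) (contract x (F w) Vs) +
            sc (complex_of_real b) (contract y (F w) Vs)) Ws"
        using alt_forms_contract_linear[OF Suc.prems(1)] by (simp add: antisymm_def)
      also have "\<dots> = sc (complex_of_real a) (antisymm sc (\<lambda>w. contract x (F w)) Ws) +
          sc (complex_of_real b) (antisymm sc (\<lambda>w. contract y (F w)) Ws)"
        unfolding antisymm_def scale_right_distrib sum.distrib scale_sum_right
        by (simp add: mult.commute)
      finally show ?thesis
        by (simp add: contract_antisymm Suc.prems(2) scale_right_diff_distrib)
    qed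
    show "contract x (contract x (antisymm sc F)) = 0" for x
    proof -
      \<comment> \<open>Contracting twice produces the contraction of \<open>F x\<close> with
        \<open>x\<close> twice, with opposite signs.\<close>
      have "contract x (contract x (antisymm sc F)) =
          antisymm sc (\<lambda>w. contract x (contract x (F w)))"
        unfolding contract_antisymm
        by (simp add: contract_def fun_eq_iff antisymm_Cons)
      then show ?thesis
        using alt_forms_contract_contract_self[OF Suc.prems(1)] by (simp add: antisymm_zero)
    qed
  qed simp
qed

lemma alt_forms_eqI_ext:
  assumes "f \<in> alt_forms sc q" "g \<in> alt_forms sc q" "\<And>Ws. length Ws = q \<Longrightarrow> f Ws = g Ws"
  shows "f = g"
proof
  fix Ws show "f Ws = g Ws"
    using assms(3) alt_formsD_length[OF assms(1)] alt_formsD_length[OF assms(2)]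
    by (cases "length Ws = q") auto
qed

end

section \<open>Lie derivatives and the exterior differential\<close>

lemma lie_algebraD:
  assumes "lie_algebra br"
  shows "br (a *\<^sub>R x + b *\<^sub>R y) z = a *\<^sub>R br x z + b *\<^sub>R br y z"
    and "br z (a *\<^sub>R x + b *\<^sub>R y) = a *\<^sub>R br z x + b *\<^sub>R br z y"
    and "br x y = - br y x"
    and "br (br w x) y - br (br w y) x = br w (br x y)"
proof -
  have lin: "linear (\<lambda>x. br x y)" "linear (br x)" for x y
    using assms by (auto simp: lie_algebra_def)
  note add = lin[THEN linear_add] and scale = lin[THEN linear_scale]
  show "br (a *\<^sub>R x + b *\<^sub>R y) z = a *\<^sub>R br x z + b *\<^sub>R br y z"
    and "br z (a *\<^sub>R x + b *\<^sub>R y) = a *\<^sub>R br z x + b *\<^sub>R br z y"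
    by (simp_all add: add scale)
  have anti: "br x y = - br y x" for x y
  proof -
    have "br (x + y) (x + y) = 0" "br x x = 0" "br y y = 0"
      using assms by (auto simp: lie_algebra_def)
    then show ?thesis by (simp add: add eq_neg_iff_add_eq_0 add.commute)
  qed
  then show "br x y = - br y x" .
  have neg: "br z (- u) = - br z u" for z u
    using lin(2) by (rule linear_neg)
  \<comment> \<open>Jacobi's identity is rewritten for brackets from the right, which is the side on
    which \<open>lie_der\<close> brackets.\<close>
  have "br w (br x y) + br x (br y w) + br y (br w x) = 0"
    using assms by (simp add: lie_algebra_def)
  moreover have "br x (br y w) = br (br w y) x"
    using anti[of x "br y w"] anti[of y w] anti[of x "br w y"] neg by simp
  moreover have "br y (br w x) = - br (br w x) y"
    by (rule anti)
  ultimately show "br (br w x) y - br (br w y) x = br w (br x y)"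
    by (simp add: algebra_simps add_eq_0_iff)
qed

context complex_space
begin

lemma lie_der_linear:
  assumes "lie_algebra br" "f \<in> alt_forms sc q"
  shows "lie_der br (a *\<^sub>R x + b *\<^sub>R y) f Ws =
    sc (complex_of_real a) (lie_der br x f Ws) + sc (complex_of_real b) (lie_der br y f Ws)"
  using assms
  by (simp add: lie_der_def lie_algebraD(2) alt_formsD_linear sum.distrib scale_sum_right)

lemma lie_der_sum_left:
  assumes "lie_algebra br" "f \<in> alt_forms sc q"
  shows "lie_der br (\<Sum>j\<in>A. c j *\<^sub>R X j) f Ws =
    (\<Sum>j\<in>A. sc (complex_of_real (c j)) (lie_der br (X j) f Ws))"
proof (induction A rule: infinite_finite_induct)
  case (insert a A)
  then show ?case
    using lie_der_linear[OF assms, of "c a" "X a" 1 "\<Sum>j\<in>A. c j *\<^sub>R X j" Ws] by simp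
qed (use lie_der_linear[OF assms, of 0 0 0 0] in auto)

lemma lie_der_uminus_left:
  assumes "lie_algebra br" "f \<in> alt_forms sc q"
  shows "lie_der br (- x) f = - lie_der br x f"
  using lie_der_linear[OF assms, of "-1" x 0 0] by (auto simp: fun_eq_iff)

lemma alt_forms_lie_der:
  assumes lie: "lie_algebra br" and "f \<in> alt_forms sc q"
  shows "lie_der br x f \<in> alt_forms sc q"
  using assms(2)
proof (induction q arbitrary: f)
  case 0
  then show ?case
    by (auto simp: alt_forms_def lie_der_def)
next
  case (Suc q)
  note f = alt_forms_contract[OF Suc.prems]
  show ?case
  proof (rule alt_forms_SucI)
    show "contract y (lie_der br x f) \<in> alt_forms sc q" for y
      unfolding contract_lie_der by (intro alt_forms_plus Suc.IH f)
    show "contract (a *\<^sub>R u + b *\<^sub>R v) (lie_der br x f) Ws =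
      sc (complex_of_real a) (contract u (lie_der br x f) Ws) +
      sc (complex_of_real b) (contract v (lie_der br x f) Ws)" for a u b v Ws
    proof -
      have "lie_der br x (contract (a *\<^sub>R u + b *\<^sub>R v) f) Ws =
          sc (complex_of_real a) (lie_der br x (contract u f) Ws) +
          sc (complex_of_real b) (lie_der br x (contract v f) Ws)"
        by (simp add: lie_der_def alt_forms_contract_linear[OF Suc.prems] sum.distrib scale_sum_right)
      then show ?thesis
        by (simp add: contract_lie_der lie_algebraD(1)[OF lie] alt_forms_contract_linear[OF Suc.prems]
            scale_right_distrib)
    qed
    show "contract y (contract y (lie_der br x f)) = 0" for y
    proof -
      \<comment> \<open>The last two terms contract with \<open>y\<close> and \<open>br y x\<close>
        in either order, so they cancel because \<open>f\<close> is alternating.\<close>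
      have "contract y (contract y (lie_der br x f)) =
          lie_der br x (contract y (contract y f)) + contract (br y x) (contract y f) +
          contract y (contract (br y x) f)"
        by (simp only: contract_lie_der contract_plus)
      also have "\<dots> = 0"
        unfolding alt_forms_contract_contract_self[OF Suc.prems]
          alt_forms_contract_swap[OF Suc.prems, of y] by (simp only: lie_der_zero) simp
      finally show ?thesis .
    qed
  qed simp
qed

text \<open>In the induction on the argument list the mixed terms are symmetric in \<open>x\<close>
  and \<open>y\<close> and cancel; what remains are double brackets at the head, where Jacobi's
  identity applies.\<close>

lemma lie_der_commutator:
  assumes lie: "lie_algebra br" and "f \<in> alt_forms sc q"
  shows "lie_der br x (lie_der br y f) - lie_der br y (lie_der br x f) = lie_der br (br x y) f"
proof
  fix Ws
  show "(lie_der br x (lie_der br y f) - lie_der br y (lie_der br x f)) Ws =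
      lie_der br (br x y) f Ws"
    using assms(2)
  proof (induction Ws arbitrary: f q)
    case (Cons w Ws)
    have contract2: "contract w (lie_der br x (lie_der br y f)) Ws =
        lie_der br x (lie_der br y (contract w f)) Ws + lie_der br x (contract (br w y) f) Ws +
        lie_der br y (contract (br w x) f) Ws + contract (br (br w x) y) f Ws" for x y
      unfolding contract_lie_der lie_der_plus by (simp add: add.assoc)
    have "contract (br (br w x) y) f Ws - contract (br (br w y) x) f Ws =
        contract (br w (br x y)) f Ws"
      using alt_forms_contract_linear[OF Cons.prems, of 1 "br (br w x) y" "- 1" "br (br w y) x" Ws]
      by (simp add: lie_algebraD(4)[OF lie])
    moreover note Cons.IH[OF alt_forms_contract_pred[OF Cons.prems], of w]
    moreover have "contract w (lie_der br (br x y) f) Ws =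
        lie_der br (br x y) (contract w f) Ws + contract (br w (br x y)) f Ws"
      unfolding contract_lie_der by simp
    ultimately have "contract w (lie_der br x (lie_der br y f)) Ws -
        contract w (lie_der br y (lie_der br x f)) Ws = contract w (lie_der br (br x y) f) Ws"
      by (simp add: contract2 algebra_simps)
    then show ?case by (simp add: contract_def)
  qed simp
qed

lemma alt_forms_antisymm_lie_der:
  assumes lie: "lie_algebra br" and "f \<in> alt_forms sc q"
  shows "antisymm sc (\<lambda>w. lie_der br w f) \<in> alt_forms sc (Suc q)"
  using assms by (intro alt_forms_antisymm alt_forms_lie_der lie_der_linear)

end

text \<open>Cartan's formula. Pairs involving the head give the Lie derivative. For the other pairs
  both indices shift, which preserves their sign, and the minus comes from swapping \<open>x\<close>
  with the bracket that \<open>d_wedge\<close> puts in front.\<close>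

lemma contract_d_wedge:
  fixes R :: "('g::real_vector, 'v::ab_group_add, 'i) lie_data"
  assumes "complex_space (scl R)" and lie: "lie_algebra (brk R)" and f: "f \<in> cochains R q"
  shows "contract x (d_wedge R f) = lie_der (brk R) x f - d_wedge R (contract x f)"
proof
  interpret complex_space "scl R" by fact
  fix Ws :: "'g list"
  have inner: "(\<Sum>i<Suc j. scl R ((- 1) ^ (i + Suc j))
        (f (brk R ((x # Ws) ! i) ((x # Ws) ! Suc j) # del_nth i (del_nth (Suc j) (x # Ws))))) =
      f (Ws[j := brk R (Ws ! j) x]) -
      (\<Sum>i<j. scl R ((- 1) ^ (i + j))
        (contract x f (brk R (Ws ! i) (Ws ! j) # del_nth i (del_nth j Ws))))"
    (is "?l = ?a - ?b") if "j < length Ws" for j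
  proof -
    have "?l = scl R ((- 1) ^ Suc j) (f (brk R x (Ws ! j) # del_nth j Ws)) - ?b"
      by (simp add: sum.lessThan_Suc_shift alt_forms_swap[OF f, of _ x] contract_def sum_negf
          del: sum.lessThan_Suc)
    also have "f (brk R x (Ws ! j) # del_nth j Ws) = - f (brk R (Ws ! j) x # del_nth j Ws)"
      using fun_cong[OF alt_forms_contract_uminus[OF f, of "brk R (Ws ! j) x"], of "del_nth j Ws"]
        lie_algebraD(3)[OF lie, of x "Ws ! j"] by (simp add: contract_def)
    finally show ?thesis
      using alt_forms_move_sign[OF f that] by simp
  qed
  have "contract x (d_wedge R f) Ws = (\<Sum>j<length Ws. \<Sum>i<Suc j. scl R ((- 1) ^ (i + Suc j))
        (f (brk R ((x # Ws) ! i) ((x # Ws) ! Suc j) # del_nth i (del_nth (Suc j) (x # Ws)))))"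
    unfolding contract_def d_wedge_def length_Cons
    by (subst sum.lessThan_Suc_shift) (simp del: sum.lessThan_Suc)
  also have "\<dots> = (\<Sum>j<length Ws. f (Ws[j := brk R (Ws ! j) x]) - (\<Sum>i<j. scl R ((- 1) ^ (i + j))
        (contract x f (brk R (Ws ! i) (Ws ! j) # del_nth i (del_nth j Ws)))))"
    by (intro sum.cong refl inner) simp
  finally show "contract x (d_wedge R f) Ws = (lie_der (brk R) x f - d_wedge R (contract x f)) Ws"
    by (simp add: sum_subtractf lie_der_def d_wedge_def)
qed

lemma d_wedge_Nil [simp]: "d_wedge R f [] = 0"
  by (simp add: d_wedge_def)

lemma d_wedge_Cons:
  assumes "complex_space (scl R)" and "lie_algebra (brk R)" and "f \<in> cochains R q"
  shows "d_wedge R f (x # Ws) = lie_der (brk R) x f Ws - d_wedge R (contract x f) Ws"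
  using fun_cong[OF contract_d_wedge[OF assms], of x Ws] by (simp add: contract_def)

text \<open>On the right each pair of arguments is bracketed twice, once with either of them as
  parameter of the Lie derivative; hence the 2. In the induction the second copy is the extra term
  from contracting a Lie derivative.\<close>

lemma d_wedge_eq_antisymm:
  fixes R :: "('g::real_vector, 'v::ab_group_add, 'i) lie_data"
  assumes "complex_space (scl R)" and lie: "lie_algebra (brk R)" and "f \<in> cochains R q"
  shows "scl R 2 (d_wedge R f Ws) = antisymm (scl R) (\<lambda>w. lie_der (brk R) w f) Ws"
proof -
  interpret complex_space "scl R" by fact
  show ?thesis
    using assms(3)
  proof (induction Ws arbitrary: f q)
  case (Cons x Ws)
  have "antisymm (scl R) (\<lambda>w. contract x (lie_der (brk R) w f)) Ws =
      antisymm (scl R) (\<lambda>w. lie_der (brk R) w (contract x f)) Ws +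
      antisymm (scl R) (\<lambda>w. contract (brk R x w) f) Ws"
    by (simp only: contract_lie_der antisymm_plus plus_fun_apply)
  also have "antisymm (scl R) (\<lambda>w. contract (brk R x w) f) =
      antisymm (scl R) (\<lambda>w. - contract (brk R w x) f)"
    using alt_forms_contract_uminus[OF Cons.prems] lie_algebraD(3)[OF lie, of x] by metis
  also have "\<dots> = - lie_der (brk R) x f"
    by (simp only: antisymm_uminus antisymm_contract[OF Cons.prems])
  finally have "antisymm (scl R) (\<lambda>w. lie_der (brk R) w f) (x # Ws) =
      scl R 2 (lie_der (brk R) x f Ws) -
      antisymm (scl R) (\<lambda>w. lie_der (brk R) w (contract x f)) Ws"
    using scale_left_distrib[of 1 1 "lie_der (brk R) x f Ws"] by (simp add: antisymm_Cons)
  then show ?case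
    using Cons.IH[OF alt_forms_contract_pred[OF Cons.prems]]
    by (simp add: d_wedge_Cons[OF assms(1,2) Cons.prems] scale_right_diff_distrib)
qed simp
qed

lemma alt_forms_d_wedge:
  assumes "complex_space (scl R)" and "lie_algebra (brk R)" and "f \<in> cochains R q"
  shows "d_wedge R f \<in> cochains R (Suc q)"
proof -
  interpret complex_space "scl R" by fact
  have "d_wedge R f = (\<lambda>Ws. scl R (1 / 2) (antisymm (scl R) (\<lambda>w. lie_der (brk R) w f) Ws))"
    by (simp flip: d_wedge_eq_antisymm[OF assms])
  then show ?thesis
    using alt_forms_scale[OF alt_forms_antisymm_lie_der[OF assms(2,3)]] by simp
qed

text \<open>Cartan's formula at the head turns the claim into the commutator of two Lie derivatives
  plus the claim for the contracted form on a shorter list.\<close>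

lemma lie_der_d_wedge:
  fixes R :: "('g::real_vector, 'v::ab_group_add, 'i) lie_data"
  assumes "complex_space (scl R)" and lie: "lie_algebra (brk R)" and "f \<in> cochains R q"
  shows "lie_der (brk R) x (d_wedge R f) = d_wedge R (lie_der (brk R) x f)"
proof
  interpret complex_space "scl R" by fact
  fix Ws
  show "lie_der (brk R) x (d_wedge R f) Ws = d_wedge R (lie_der (brk R) x f) Ws"
    using assms(3)
  proof (induction Ws arbitrary: f q)
    case (Cons w Ws)
    note cf = alt_forms_contract_pred[OF Cons.prems]
    have d_add: "d_wedge R (f + g) = d_wedge R f + d_wedge R g" for f g
      by (simp add: d_wedge_def scale_right_distrib sum.distrib fun_eq_iff)
    have "lie_der (brk R) x (d_wedge R f) (w # Ws) =
        lie_der (brk R) x (contract w (d_wedge R f)) Ws + contract (brk R w x) (d_wedge R f) Ws"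
      by (simp add: lie_der_Cons contract_def add.commute)
    also have "lie_der (brk R) x (contract w (d_wedge R f)) =
        lie_der (brk R) x (lie_der (brk R) w f) - lie_der (brk R) x (d_wedge R (contract w f))"
      unfolding contract_d_wedge[OF assms(1,2) Cons.prems] diff_conv_add_uminus
        lie_der_plus lie_der_uminus ..
    also have "contract (brk R w x) (d_wedge R f) =
        lie_der (brk R) (brk R w x) f - d_wedge R (contract (brk R w x) f)"
      by (rule contract_d_wedge[OF assms(1,2) Cons.prems])
    also have "lie_der (brk R) (brk R w x) f =
        lie_der (brk R) w (lie_der (brk R) x f) - lie_der (brk R) x (lie_der (brk R) w f)"
      by (rule lie_der_commutator[OF lie Cons.prems, symmetric])
    finally have "lie_der (brk R) x (d_wedge R f) (w # Ws) =
        lie_der (brk R) w (lie_der (brk R) x f) Ws - (d_wedge R (lie_der (brk R) x (contract w f)) Ws +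
        d_wedge R (contract (brk R w x) f) Ws)"
      using Cons.IH[OF cf, of w] by simp
    also have "\<dots> = lie_der (brk R) w (lie_der (brk R) x f) Ws -
        d_wedge R (contract w (lie_der (brk R) x f)) Ws"
      by (simp only: contract_lie_der d_add plus_fun_apply)
    also have "\<dots> = d_wedge R (lie_der (brk R) x f) (w # Ws)"
      by (rule d_wedge_Cons[OF assms(1,2) alt_forms_lie_der[OF lie Cons.prems], symmetric])
    finally show ?case .
  qed simp
qed

section \<open>Formal adjoints\<close>

locale hermitian_lie_module =
  fixes R :: "('g::real_vector, 'v::ab_group_add, 'i) lie_data"
  assumes reductive_data: "reductive_data R"
    and adapted_basis: "adapted_basis R"
    and hermitian_module: "hermitian_module R"
begin

sublocale V: complex_space "scl R"
  using hermitian_module by (simp add: hermitian_module_def complex_space_def)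

lemma lie: "lie_algebra (brk R)"
  using reductive_data by (simp add: reductive_data_def reductive_lie_algebra_def)

lemma finite_idx [simp]: "finite (idx_k R)" "finite (idx_p R)"
  using adapted_basis by (auto simp: adapted_basis_def)

lemma linear_frm: "linear (frm R x)"
  using reductive_data by (auto simp: reductive_data_def)

lemma frm_commute: "frm R x y = frm R y x"
  using reductive_data by (auto simp: reductive_data_def)

lemma frm_invariant: "frm R (brk R x y) z = - frm R y (brk R x z)"
  using reductive_data by (auto simp: reductive_data_def eq_neg_iff_add_eq_0)

lemma linear_theta: "linear (theta R)"
  using reductive_data by (auto simp: reductive_data_def)

lemma theta_theta [simp]: "theta R (theta R x) = x"
  using reductive_data by (auto simp: reductive_data_def)

lemma theta_brk: "theta R (brk R x y) = brk R (theta R x) (theta R y)"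
  using reductive_data by (auto simp: reductive_data_def)

lemma frm_theta: "frm R (theta R x) (theta R y) = frm R x y"
  using reductive_data by (auto simp: reductive_data_def)

lemma linear_Btheta: "linear (Btheta R x)" "linear (\<lambda>x. Btheta R x y)"
  using linear_frm linear_theta
  by (auto simp: Btheta_def linear_iff frm_commute[of _ "theta R y"])

lemma Btheta_commute: "Btheta R x y = Btheta R y x"
  using frm_theta[of x "theta R y"] frm_commute by (simp add: Btheta_def)

lemma Btheta_theta: "Btheta R (theta R x) y = Btheta R x (theta R y)"
  using frm_theta[of x y] frm_theta[of x "theta R y"] by (simp add: Btheta_def)

text \<open>Invariance makes ad x skew for \<open>frm\<close>; crossing the \<open>theta\<close>
  inside \<open>Btheta\<close> replaces \<open>x\<close> by \<open>theta R x\<close>. The adjoints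
  of all Lie derivatives and of the coadjoint action rest on this.\<close>

lemma Btheta_brk: "Btheta R (brk R y x) z = - Btheta R y (brk R z (theta R x))"
proof -
  have "frm R (brk R y x) (theta R z) = frm R (- brk R x y) (theta R z)"
    using lie_algebraD(3)[OF lie, of y x] by simp
  also have "\<dots> = - frm R (brk R x y) (theta R z)"
    using linear_neg[OF linear_frm, of "theta R z" "brk R x y"] frm_commute by metis
  also have "\<dots> = frm R y (theta R (brk R (theta R x) z))"
    by (simp add: frm_invariant theta_brk)
  also have "brk R (theta R x) z = - brk R z (theta R x)"
    by (rule lie_algebraD(3)[OF lie])
  finally show ?thesis
    by (simp add: Btheta_def linear_neg[OF linear_theta] linear_neg[OF linear_frm])
qed

lemma Btheta_bas: "i \<in> idx R \<Longrightarrow> j \<in> idx R \<Longrightarrow> Btheta R (bas R i) (bas R j) = (if i = j then 1 else 0)"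
  using adapted_basis by (simp add: adapted_basis_def)

lemma theta_bas_k: "j \<in> idx_k R \<Longrightarrow> theta R (bas R j) = bas R j"
  using adapted_basis span_base[of "bas R j" "bas R ` idx_k R"]
  by (auto simp: adapted_basis_def kpart_def)

lemma theta_bas_p: "j \<in> idx_p R \<Longrightarrow> theta R (bas R j) = - bas R j"
  using adapted_basis span_base[of "bas R j" "bas R ` idx_p R"]
  by (auto simp: adapted_basis_def ppart_def)

lemma bas_expand: "(\<Sum>j\<in>idx R. Btheta R x (bas R j) *\<^sub>R bas R j) = x"
proof -
  let ?S = "span (bas R ` idx R)"
  \<comment> \<open>Averaging over \<open>theta\<close> splits \<open>x\<close> into its parts in
    \<open>kpart\<close> and \<open>ppart\<close>, so the two halves of the basis together span
    everything.\<close>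
  have half: "x = (1/2) *\<^sub>R (x + theta R x) + (1/2) *\<^sub>R (x - theta R x)"
    by (simp flip: scaleR_add_right scaleR_2)
  have "x + theta R x \<in> kpart R" "x - theta R x \<in> ppart R"
    by (auto simp: kpart_def ppart_def linear_add[OF linear_theta] linear_diff[OF linear_theta])
  then have "x + theta R x \<in> span (bas R ` idx_k R)" "x - theta R x \<in> span (bas R ` idx_p R)"
    using adapted_basis by (auto simp: adapted_basis_def)
  moreover have "span (bas R ` idx_k R) \<subseteq> ?S" "span (bas R ` idx_p R) \<subseteq> ?S"
    by (auto intro!: span_mono)
  ultimately have "x \<in> ?S"
    by (subst half) (rule span_add; rule span_scale; blast)
  then show ?thesis
  proof (induction rule: span_induct_alt)
    case base
    then show ?case by (simp add: linear_0[OF linear_Btheta(2)])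
  next
    case (step c b y)
    then obtain i where i: "i \<in> idx R" "b = bas R i" by auto
    have "(\<Sum>j\<in>idx R. Btheta R b (bas R j) *\<^sub>R bas R j) = (\<Sum>j\<in>idx R. if i = j then bas R j else 0)"
      by (rule sum.cong) (simp_all add: i Btheta_bas[OF i(1)] del: Un_iff)
    also have "\<dots> = b"
      using i by simp
    finally show ?case
      using step.IH
      by (simp add: linear_add[OF linear_Btheta(2)] linear_scale[OF linear_Btheta(2)]
          scaleR_left_distrib sum.distrib flip: scaleR_scaleR scaleR_sum_right)
  qed
qed

lemma tau_linear_right: "tau R x (scl R a u + scl R b v) = scl R a (tau R x u) + scl R b (tau R x v)"
  using hermitian_module by (simp add: hermitian_module_def)

lemma tau_add: "tau R x (u + v) = tau R x u + tau R x v"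
  using tau_linear_right[of x 1 u 1 v] by simp

lemma tau_scale: "tau R x (scl R a u) = scl R a (tau R x u)"
  using tau_linear_right[of x a u 0 0] by simp

lemma tau_zero [simp]: "tau R x 0 = 0"
  using tau_scale[of x 0 0] by simp

lemma tau_uminus: "tau R x (- u) = - tau R x u"
  using tau_scale[of x "- 1" u] by simp

lemma tau_sum: "tau R x (\<Sum>i\<in>A. u i) = (\<Sum>i\<in>A. tau R x (u i))"
  by (induction A rule: infinite_finite_induct) (auto simp: tau_add)

lemma tau_linear_left:
  "tau R (a *\<^sub>R x + b *\<^sub>R y) u =
    scl R (complex_of_real a) (tau R x u) + scl R (complex_of_real b) (tau R y u)"
  using hermitian_module by (simp add: hermitian_module_def)

lemma tau_sum_left:
  "tau R (\<Sum>j\<in>A. c j *\<^sub>R X j) u = (\<Sum>j\<in>A. scl R (complex_of_real (c j)) (tau R (X j) u))"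
proof (induction A rule: infinite_finite_induct)
  case (insert a A)
  then show ?case
    using tau_linear_left[of "c a" "X a" 1 "\<Sum>j\<in>A. c j *\<^sub>R X j" u] by simp
qed (use tau_linear_left[of 0 0 0 0] in auto)

lemma tau_uminus_left: "tau R (- x) u = - tau R x u"
  using tau_linear_left[of "- 1" x 0 0 u] by simp

lemma tau_brk: "tau R (brk R x y) u = tau R x (tau R y u) - tau R y (tau R x u)"
  using hermitian_module by (simp add: hermitian_module_def)

lemma herm_tau: "herm R (tau R x u) v = - herm R u (tau R x v)"
  using hermitian_module by (simp add: hermitian_module_def eq_neg_iff_add_eq_0)

lemma hermitian_product: "hermitian_product (scl R) (herm R)"
  using hermitian_module by (simp add: hermitian_module_def)

lemma herm_linear: "herm R (scl R a u + scl R b v) w = a * herm R u w + b * herm R v w"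
  using hermitian_product unfolding hermitian_product_def by blast

lemma herm_cnj: "herm R u v = cnj (herm R v u)"
  using hermitian_product unfolding hermitian_product_def by blast

lemma herm_add: "herm R (u + v) w = herm R u w + herm R v w"
  using herm_linear[of 1 u 1 v w] by simp

lemma herm_scale: "herm R (scl R a u) w = a * herm R u w"
  using herm_linear[of a u 0 0 w] by simp

lemma herm_zero [simp]: "herm R 0 w = 0"
  using herm_scale[of 0 0 w] by simp

lemma herm_scale_right: "herm R w (scl R a u) = cnj a * herm R w u"
  using arg_cong[OF herm_scale[of a u w], of cnj] by (simp flip: herm_cnj)

lemma herm_zero_right [simp]: "herm R w 0 = 0"
  using herm_scale_right[of w 0 0] by simp

lemma cochain_ip_add: "cochain_ip R q (f + g) h = cochain_ip R q f h + cochain_ip R q g h"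
  by (simp add: cochain_ip_def herm_add sum.distrib add_divide_distrib)

lemma cochain_ip_scale: "cochain_ip R q (\<lambda>Ws. scl R c (f Ws)) h = c * cochain_ip R q f h"
  by (simp add: cochain_ip_def herm_scale sum_distrib_left)

lemma cochain_ip_zero [simp]: "cochain_ip R q 0 h = 0"
  by (simp add: cochain_ip_def)

lemma cochain_ip_uminus: "cochain_ip R q (- f) h = - cochain_ip R q f h"
  using cochain_ip_scale[of q "- 1" f h] by (simp add: fun_Compl_def)

lemma cochain_ip_diff: "cochain_ip R q (f - g) h = cochain_ip R q f h - cochain_ip R q g h"
  using cochain_ip_add[of q f "- g" h] cochain_ip_uminus[of q g h] by simp

lemma cochain_ip_sum: "cochain_ip R q (\<Sum>i\<in>A. f i) h = (\<Sum>i\<in>A. cochain_ip R q (f i) h)"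
  by (induction A rule: infinite_finite_induct)
    (simp_all only: cochain_ip_add cochain_ip_zero sum.infinite sum.empty sum.insert not_False_eq_True)

lemma cochain_ip_cnj: "cochain_ip R q f g = cnj (cochain_ip R q g f)"
proof -
  have "herm R (f Ws) (g Ws) = cnj (herm R (g Ws) (f Ws))" for Ws
    by (rule herm_cnj)
  then show ?thesis by (simp add: cochain_ip_def)
qed

lemma cochain_ip_add_right: "cochain_ip R q h (f + g) = cochain_ip R q h f + cochain_ip R q h g"
  using arg_cong[OF cochain_ip_add[of q f g h], of cnj] by (simp flip: cochain_ip_cnj)

lemma cochain_ip_scale_right:
  "cochain_ip R q h (\<lambda>Ws. scl R c (f Ws)) = cnj c * cochain_ip R q h f"
  using arg_cong[OF cochain_ip_scale[of q c f h], of cnj] by (simp flip: cochain_ip_cnj)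

lemma cochain_ip_diff_right: "cochain_ip R q h (f - g) = cochain_ip R q h f - cochain_ip R q h g"
  using arg_cong[OF cochain_ip_diff[of q f g h], of cnj] by (simp flip: cochain_ip_cnj)

lemma cochain_ip_uminus_right: "cochain_ip R q h (- f) = - cochain_ip R q h f"
  using arg_cong[OF cochain_ip_uminus[of q f h], of cnj] by (simp flip: cochain_ip_cnj)

lemma cochain_ip_sum_right: "cochain_ip R q h (\<Sum>i\<in>A. f i) = (\<Sum>i\<in>A. cochain_ip R q h (f i))"
  using arg_cong[OF cochain_ip_sum[of q f A h], of cnj] by (simp only: cnj_sum flip: cochain_ip_cnj)

lemma cochain_ip_0: "cochain_ip R 0 f g = herm R (f []) (g [])"
proof -
  have "{js. length js = 0 \<and> set js \<subseteq> idx R} = {[]}" by auto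
  then show ?thesis by (simp add: cochain_ip_def)
qed

text \<open>The first index of each tuple is split off; the factor is the quotient of the factorials
  that normalise the two products.\<close>

lemma cochain_ip_Suc:
  "of_nat (Suc q) * cochain_ip R (Suc q) f g =
    (\<Sum>j\<in>idx R. cochain_ip R q (contract (bas R j) f) (contract (bas R j) g))"
proof -
  let ?A = "\<lambda>q. {js. length js = q \<and> set js \<subseteq> idx R}"
  have fin: "finite (?A q)"
    using finite_lists_length_eq[of "idx R" q] by (simp add: conj_commute)
  have "?A (Suc q) = (\<lambda>(j, js). j # js) ` (idx R \<times> ?A q)"
    by (auto simp: length_Suc_conv image_iff)
  moreover have "inj_on (\<lambda>(j, js). j # js) (idx R \<times> ?A q)"
    by (auto simp: inj_on_def)
  ultimately have "(\<Sum>js\<in>?A (Suc q). herm R (f (map (bas R) js)) (g (map (bas R) js))) =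
      (\<Sum>j\<in>idx R. \<Sum>js\<in>?A q. herm R (f (bas R j # map (bas R) js)) (g (bas R j # map (bas R) js)))"
    by (simp add: sum.reindex sum.cartesian_product case_prod_unfold del: Un_iff)
  then show ?thesis
    by (simp add: cochain_ip_def contract_def flip: sum_divide_distrib of_nat_Suc del: of_nat_Suc)
qed

text \<open>Splitting off a basis vector multiplies the left side by q + 2, while the two terms of
  \<open>contract_antisymm\<close> contribute one and q + 1 copies of the right side, so the factor
  cancels.\<close>

lemma cochain_ip_antisymm:
  assumes "g \<in> cochains R (Suc q)"
  shows "cochain_ip R (Suc q) (antisymm (scl R) F) g =
    (\<Sum>j\<in>idx R. cochain_ip R q (F (bas R j)) (contract (bas R j) g))"
  using assms
proof (induction q arbitrary: F g)
  case 0
  have "cochain_ip R (Suc 0) (antisymm (scl R) F) g =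
      (\<Sum>j\<in>idx R. cochain_ip R 0 (contract (bas R j) (antisymm (scl R) F)) (contract (bas R j) g))"
    using cochain_ip_Suc[of 0] by simp
  then show ?case
    by (simp add: cochain_ip_0 V.contract_antisymm)
next
  case (Suc q)
  let ?e = "bas R" and ?S = "\<Sum>j\<in>idx R. cochain_ip R (Suc q) (F (bas R j)) (contract (bas R j) g)"
  \<comment> \<open>Exchanging the two contractions of \<open>g\<close> yields a minus that offsets
    the one in \<open>contract_antisymm\<close>.\<close>
  have IH: "cochain_ip R (Suc q) (antisymm (scl R) (\<lambda>w. contract (?e x) (F w))) (contract (?e x) g) =
      - (\<Sum>j\<in>idx R. cochain_ip R q (contract (?e x) (F (?e j))) (contract (?e x) (contract (?e j) g)))"
    for x
    unfolding Suc.IH[OF V.alt_forms_contract[OF Suc.prems]]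
      V.alt_forms_contract_swap[OF Suc.prems, of "?e _" "?e x"] cochain_ip_uminus_right
    by (rule sum_negf)
  have "of_nat (Suc (Suc q)) * cochain_ip R (Suc (Suc q)) (antisymm (scl R) F) g =
      ?S + (\<Sum>x\<in>idx R. \<Sum>j\<in>idx R. cochain_ip R q (contract (?e x) (F (?e j)))
        (contract (?e x) (contract (?e j) g)))"
    unfolding cochain_ip_Suc V.contract_antisymm cochain_ip_diff IH sum_subtractf
    by (simp add: sum_negf del: Un_iff)
  also have "(\<Sum>x\<in>idx R. \<Sum>j\<in>idx R. cochain_ip R q (contract (?e x) (F (?e j)))
        (contract (?e x) (contract (?e j) g))) = of_nat (Suc q) * ?S"
    unfolding sum_distrib_left cochain_ip_Suc by (rule sum.swap)
  finally have "of_nat (Suc (Suc q)) * cochain_ip R (Suc (Suc q)) (antisymm (scl R) F) g =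
      of_nat (Suc (Suc q)) * ?S"
    by (simp add: algebra_simps)
  then show ?case
    by (simp only: mult_cancel_left of_nat_eq_0_iff) simp
qed

lemma cochain_ip_contract_expand:
  assumes "f \<in> cochains R q"
  shows "cochain_ip R n (contract x f) h =
    (\<Sum>j\<in>idx R. complex_of_real (Btheta R x (bas R j)) * cochain_ip R n (contract (bas R j) f) h)"
proof -
  have "contract x f = (\<Sum>j\<in>idx R. (\<lambda>Ws. scl R (complex_of_real (Btheta R x (bas R j))) (contract (bas R j) f Ws)))"
    using V.alt_forms_contract_sum[OF assms, of "\<lambda>j. Btheta R x (bas R j)" "bas R" "idx R"]
    by (simp add: bas_expand fun_eq_iff sum_fun_apply)
  then show ?thesis
    by (simp only: cochain_ip_sum cochain_ip_scale)
qed

lemma cochain_ip_contract_expand_right: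
  assumes "f \<in> cochains R q"
  shows "cochain_ip R n h (contract x f) =
    (\<Sum>j\<in>idx R. complex_of_real (Btheta R x (bas R j)) * cochain_ip R n h (contract (bas R j) f))"
proof -
  have "cnj (cochain_ip R n (contract x f) h) =
    (\<Sum>j\<in>idx R. complex_of_real (Btheta R x (bas R j)) * cnj (cochain_ip R n (contract (bas R j) f) h))"
    by (subst cochain_ip_contract_expand[OF assms]) simp
  then show ?thesis by (simp flip: cochain_ip_cnj)
qed

text \<open>After splitting off a basis vector, the bracket terms are a double sum over the matrix
  of bracketing with \<open>x\<close>, and \<open>Btheta_brk\<close> transposes that matrix. The
  other terms are the induction hypothesis.\<close>

lemma cochain_ip_lie_der:
  assumes "f \<in> cochains R q" "g \<in> cochains R q"
  shows "cochain_ip R q (lie_der (brk R) x f) g = - cochain_ip R q f (lie_der (brk R) (theta R x) g)"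
  using assms
proof (induction q arbitrary: f g)
  case 0
  then show ?case by (simp add: cochain_ip_0)
next
  case (Suc q)
  let ?e = "bas R"
  have "(\<Sum>i\<in>idx R. cochain_ip R q (contract (brk R (?e i) x) f) (contract (?e i) g)) =
      (\<Sum>i\<in>idx R. \<Sum>j\<in>idx R. complex_of_real (Btheta R (brk R (?e i) x) (?e j)) *
        cochain_ip R q (contract (?e j) f) (contract (?e i) g))"
    by (simp only: cochain_ip_contract_expand[OF Suc.prems(1), of q "brk R _ _"])
  also have "\<dots> = (\<Sum>j\<in>idx R. \<Sum>i\<in>idx R. - (complex_of_real (Btheta R (brk R (?e j) (theta R x)) (?e i)) *
        cochain_ip R q (contract (?e j) f) (contract (?e i) g)))"
    by (subst sum.swap) (simp add: Btheta_brk[of _ x] Btheta_commute[of "?e _"])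
  also have "\<dots> = - (\<Sum>j\<in>idx R. cochain_ip R q (contract (?e j) f)
        (contract (brk R (?e j) (theta R x)) g))"
    by (simp only: cochain_ip_contract_expand_right[OF Suc.prems(2), of q _ "brk R _ _"] sum_negf)
  finally have eq: "(\<Sum>i\<in>idx R. cochain_ip R q (contract (brk R (?e i) x) f) (contract (?e i) g)) =
      - (\<Sum>j\<in>idx R. cochain_ip R q (contract (?e j) f) (contract (brk R (?e j) (theta R x)) g))" .
  have "of_nat (Suc q) * cochain_ip R (Suc q) (lie_der (brk R) x f) g =
      of_nat (Suc q) * (- cochain_ip R (Suc q) f (lie_der (brk R) (theta R x) g))"
    unfolding mult_minus_right cochain_ip_Suc contract_lie_der cochain_ip_add cochain_ip_add_right
      sum.distrib eq Suc.IH[OF V.alt_forms_contract[OF Suc.prems(1)] V.alt_forms_contract[OF Suc.prems(2)]]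
    by (simp add: sum_negf)
  then show ?case
    by (simp only: mult_cancel_left of_nat_eq_0_iff) simp
qed

section \<open>Definiteness of the product on cochains and uniqueness of adjoints\<close>

lemma herm_self_pos: "v \<noteq> 0 \<Longrightarrow> 0 < Re (herm R v v)"
  using hermitian_product unfolding hermitian_product_def by blast

lemma herm_self_eq_0: "herm R v v = 0 \<Longrightarrow> v = 0"
  using herm_self_pos[of v] by force

lemma herm_self_nonneg: "Im (herm R v v) = 0" "0 \<le> Re (herm R v v)"
proof -
  show "Im (herm R v v) = 0"
    using arg_cong[OF herm_cnj[of v v], of Im] by simp
  show "0 \<le> Re (herm R v v)"
    using herm_self_pos[of v] by (cases "v = 0") auto
qed

lemma cochain_ip_self_nonneg: "0 \<le> Re (cochain_ip R q f f)"
proof -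
  have "Re (z / fact q) = Re z / fact q" for z
    using Re_divide_of_nat[of z "fact q"] by simp
  then show ?thesis
    by (simp add: cochain_ip_def herm_self_nonneg(2) sum_nonneg)
qed

text \<open>The norms of the contractions with basis vectors are nonnegative and add up to a
  multiple of the norm of \<open>f\<close>, so each is zero; by induction these contractions vanish,
  and they determine \<open>f\<close>.\<close>

lemma cochain_ip_definite:
  assumes "f \<in> cochains R q" "cochain_ip R q f f = 0"
  shows "f = 0"
  using assms
proof (induction q arbitrary: f)
  case 0
  have "f Ws = 0" for Ws
    using 0 herm_self_eq_0 V.alt_formsD_length[OF 0(1)] by (cases Ws) (auto simp: cochain_ip_0)
  then show ?case by auto
next
  case (Suc q)
  have "(\<Sum>j\<in>idx R. Re (cochain_ip R q (contract (bas R j) f) (contract (bas R j) f))) = 0"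
    using arg_cong[OF cochain_ip_Suc[of q f f], of Re] Suc.prems(2) by simp
  then have Re0: "Re (cochain_ip R q (contract (bas R j) f) (contract (bas R j) f)) = 0" if "j \<in> idx R" for j
    using that by (subst (asm) sum_nonneg_eq_0_iff) (auto simp: cochain_ip_self_nonneg)
  have Im0: "Im (cochain_ip R q (contract (bas R j) f) (contract (bas R j) f)) = 0" for j
    using arg_cong[OF cochain_ip_cnj[of q "contract (bas R j) f" "contract (bas R j) f"], of Im] by simp
  have c: "contract (bas R j) f = 0" if "j \<in> idx R" for j
    using Re0[OF that] Im0
    by (intro Suc.IH V.alt_forms_contract[OF Suc.prems(1)]) (simp add: complex_eq_iff)
  have "contract x f Ws = 0" for x Ws
    using V.alt_forms_contract_sum[OF Suc.prems(1), of "\<lambda>j. Btheta R x (bas R j)" "bas R" "idx R" Ws]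
    by (simp add: bas_expand c del: Un_iff)
  then have "f Ws = 0" for Ws
    using V.alt_formsD_length[OF Suc.prems(1)] by (cases Ws) (auto simp: contract_def)
  then show ?case by auto
qed

text \<open>Turns the definite description into a check on a candidate; the difference of two
  candidates is orthogonal to itself.\<close>

lemma formal_adjoint_eq:
  assumes "h \<in> cochains R q"
    and adj: "\<And>f. f \<in> cochains R q \<Longrightarrow> cochain_ip R (Suc q) (D f) g = cochain_ip R q f h"
  shows "formal_adjoint R D (Suc q) g = h"
proof -
  have "h' = h" if "h' \<in> cochains R q"
    "\<forall>f\<in>cochains R q. cochain_ip R (Suc q) (D f) g = cochain_ip R q f h'" for h'
  proof -
    have d: "h' - h \<in> cochains R q"
      using that(1) assms(1) by (rule V.alt_forms_diff)
    have "cochain_ip R q (h' - h) (h' - h) = 0"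
      using that(2) adj d by (simp add: cochain_ip_diff_right)
    then have "h' - h = 0"
      by (rule cochain_ip_definite[OF d])
    then show ?thesis by (simp only: right_minus_eq)
  qed
  then show ?thesis
    unfolding formal_adjoint_def using assms by (auto intro!: the_equality)
qed

end

section \<open>The Laplacians\<close>

lemma contract_tau_ext: "contract y (tau_ext R x f) = tau_ext R x (contract y f)"
  by (simp add: tau_ext_def contract_def)

lemma d_circ_eq_antisymm: "d_circ R f = antisymm (scl R) (\<lambda>w. tau_ext R w f)"
  by (simp add: d_circ_def antisymm_def tau_ext_def)

context hermitian_lie_module
begin

lemmas cochains_lie_der = V.alt_forms_lie_der[OF lie]
lemmas cochains_contract_pred = V.alt_forms_contract_pred
lemmas d_wedge_rules = V.complex_space_axioms lie

lemma tau_ext_add: "tau_ext R x (f + g) = tau_ext R x f + tau_ext R x g"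
  by (auto simp: tau_ext_def tau_add)

lemma tau_ext_zero: "tau_ext R x 0 = 0"
  by (auto simp: tau_ext_def)

lemma tau_ext_uminus: "tau_ext R x (- f) = - tau_ext R x f"
  by (auto simp: tau_ext_def tau_uminus)

lemma tau_ext_sum: "tau_ext R x (\<Sum>i\<in>A. f i) = (\<Sum>i\<in>A. tau_ext R x (f i))"
  by (auto simp: tau_ext_def tau_sum sum_fun_apply)

lemma lie_der_tau_ext: "lie_der br y (tau_ext R x f) = tau_ext R x (lie_der br y f)"
  by (simp add: lie_der_def tau_ext_def tau_sum)

lemma cochains_tau_ext: "f \<in> cochains R q \<Longrightarrow> tau_ext R x f \<in> cochains R q"
  by (simp add: alt_forms_def tau_ext_def tau_linear_right)

lemma cochains_d_circ: "f \<in> cochains R q \<Longrightarrow> d_circ R f \<in> cochains R (Suc q)"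
  unfolding d_circ_eq_antisymm
  by (intro V.alt_forms_antisymm cochains_tau_ext) (auto simp: tau_ext_def tau_linear_left)

lemma cochains_d_wedge: "f \<in> cochains R q \<Longrightarrow> d_wedge R f \<in> cochains R (Suc q)"
  by (rule alt_forms_d_wedge[OF d_wedge_rules])

lemma cochains_cscale: "f \<in> cochains R q \<Longrightarrow> cscale R c f \<in> cochains R q"
  unfolding cscale_def by (rule V.alt_forms_scale)

lemma lie_der_cscale: "lie_der br x (cscale R c f) = cscale R c (lie_der br x f)"
  by (simp add: lie_der_def cscale_def V.scale_sum_right)

lemma contract_cscale: "contract x (cscale R c f) = cscale R c (contract x f)"
  by (simp add: contract_def cscale_def)

lemma d_wedge_sum: "d_wedge R (\<Sum>i\<in>A. f i) = (\<Sum>i\<in>A. d_wedge R (f i))"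
proof
  show "d_wedge R (\<Sum>i\<in>A. f i) Ws = (\<Sum>i\<in>A. d_wedge R (f i)) Ws" for Ws
    unfolding d_wedge_def sum_fun_apply V.scale_sum_right
    by (subst sum.swap) (simp add: sum.swap[of _ A])
qed

lemma d_wedge_cscale: "d_wedge R (cscale R c f) = cscale R c (d_wedge R f)"
  by (simp add: d_wedge_def cscale_def V.scale_sum_right mult.commute)

lemma delta_circ_eq:
  assumes "g \<in> cochains R q"
  shows "delta_circ R q g = - (\<Sum>j\<in>idx R. tau_ext R (bas R j) (contract (bas R j) g))"
proof (cases q)
  case 0
  \<comment> \<open>In degree 0 the adjoint is 0 by convention, and the formula agrees since every
    contraction vanishes there.\<close>
  have "contract x g = 0" for x
    using assms unfolding 0 by (rule V.alt_forms_0_contract)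
  then show ?thesis
    by (simp only: 0 delta_circ_def formal_adjoint_def tau_ext_zero sum.neutral_const minus_zero refl if_True)
next
  case (Suc n)
  show ?thesis
    unfolding delta_circ_def Suc
  proof (rule formal_adjoint_eq)
    show "- (\<Sum>j\<in>idx R. tau_ext R (bas R j) (contract (bas R j) g)) \<in> cochains R n"
      using assms Suc
      by (intro V.alt_forms_uminus V.alt_forms_sum cochains_tau_ext V.alt_forms_contract) auto
    fix f assume "f \<in> cochains R n"
    have "cochain_ip R n (tau_ext R x f) h = - cochain_ip R n f (tau_ext R x h)" for x h
      by (simp add: cochain_ip_def tau_ext_def herm_tau sum_negf)
    then show "cochain_ip R (Suc n) (d_circ R f) g =
        cochain_ip R n f (- (\<Sum>j\<in>idx R. tau_ext R (bas R j) (contract (bas R j) g)))"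
      using assms Suc
      by (simp only: d_circ_eq_antisymm cochain_ip_antisymm cochain_ip_uminus_right
          cochain_ip_sum_right sum_negf)
  qed
qed

lemma delta_wedge_eq:
  assumes "g \<in> cochains R q"
  shows "delta_wedge R q g = cscale R (- 1 / 2)
    (\<Sum>j\<in>idx R. lie_der (brk R) (theta R (bas R j)) (contract (bas R j) g))"
proof (cases q)
  case 0
  have "contract x g = 0" for x
    using assms unfolding 0 by (rule V.alt_forms_0_contract)
  moreover have "cscale R c 0 = 0" for c
    by (auto simp: cscale_def)
  ultimately show ?thesis
    by (simp only: 0 delta_wedge_def formal_adjoint_def lie_der_zero sum.neutral_const refl if_True)
next
  case (Suc n)
  let ?h = "\<Sum>j\<in>idx R. lie_der (brk R) (theta R (bas R j)) (contract (bas R j) g)"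
  show ?thesis
    unfolding delta_wedge_def Suc
  proof (rule formal_adjoint_eq)
    have g: "contract x g \<in> cochains R n" for x
      using V.alt_forms_contract assms Suc by simp
    show "cscale R (- 1 / 2) ?h \<in> cochains R n"
      by (intro cochains_cscale V.alt_forms_sum cochains_lie_der g)
    fix f assume f: "f \<in> cochains R n"
    have d: "d_wedge R f = (\<lambda>Ws. scl R (1 / 2) (antisymm (scl R) (\<lambda>w. lie_der (brk R) w f) Ws))"
      by (simp flip: d_wedge_eq_antisymm[OF d_wedge_rules f])
    have "cochain_ip R (Suc n) (d_wedge R f) g = 1 / 2 * - cochain_ip R n f ?h"
      unfolding d cochain_ip_scale cochain_ip_antisymm[OF assms[unfolded Suc]]
        cochain_ip_lie_der[OF f g] cochain_ip_sum_right by (simp only: sum_negf)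
    then show "cochain_ip R (Suc n) (d_wedge R f) g = cochain_ip R n f (cscale R (- 1 / 2) ?h)"
      unfolding cscale_def cochain_ip_scale_right by simp
  qed
qed

text \<open>The \<open>\<epsilon>\<close> terms of the two compositions differ only in the order of
  \<tau>(w) and \<tau>(X_j), and have opposite signs, so they combine to \<tau>[w, X_j]. The
  leftover squares \<tau>(X_j)^2 are exactly what \<open>box_circ\<close> compensates.\<close>

lemma box_circ_eq:
  assumes f: "f \<in> cochains R n"
  shows "box_circ R n f =
    - (\<Sum>j\<in>idx R. antisymm (scl R) (\<lambda>w. tau_ext R (brk R w (bas R j)) (contract (bas R j) f)))"
proof -
  let ?e = "bas R" and ?A = "antisymm (scl R)"
  have "d_circ R (delta_circ R n f) = ?A (\<lambda>w. - (\<Sum>j\<in>idx R. tau_ext R w (tau_ext R (?e j) (contract (?e j) f))))"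
    unfolding d_circ_eq_antisymm delta_circ_eq[OF f] by (simp only: tau_ext_uminus tau_ext_sum)
  then have 1: "d_circ R (delta_circ R n f) =
      - (\<Sum>j\<in>idx R. ?A (\<lambda>w. tau_ext R w (tau_ext R (?e j) (contract (?e j) f))))"
    by (simp only: V.antisymm_uminus V.antisymm_sum)
  have tau_A: "tau_ext R x (?A F) = ?A (\<lambda>w. tau_ext R x (F w))" for x F
    by (simp add: tau_ext_def antisymm_def tau_sum tau_scale)
  have "delta_circ R (Suc n) (d_circ R f) = - (\<Sum>j\<in>idx R. tau_ext R (?e j) (tau_ext R (?e j) f +
      - ?A (\<lambda>w. tau_ext R w (contract (?e j) f))))"
    unfolding delta_circ_eq[OF cochains_d_circ[OF f]]
    unfolding d_circ_eq_antisymm V.contract_antisymm contract_tau_ext diff_conv_add_uminus ..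
  then have 2: "delta_circ R (Suc n) (d_circ R f) = - tau_Omega_bar R f +
      (\<Sum>j\<in>idx R. ?A (\<lambda>w. tau_ext R (?e j) (tau_ext R w (contract (?e j) f))))"
    unfolding tau_ext_add tau_ext_uminus tau_A sum.distrib sum_negf tau_Omega_bar_def quad_action_def
    by (simp only: minus_add_distrib minus_minus)
  have "tau_ext R (brk R w x) g = tau_ext R w (tau_ext R x g) - tau_ext R x (tau_ext R w g)" for w x g
    by (auto simp: tau_ext_def tau_brk)
  then have 3: "?A (\<lambda>w. tau_ext R (brk R w (?e j)) (contract (?e j) f)) =
      ?A (\<lambda>w. tau_ext R w (tau_ext R (?e j) (contract (?e j) f))) -
      ?A (\<lambda>w. tau_ext R (?e j) (tau_ext R w (contract (?e j) f)))" for j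
    by (simp only: V.antisymm_diff)
  have group: "- a + (- t + b) + t = - (a - b)" for a b t :: "'g list \<Rightarrow> 'v"
    by auto
  show ?thesis
    unfolding box_circ_def lap_circ_def Suc_eq_plus1[symmetric] 1 2 3 sum_subtractf by (rule group)
qed

lemma box_circ_apply:
  assumes "f \<in> cochains R n"
  shows "box_circ R n f Ws =
    - (\<Sum>i<length Ws. \<Sum>j\<in>idx R. tau R (brk R (Ws ! i) (bas R j)) (f (Ws[i := bas R j])))"
proof -
  have "scl R ((- 1) ^ i) (tau R y (contract x f (del_nth i Ws))) = tau R y (f (Ws[i := x]))"
    if "i < length Ws" for i x y
    using V.alt_forms_move_sign[OF assms that] by (simp add: contract_def flip: tau_scale)
  then show ?thesis
    unfolding box_circ_eq[OF assms] by (simp add: sum_fun_apply antisymm_def tau_ext_def sum.swap[of _ "idx R"])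
qed

text \<open>Both compositions contain \<open>d_wedge\<close> of the contractions of \<open>f\<close>
  under the same Lie derivatives, with opposite signs; only the Lie derivative term of Cartan's
  formula survives.\<close>

lemma lap_wedge_eq:
  assumes f: "f \<in> cochains R n"
  shows "lap_wedge R n f = cscale R (- 1 / 2)
    (\<Sum>j\<in>idx R. lie_der (brk R) (theta R (bas R j)) (lie_der (brk R) (bas R j) f))"
proof -
  let ?e = "bas R"
  let ?L = "lie_der (brk R)"
  note cf = cochains_contract_pred[OF f]
  have "d_wedge R (delta_wedge R n f) =
      cscale R (- 1 / 2) (\<Sum>j\<in>idx R. ?L (theta R (?e j)) (d_wedge R (contract (?e j) f)))"
    unfolding delta_wedge_eq[OF f] d_wedge_cscale d_wedge_sum
    by (simp only: lie_der_d_wedge[OF d_wedge_rules cf])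
  moreover have "delta_wedge R (Suc n) (d_wedge R f) =
      cscale R (- 1 / 2) (\<Sum>j\<in>idx R. ?L (theta R (?e j)) (?L (?e j) f + - d_wedge R (contract (?e j) f)))"
    unfolding delta_wedge_eq[OF cochains_d_wedge[OF f]] contract_d_wedge[OF d_wedge_rules f] by simp
  moreover have "cscale R c g + cscale R c h = cscale R c (g + h)" for c g h
    by (auto simp: cscale_def V.scale_right_distrib)
  ultimately show ?thesis
    unfolding lap_wedge_def Suc_eq_plus1[symmetric] lie_der_plus lie_der_uminus sum.distrib sum_negf
    by simp
qed

section \<open>The dual coadjoint representation on functionals and on cochains\<close>

lemma cdual_expand:
  assumes "l \<in> cdual"
  shows "l x = (\<Sum>j\<in>idx R. complex_of_real (Btheta R x (bas R j)) * l (bas R j))"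
proof -
  have l: "l (a *\<^sub>R x + b *\<^sub>R y) = complex_of_real a * l x + complex_of_real b * l y" for a x b y
    using assms by (simp add: cdual_def)
  have "l (\<Sum>j\<in>A. c j *\<^sub>R X j) = (\<Sum>j\<in>A. complex_of_real (c j) * l (X j))" for A :: "'i set" and c X
  proof (induction A rule: infinite_finite_induct)
    case (insert a A)
    then show ?case
      using l[of "c a" "X a" 1 "\<Sum>j\<in>A. c j *\<^sub>R X j"] by simp
  qed (use l[of 0 0 0 0] in auto)
  from this[of "\<lambda>j. Btheta R x (bas R j)" "bas R" "idx R"] show ?thesis
    by (simp only: bas_expand)
qed

lemma Btheta_cdual: "(\<lambda>y. complex_of_real (Btheta R y x)) \<in> cdual"
  by (simp add: cdual_def linear_add[OF linear_Btheta(2)] linear_scale[OF linear_Btheta(2)])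

lemma coad_cdual: "l \<in> cdual \<Longrightarrow> coad R x l \<in> cdual"
  by (simp add: cdual_def coad_def lie_algebraD(1)[OF lie])

lemma cdual_ip_coad:
  assumes "l \<in> cdual" "m \<in> cdual"
  shows "cdual_ip R (coad R (theta R x) l) m = - cdual_ip R l (coad R x m)"
proof -
  let ?e = "bas R"
  have "cdual_ip R (coad R (theta R x) l) m = (\<Sum>j\<in>idx R. \<Sum>k\<in>idx R.
      complex_of_real (Btheta R (brk R (?e j) (theta R x)) (?e k)) * l (?e k) * cnj (m (?e j)))"
    unfolding cdual_ip_def coad_def
    by (subst cdual_expand[OF assms(1)]) (simp add: sum_distrib_right)
  also have "\<dots> = (\<Sum>k\<in>idx R. \<Sum>j\<in>idx R. - (l (?e k) *
      (complex_of_real (Btheta R (brk R (?e k) x) (?e j)) * cnj (m (?e j)))))"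
    by (subst sum.swap) (simp add: Btheta_brk[of "?e _" "theta R x"] Btheta_commute[of "?e _" "brk R _ _"] ac_simps)
  also have "\<dots> = - cdual_ip R l (coad R x m)"
    unfolding cdual_ip_def coad_def
    by (subst (2) cdual_expand[OF assms(2)]) (simp add: sum_negf sum_distrib_left)
  finally show ?thesis .
qed

text \<open>Testing against the dual basis functionals recovers the values on the basis, which
  determine a functional; this settles uniqueness. Since \<open>theta\<close> is 1 on
  \<open>kpart\<close> and -1 on \<open>ppart\<close>, the familiar signs of coad* follow.\<close>

lemma coad_star_eq:
  assumes l: "l \<in> cdual"
  shows "coad_star R x l = coad R (theta R x) l"
  unfolding coad_star_def
proof (rule the_equality)
  show "coad R (theta R x) l \<in> cdual \<and>
      (\<forall>m\<in>cdual. cdual_ip R (coad R (theta R x) l) m = - cdual_ip R l (coad R x m))"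
    using coad_cdual[OF l] cdual_ip_coad[OF l] by blast
  fix l' assume l': "l' \<in> cdual \<and> (\<forall>m\<in>cdual. cdual_ip R l' m = - cdual_ip R l (coad R x m))"
  have eval: "cdual_ip R k (\<lambda>y. complex_of_real (Btheta R y (bas R j))) = k (bas R j)"
    if "j \<in> idx R" for k j
  proof -
    have "cdual_ip R k (\<lambda>y. complex_of_real (Btheta R y (bas R j))) =
        (\<Sum>i\<in>idx R. if i = j then k (bas R i) else 0)"
      unfolding cdual_ip_def by (rule sum.cong) (simp_all add: Btheta_bas[OF _ that] del: Un_iff)
    then show ?thesis using that by simp
  qed
  have "l' (bas R j) = coad R (theta R x) l (bas R j)" if "j \<in> idx R" for j
    using l' cdual_ip_coad[OF l Btheta_cdual[of "bas R j"], of x] Btheta_cdual[of "bas R j"]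
    by (metis eval[OF that])
  then show "l' = coad R (theta R x) l"
    using l' cdual_expand[of l'] cdual_expand[OF coad_cdual[OF l], of "theta R x"]
    by (metis (no_types, lifting) ext sum.cong)
qed

text \<open>Inserting basis vectors weighted by their coordinates reassembles the bracket in its
  slot, so the basis in \<open>deriv_ext\<close> disappears.\<close>

lemma coad_ext_eq:
  assumes "f \<in> cochains R n"
  shows "coad_ext R x f = lie_der (brk R) x f"
proof
  have "(\<Sum>j\<in>idx R. scl R (complex_of_real (Btheta R y (bas R j))) (f (Ws[i := bas R j]))) = f (Ws[i := y])"
    if "i < length Ws" for i Ws y
    using V.alt_forms_update_sum[OF assms that, of "\<lambda>j. Btheta R y (bas R j)" "bas R" "idx R"]
    by (simp only: bas_expand)
  then show "coad_ext R x f Ws = lie_der (brk R) x f Ws" for Ws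
    by (simp add: coad_ext_def deriv_ext_def coad_def lie_der_def)
qed

lemma coad_star_ext_eq_coad_ext: "coad_star_ext R x f = coad_ext R (theta R x) f"
  by (simp add: coad_star_ext_def coad_ext_def deriv_ext_def coad_star_eq[OF Btheta_cdual])

lemma coad_star_ext_eq: "f \<in> cochains R n \<Longrightarrow> coad_star_ext R x f = lie_der (brk R) (theta R x) f"
  by (simp only: coad_star_ext_eq_coad_ext coad_ext_eq)

end

text \<open>Projection onto the forms that take exactly \<open>p\<close> arguments from
  \<open>kpart\<close>: each argument is distributed over its two components. With \<open>p\<close>
  an integer, a branch that uses too many \<open>kpart\<close> components goes negative and ends in
  0.\<close>

fun bidegree_part ::
    "('g::real_vector, 'v, 'i) lie_data \<Rightarrow> int \<Rightarrow> ('g list \<Rightarrow> 'w::comm_monoid_add) \<Rightarrow> 'g list \<Rightarrow> 'w" where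
  "bidegree_part R p f [] = (if p = 0 then f [] else 0)"
| "bidegree_part R p f (x # Ws) =
     bidegree_part R (p - 1) (contract ((1 / 2) *\<^sub>R (x + theta R x)) f) Ws +
     bidegree_part R p (contract ((1 / 2) *\<^sub>R (x - theta R x)) f) Ws"

lemma bidegree_part_add: "bidegree_part R p (f + g) = bidegree_part R p f + bidegree_part R p g"
proof
  show "bidegree_part R p (f + g) Ws = (bidegree_part R p f + bidegree_part R p g) Ws" for Ws
  proof (induction Ws arbitrary: p f g)
    case (Cons x Ws)
    show ?case
      unfolding bidegree_part.simps contract_plus Cons.IH by (simp add: ac_simps)
  qed simp
qed

lemma bidegree_part_zero: "bidegree_part R p 0 = 0"
proof
  show "bidegree_part R p 0 Ws = 0 Ws" for Ws
  proof (induction Ws arbitrary: p)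
    case (Cons x Ws)
    show ?case
      unfolding bidegree_part.simps contract_zero Cons.IH by simp
  qed simp
qed

context hermitian_lie_module
begin

text \<open>
  The tensor \<open>\<Sum>\<^sub>j X\<^sub>j \<otimes> [w, \<theta> X\<^sub>j]\<close> is antisymmetric, because \<open>x \<mapsto> [w, \<theta> x]\<close> is skew for \<open>Btheta\<close>.
\<close>

lemma tau_coad_star_swap:
  assumes "f \<in> cochains R n" "i < length Ws"
  shows "(\<Sum>j\<in>idx R. tau R (bas R j) (f (Ws[i := brk R w (theta R (bas R j))]))) =
    - (\<Sum>j\<in>idx R. tau R (brk R w (theta R (bas R j))) (f (Ws[i := bas R j])))"
proof -
  let ?e = "bas R" and ?c = "\<lambda>x j. complex_of_real (Btheta R (brk R w (theta R x)) (bas R j))"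
  have f: "f (Ws[i := x]) = (\<Sum>j\<in>idx R. scl R (complex_of_real (Btheta R x (?e j))) (f (Ws[i := ?e j])))"
    for x
    using V.alt_forms_update_sum[OF assms, of "\<lambda>j. Btheta R x (?e j)" ?e "idx R"]
    by (simp only: bas_expand)
  have t: "tau R x u = (\<Sum>j\<in>idx R. scl R (complex_of_real (Btheta R x (?e j))) (tau R (?e j) u))" for x u
    using tau_sum_left[of "\<lambda>j. Btheta R x (?e j)" ?e "idx R"] by (simp only: bas_expand)
  have skew: "Btheta R (brk R w (theta R x)) y = - Btheta R (brk R w (theta R y)) x" for x y
  proof -
    have "Btheta R (brk R w (theta R x)) y = - Btheta R (brk R (theta R x) w) y"
      using lie_algebraD(3)[OF lie, of w "theta R x"] linear_neg[OF linear_Btheta(2)] by simp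
    also have "\<dots> = Btheta R x (theta R (brk R y (theta R w)))"
      by (simp add: Btheta_brk Btheta_theta)
    also have "theta R (brk R y (theta R w)) = - brk R w (theta R y)"
      using lie_algebraD(3)[OF lie, of "theta R y" w] by (simp add: theta_brk)
    finally show ?thesis
      by (simp add: linear_neg[OF linear_Btheta(1)] Btheta_commute)
  qed
  have "(\<Sum>j\<in>idx R. tau R (?e j) (f (Ws[i := brk R w (theta R (?e j))]))) =
      (\<Sum>j\<in>idx R. \<Sum>k\<in>idx R. scl R (?c (?e j) k) (tau R (?e j) (f (Ws[i := ?e k]))))"
    by (subst f) (simp add: tau_sum tau_scale)
  also have "\<dots> = (\<Sum>k\<in>idx R. \<Sum>j\<in>idx R. - scl R (?c (?e k) j) (tau R (?e j) (f (Ws[i := ?e k]))))"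
    by (subst sum.swap, intro sum.cong refl, subst skew) simp
  also have "\<dots> = - (\<Sum>k\<in>idx R. tau R (brk R w (theta R (?e k))) (f (Ws[i := ?e k])))"
    by (subst (2) t) (simp only: sum_negf)
  finally show ?thesis .
qed

text \<open>The swap above moves the bracket from inside \<open>f\<close> to \<tau>. The result has
  the shape of \<open>box_circ_apply\<close> with \<theta> X_j for X_j in the bracket, so the two
  can be compared term by term.\<close>

lemma tau_coad_star_apply:
  assumes "f \<in> cochains R n"
  shows "(\<Sum>j\<in>idx R. tau_ext R (bas R j) (coad_star_ext R (bas R j) f)) Ws =
    - (\<Sum>i<length Ws. \<Sum>j\<in>idx R. tau R (brk R (Ws ! i) (theta R (bas R j))) (f (Ws[i := bas R j])))"
proof -
  have "(\<Sum>j\<in>idx R. tau_ext R (bas R j) (coad_star_ext R (bas R j) f)) Ws =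
      (\<Sum>i<length Ws. \<Sum>j\<in>idx R. tau R (bas R j) (f (Ws[i := brk R (Ws ! i) (theta R (bas R j))])))"
    by (simp add: sum_fun_apply tau_ext_def coad_star_ext_eq[OF assms] lie_der_def tau_sum
        sum.swap[of _ "idx R"])
  also have "\<dots> = (\<Sum>i<length Ws. - (\<Sum>j\<in>idx R. tau R (brk R (Ws ! i) (theta R (bas R j)))
      (f (Ws[i := bas R j]))))"
    by (rule sum.cong[OF refl], rule tau_coad_star_swap[OF assms]) simp
  finally show ?thesis
    by (simp only: sum_negf)
qed

text \<open>For any dual bases, the tensor with terms \<theta> Z_i and \<theta> Z'_i is minus the
  tensor with terms \<theta> X_j and X_j: the second factor is expanded in the orthonormal basis,
  then duality reassembles the first. The minus is the one in the definition of
  \<open>Btheta\<close>.\<close>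

lemma D_g_eq:
  assumes dual: "dual_bases R J Z Z'" and f: "f \<in> cochains R n"
  shows "D_g R J Z Z' f = cscale R (- 1 / 2)
    (\<Sum>j\<in>idx R. lie_der (brk R) (theta R (bas R j)) (lie_der (brk R) (bas R j) f))"
proof
  fix Ws
  let ?L = "lie_der (brk R)" and ?e = "bas R"
  have J: "finite J" "span (Z ` J) = UNIV"
    and frm_ZZ': "\<And>i j. i \<in> J \<Longrightarrow> j \<in> J \<Longrightarrow> frm R (Z i) (Z' j) = (if i = j then 1 else 0)"
    using dual by (auto simp: dual_bases_def)
  have lin: "linear (\<lambda>x. frm R x y)" for y
  proof -
    have "(\<lambda>x. frm R x y) = frm R y" by (rule ext) (rule frm_commute)
    then show ?thesis using linear_frm by simp
  qed
  have Z_expand: "(\<Sum>i\<in>J. frm R x (Z' i) *\<^sub>R Z i) = x" for x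
  proof -
    have "x \<in> span (Z ` J)"
      by (simp add: J)
    then show ?thesis
    proof (induction rule: span_induct_alt)
      case base
      then show ?case by (simp add: linear_0[OF lin])
    next
      case (step c b y)
      then obtain k where k: "k \<in> J" "b = Z k" by auto
      have "(\<Sum>i\<in>J. frm R b (Z' i) *\<^sub>R Z i) = (\<Sum>i\<in>J. if k = i then Z i else 0)"
        by (rule sum.cong) (simp_all add: k frm_ZZ'[OF k(1)])
      also have "\<dots> = b"
        using k J(1) by simp
      finally show ?case
        using step.IH
        by (simp add: linear_add[OF lin] linear_scale[OF lin] scaleR_left_distrib sum.distrib
            flip: scaleR_scaleR scaleR_sum_right)
    qed
  qed
  have Z'_expand: "(\<Sum>j\<in>idx R. (- frm R (?e j) (Z' i)) *\<^sub>R ?e j) = theta R (Z' i)" for i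
  proof -
    have "Btheta R (theta R (Z' i)) (?e j) = - frm R (?e j) (Z' i)" for j
      by (simp add: Btheta_def frm_theta frm_commute)
    then show ?thesis
      using bas_expand[of "theta R (Z' i)"] by simp
  qed
  have "quad_action (coad_star_ext R) J Z Z' f Ws =
      (\<Sum>i\<in>J. ?L (theta R (Z i)) (?L (theta R (Z' i)) f) Ws)"
    by (simp add: quad_action_def sum_fun_apply coad_star_ext_eq[OF f]
        coad_star_ext_eq[OF cochains_lie_der[OF f]])
  also have "\<dots> = (\<Sum>i\<in>J. \<Sum>j\<in>idx R. scl R (complex_of_real (- frm R (?e j) (Z' i)))
      (?L (theta R (Z i)) (?L (?e j) f) Ws))"
  proof (rule sum.cong[OF refl])
    fix i
    have "?L (theta R (Z' i)) f =
        (\<Sum>j\<in>idx R. cscale R (complex_of_real (- frm R (?e j) (Z' i))) (?L (?e j) f))"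
      using V.lie_der_sum_left[OF lie f, of "\<lambda>j. - frm R (?e j) (Z' i)" ?e "idx R"]
      by (auto simp: Z'_expand[symmetric] sum_fun_apply cscale_def simp del: Un_iff)
    then show "?L (theta R (Z i)) (?L (theta R (Z' i)) f) Ws =
        (\<Sum>j\<in>idx R. scl R (complex_of_real (- frm R (?e j) (Z' i))) (?L (theta R (Z i)) (?L (?e j) f) Ws))"
      by (simp only: lie_der_sum lie_der_cscale sum_fun_apply) (simp only: cscale_def)
  qed
  also have "\<dots> = (\<Sum>j\<in>idx R. - (\<Sum>i\<in>J. scl R (complex_of_real (frm R (?e j) (Z' i)))
      (?L (theta R (Z i)) (?L (?e j) f) Ws)))"
    by (subst sum.swap) (simp add: sum_negf)
  also have "\<dots> = (\<Sum>j\<in>idx R. - ?L (theta R (?e j)) (?L (?e j) f) Ws)"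
  proof (intro sum.cong refl arg_cong[of _ _ uminus])
    fix j
    have "(\<Sum>i\<in>J. frm R (?e j) (Z' i) *\<^sub>R theta R (Z i)) = theta R (?e j)"
      using arg_cong[OF Z_expand[of "?e j"], of "theta R"]
      by (simp add: linear_sum[OF linear_theta] linear_scale[OF linear_theta])
    then show "(\<Sum>i\<in>J. scl R (complex_of_real (frm R (?e j) (Z' i))) (?L (theta R (Z i)) (?L (?e j) f) Ws)) =
        ?L (theta R (?e j)) (?L (?e j) f) Ws"
      using V.lie_der_sum_left[OF lie cochains_lie_der[OF f], of "\<lambda>i. frm R (?e j) (Z' i)" "\<lambda>i. theta R (Z i)" J]
      by simp
  qed
  finally show "D_g R J Z Z' f Ws = cscale R (- 1 / 2) (\<Sum>j\<in>idx R. ?L (theta R (?e j)) (?L (?e j) f)) Ws"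
    by (simp add: D_g_def cscale_def sum_fun_apply sum_negf)
qed

section \<open>The mixed Laplacians on one-cochains and the splitting of the full Laplacian\<close>

lemma lie_der_cochains_0: "f \<in> cochains R 0 \<Longrightarrow> lie_der br x f = 0"
  by (auto simp: lie_der_def fun_eq_iff intro!: sum.neutral V.alt_formsD_length[of f 0])

lemma d_wedge_cochains_0: "f \<in> cochains R 0 \<Longrightarrow> d_wedge R f = 0"
  by (auto simp: d_wedge_def V.alt_formsD_length)

lemma d_circ_zero: "d_circ R 0 = 0"
  by (auto simp: d_circ_def)

lemma cscale_zero: "cscale R c 0 = 0"
  by (auto simp: cscale_def)

text \<open>Zero-cochains are killed by \<open>d_wedge\<close>; this removes one composition and, in
  the other, the second term of Cartan's formula.\<close>

lemma lap_wedge_circ_1: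
  assumes f: "f \<in> cochains R 1"
  shows "lap_wedge_circ R 1 f = - (\<Sum>j\<in>idx R. tau_ext R (bas R j) (lie_der (brk R) (bas R j) f))"
proof -
  have cf: "contract x f \<in> cochains R 0" for x
    using cochains_contract_pred[OF f] by simp
  have "delta_circ R 1 f \<in> cochains R 0"
    unfolding delta_circ_eq[OF f] by (intro V.alt_forms_uminus V.alt_forms_sum cochains_tau_ext cf)
  then have "d_wedge R (delta_circ R 1 f) = 0"
    by (rule d_wedge_cochains_0)
  moreover have "delta_circ R (1 + 1) (d_wedge R f) =
      - (\<Sum>j\<in>idx R. tau_ext R (bas R j) (lie_der (brk R) (bas R j) f))"
    using delta_circ_eq[OF cochains_d_wedge[OF f]]
    by (simp only: Suc_eq_plus1 contract_d_wedge[OF d_wedge_rules f] d_wedge_cochains_0[OF cf] diff_0_right)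
  ultimately show ?thesis
    by (simp only: lap_wedge_circ_def add_0_left)
qed

text \<open>The two terms of the contracted \<open>d_circ R f\<close> contribute equally, which
  cancels the 1/2 of the codifferential. Here \<theta> survives and produces coad*, where the other
  mixed Laplacian has coad; this is why \<open>C_p\<close> enters the two with opposite
  signs.\<close>

lemma lap_circ_wedge_1:
  assumes f: "f \<in> cochains R 1"
  shows "lap_circ_wedge R 1 f = - (\<Sum>j\<in>idx R. tau_ext R (bas R j) (coad_star_ext R (bas R j) f))"
    (is "_ = - ?S")
proof -
  let ?e = "bas R" and ?L = "lie_der (brk R)"
  have cf: "contract x f \<in> cochains R 0" for x
    using cochains_contract_pred[OF f] by simp
  have "d_circ R (delta_wedge R 1 f) = 0"
    unfolding delta_wedge_eq[OF f] lie_der_cochains_0[OF cf]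
    by (simp only: sum.neutral_const cscale_zero d_circ_zero)
  moreover have "delta_wedge R (1 + 1) (d_circ R f) = cscale R (- 1 / 2)
      (\<Sum>j\<in>idx R. ?L (theta R (?e j)) (tau_ext R (?e j) f + - d_circ R (contract (?e j) f)))"
    using delta_wedge_eq[OF cochains_d_circ[OF f]]
    by (simp only: Suc_eq_plus1 d_circ_eq_antisymm V.contract_antisymm contract_tau_ext diff_conv_add_uminus)
  moreover have "(\<Sum>j\<in>idx R. ?L (theta R (?e j)) (tau_ext R (?e j) f)) = ?S"
    by (simp only: lie_der_tau_ext coad_star_ext_eq[OF f])
  \<comment> \<open>On a single argument W the left side is the sum of \<tau>[W, \<theta> X_j]
    f[X_j], the expression in \<open>tau_coad_star_apply\<close>.\<close>
  moreover have "(\<Sum>j\<in>idx R. ?L (theta R (?e j)) (d_circ R (contract (?e j) f))) = - ?S"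
  proof (rule V.alt_forms_eqI_ext)
    show "(\<Sum>j\<in>idx R. ?L (theta R (?e j)) (d_circ R (contract (?e j) f))) \<in> cochains R 1"
      unfolding One_nat_def by (intro V.alt_forms_sum cochains_lie_der cochains_d_circ cf)
    show "- ?S \<in> cochains R 1"
      unfolding coad_star_ext_eq[OF f]
      by (intro V.alt_forms_uminus V.alt_forms_sum cochains_lie_der cochains_tau_ext f)
    fix Ws :: "'g list" assume "length Ws = 1"
    then obtain W where Ws: "Ws = [W]"
      by (auto simp: length_Suc_conv)
    show "(\<Sum>j\<in>idx R. ?L (theta R (?e j)) (d_circ R (contract (?e j) f))) Ws = (- ?S) Ws"
      using tau_coad_star_apply[OF f, of "[W]"]
      by (simp add: Ws sum_fun_apply lie_der_def d_circ_def contract_def)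
  qed
  moreover have "scl R (- 1 / 2) (u + u) = - u" for u
    using V.scale_left_distrib[of "- 1 / 2" "- 1 / 2" u] by (simp add: V.scale_right_distrib)
  then have "cscale R (- 1 / 2) (?S + ?S) = - ?S"
    by (simp add: cscale_def fun_eq_iff del: Un_iff)
  ultimately show ?thesis
    unfolding lap_circ_wedge_def lie_der_plus lie_der_uminus sum.distrib sum_negf
    by (simp only: add_0_left minus_minus)
qed

text \<open>Additivity of the codifferentials cannot be read off their definite descriptions, so it
  is taken from the explicit formulas.\<close>

lemma laplacian_eq:
  assumes f: "f \<in> cochains R n"
  shows "laplacian R n f = lap_circ R n f + lap_wedge R n f + lap_circ_wedge R n f + lap_wedge_circ R n f"
proof -
  have d_add: "d_circ R (g + h) = d_circ R g + d_circ R h" "d_wedge R (g + h) = d_wedge R g + d_wedge R h" for g h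
    by (auto simp: d_circ_def d_wedge_def tau_add V.scale_right_distrib sum.distrib)
  note c = cochains_d_circ[OF f] cochains_d_wedge[OF f]
  have "cscale R x (g + h) = cscale R x g + cscale R x h" for x g h
    by (auto simp: cscale_def V.scale_right_distrib)
  then have delta_add:
    "delta_circ R (Suc n) (d_circ R f + d_wedge R f) =
      delta_circ R (Suc n) (d_circ R f) + delta_circ R (Suc n) (d_wedge R f)"
    "delta_wedge R (Suc n) (d_circ R f + d_wedge R f) =
      delta_wedge R (Suc n) (d_circ R f) + delta_wedge R (Suc n) (d_wedge R f)"
    unfolding delta_circ_eq[OF c(1)] delta_circ_eq[OF c(2)] delta_circ_eq[OF V.alt_forms_plus[OF c]]
      delta_wedge_eq[OF c(1)] delta_wedge_eq[OF c(2)] delta_wedge_eq[OF V.alt_forms_plus[OF c]]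
    by (simp_all only: contract_plus tau_ext_add lie_der_plus sum.distrib minus_add_distrib)
  have delta: "delta_total R m g = delta_circ R m g + delta_wedge R m g" for m g
    by (simp add: delta_total_def fun_eq_iff)
  show ?thesis
    unfolding laplacian_def d_total_def delta d_add lap_circ_def lap_wedge_def lap_circ_wedge_def
      lap_wedge_circ_def Suc_eq_plus1[symmetric] delta_add by (simp only: ac_simps)
qed

lemma kpart_ppart_brk:
  "x \<in> kpart R \<Longrightarrow> y \<in> kpart R \<Longrightarrow> brk R x y \<in> kpart R"
  "x \<in> ppart R \<Longrightarrow> y \<in> kpart R \<Longrightarrow> brk R x y \<in> ppart R"
  "x \<in> kpart R \<Longrightarrow> y \<in> ppart R \<Longrightarrow> brk R x y \<in> ppart R"
  "x \<in> ppart R \<Longrightarrow> y \<in> ppart R \<Longrightarrow> brk R x y \<in> kpart R"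
  using lie_algebraD(1)[OF lie, of "- 1" x 0 0 y] lie_algebraD(1)[OF lie, of "- 1" x 0 0 "- y"]
    lie_algebraD(2)[OF lie, of x "- 1" y 0 0] lie_algebraD(2)[OF lie, of "- x" "- 1" y 0 0]
  by (auto simp: kpart_def ppart_def theta_brk)

lemma bas_kpart: "j \<in> idx_k R \<Longrightarrow> bas R j \<in> kpart R"
  by (simp add: kpart_def theta_bas_k)

lemma bas_ppart: "j \<in> idx_p R \<Longrightarrow> bas R j \<in> ppart R"
  by (simp add: ppart_def theta_bas_p)

section \<open>Bidegrees\<close>

text \<open>The sum of the spaces of bidegree (p, n - p) over p in \<open>S\<close>. A set of
  degrees describes the image of an operator that shifts bidegrees both ways; members of
  \<open>S\<close> outside 0..n contribute nothing.\<close>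

definition graded :: "int set \<Rightarrow> nat \<Rightarrow> ('g list \<Rightarrow> 'v) set" where
  "graded S n = {f \<in> cochains R n. \<forall>Us Ws. set Us \<subseteq> kpart R \<longrightarrow> set Ws \<subseteq> ppart R \<longrightarrow>
     int (length Us) \<notin> S \<longrightarrow> f (Us @ Ws) = 0}"

lemma gradedI:
  "f \<in> cochains R n \<Longrightarrow>
   (\<And>Us Ws. set Us \<subseteq> kpart R \<Longrightarrow> set Ws \<subseteq> ppart R \<Longrightarrow> int (length Us) \<notin> S \<Longrightarrow> f (Us @ Ws) = 0) \<Longrightarrow>
   f \<in> graded S n"
  by (simp add: graded_def)

lemma graded_cochains: "f \<in> graded S n \<Longrightarrow> f \<in> cochains R n"
  by (simp add: graded_def)

lemma gradedD:
  "f \<in> graded S n \<Longrightarrow> set Us \<subseteq> kpart R \<Longrightarrow> set Ws \<subseteq> ppart R \<Longrightarrow> int (length Us) \<notin> S \<Longrightarrow>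
   f (Us @ Ws) = 0"
  by (simp add: graded_def)

text \<open>On lists of the right length p determines q, and on all others the form vanishes. The
  assumption keeps \<open>nat\<close> from truncating.\<close>

lemma bicochains_eq_graded:
  assumes "0 \<le> p + q"
  shows "bicochains R p q = graded {p} (nat (p + q))"
proof -
  have "f (Us @ Ws) = 0"
    if "f \<in> cochains R (nat (p + q))" "(int (length Us), int (length Ws)) \<noteq> (p, q)" "int (length Us) = p"
    for f :: "'g list \<Rightarrow> 'v" and Us Ws
    using that assms by (intro V.alt_formsD_length[OF that(1)]) auto
  then show ?thesis
    unfolding biforms_def graded_def by (intro Collect_cong conj_cong refl) blast
qed

text \<open>In degree one this collapses a shifted set such as {0, 2} to a single degree.\<close>

lemma graded_restrict:
  assumes "f \<in> graded S n" "S \<inter> {0..int n} \<subseteq> T"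
  shows "f \<in> graded T n"
proof (rule gradedI)
  show "f \<in> cochains R n" using assms(1) by (rule graded_cochains)
  fix Us Ws assume UW: "set Us \<subseteq> kpart R" "set Ws \<subseteq> ppart R" "int (length Us) \<notin> T"
  show "f (Us @ Ws) = 0"
  proof (cases "length (Us @ Ws) = n")
    case True
    then have "int (length Us) \<in> {0..int n}" by simp
    then have "int (length Us) \<notin> S" using UW(3) assms(2) by blast
    then show ?thesis using UW by (intro gradedD[OF assms(1)])
  next
    case False
    then show ?thesis by (rule V.alt_formsD_length[OF graded_cochains[OF assms(1)]])
  qed
qed

lemma graded_mono: "f \<in> graded S n \<Longrightarrow> S \<subseteq> T \<Longrightarrow> f \<in> graded T n"
  by (erule graded_restrict) auto

lemma graded_zero: "0 \<in> graded S n"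
  by (intro gradedI V.alt_forms_zero) simp

lemma graded_add: "f \<in> graded S n \<Longrightarrow> g \<in> graded S n \<Longrightarrow> f + g \<in> graded S n"
  by (simp add: graded_def V.alt_forms_plus del: plus_fun_apply) simp

lemma graded_uminus: "f \<in> graded S n \<Longrightarrow> - f \<in> graded S n"
  by (simp add: graded_def V.alt_forms_uminus)

lemma graded_diff: "f \<in> graded S n \<Longrightarrow> g \<in> graded S n \<Longrightarrow> f - g \<in> graded S n"
  unfolding diff_conv_add_uminus by (intro graded_add graded_uminus)

lemma graded_sum: "(\<And>i. i \<in> A \<Longrightarrow> f i \<in> graded S n) \<Longrightarrow> (\<Sum>i\<in>A. f i) \<in> graded S n"
  by (induction A rule: infinite_finite_induct) (auto intro: graded_zero graded_add simp del: plus_fun_apply zero_fun_apply)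

lemma graded_cscale: "f \<in> graded S n \<Longrightarrow> cscale R c f \<in> graded S n"
  by (simp add: graded_def cochains_cscale) (simp add: cscale_def)

lemma graded_tau_ext: "f \<in> graded S n \<Longrightarrow> tau_ext R x f \<in> graded S n"
  by (simp add: graded_def cochains_tau_ext) (simp add: tau_ext_def)

lemma graded_contract_kpart:
  assumes "f \<in> graded S n" "x \<in> kpart R"
  shows "contract x f \<in> graded {r. r + 1 \<in> S} (n - 1)"
proof (rule gradedI)
  fix Us Ws assume "set Us \<subseteq> kpart R" "set Ws \<subseteq> ppart R" "int (length Us) \<notin> {r. r + 1 \<in> S}"
  then show "contract x f (Us @ Ws) = 0"
    using gradedD[OF assms(1), of "x # Us" Ws] assms(2) by (simp add: contract_def add.commute)
qed (intro V.alt_forms_contract_pred graded_cochains[OF assms(1)])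

text \<open>The head \<open>x\<close> has to move behind the arguments from \<open>kpart\<close>;
  the sign this costs does not affect vanishing.\<close>

lemma graded_contract_ppart:
  assumes "f \<in> graded S n" "x \<in> ppart R"
  shows "contract x f \<in> graded S (n - 1)"
proof (rule gradedI)
  fix Us Ws assume "set Us \<subseteq> kpart R" "set Ws \<subseteq> ppart R" "int (length Us) \<notin> S"
  then show "contract x f (Us @ Ws) = 0"
    using gradedD[OF assms(1), of Us "x # Ws"] assms(2)
      V.alt_forms_move[OF graded_cochains[OF assms(1)], of "length Us" "Us @ x # Ws" x]
    by (simp add: contract_def del_nth_def)
qed (intro V.alt_forms_contract_pred graded_cochains[OF assms(1)])

lemma kpart_ppart_components:
  "(1 / 2) *\<^sub>R (x + theta R x) \<in> kpart R" "(1 / 2) *\<^sub>R (x - theta R x) \<in> ppart R"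
  "(1 / 2) *\<^sub>R (x + theta R x) + (1 / 2) *\<^sub>R (x - theta R x) = x"
  by (auto simp: kpart_def ppart_def linear_scale[OF linear_theta] linear_add[OF linear_theta]
      linear_diff[OF linear_theta] add.commute simp flip: scaleR_add_right scaleR_minus_right scaleR_2)

text \<open>A form is determined by its values on lists with all \<open>kpart\<close> arguments
  before all \<open>ppart\<close> arguments, because contraction with any vector splits into
  contractions with its two components. Equalities of forms are later proved by testing differences
  on such lists.\<close>

lemma graded_empty: "f \<in> graded {} n \<Longrightarrow> f = 0"
proof (induction n arbitrary: f)
  case 0
  have "f Ws = 0" for Ws
    using gradedD[OF 0, of "[]" "[]"] V.alt_formsD_length[OF graded_cochains[OF 0]] by (cases Ws) auto
  then show ?case by auto
next
  case (Suc n)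
  have "contract y f = 0" if "y \<in> kpart R \<union> ppart R" for y
    using that graded_contract_kpart[OF Suc.prems, of y] graded_contract_ppart[OF Suc.prems, of y]
    by (intro Suc.IH) auto
  then have "contract x f = 0 + 0" for x
    using V.alt_forms_contract_add[OF graded_cochains[OF Suc.prems]]
      kpart_ppart_components[of x] by (metis UnI1 UnI2)
  then have c: "contract x f = contract x 0" for x
    by (simp only: contract_zero add_0_left)
  show ?case
    by (rule list_fun_eqI[OF _ c]) (use V.alt_formsD_length[OF graded_cochains[OF Suc.prems], of "[]"] in simp)
qed

lemma graded_lie_der_kpart:
  assumes "f \<in> graded S n" "x \<in> kpart R"
  shows "lie_der (brk R) x f \<in> graded S n"
proof (rule gradedI)
  show "lie_der (brk R) x f \<in> cochains R n"
    by (intro cochains_lie_der graded_cochains[OF assms(1)])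
  have p: "lie_der (brk R) x f Ws = 0"
    if "f \<in> graded S n" "set Ws \<subseteq> ppart R" "0 \<notin> S" for f S n Ws
    using that
  proof (induction Ws arbitrary: f n)
    case (Cons w Ws)
    then show ?case
      using gradedD[OF Cons.prems(1), of "[]" "brk R w x # Ws"] assms(2) graded_contract_ppart
      by (force simp: lie_der_Cons kpart_ppart_brk)
  qed simp
  fix Us Ws assume "set Us \<subseteq> kpart R" "set Ws \<subseteq> ppart R" "int (length Us) \<notin> S"
  then show "lie_der (brk R) x f (Us @ Ws) = 0"
    using assms(1)
  proof (induction Us arbitrary: f S n)
    case (Cons u Us)
    have "lie_der (brk R) x (contract u f) (Us @ Ws) = 0"
      using Cons.prems by (intro Cons.IH[OF _ _ _ graded_contract_kpart[OF Cons.prems(4)]]) (auto simp: add.commute)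
    then show ?case
      using gradedD[OF Cons.prems(4), of "brk R u x # Us" Ws] assms(2) Cons.prems
      by (simp add: lie_der_Cons kpart_ppart_brk)
  qed (simp add: p)
qed

text \<open>Bracketing with an element of \<open>ppart\<close> exchanges \<open>kpart\<close> and
  \<open>ppart\<close>, so exactly one argument changes its type.\<close>

lemma graded_lie_der_ppart:
  assumes "f \<in> graded S n" "x \<in> ppart R"
  shows "lie_der (brk R) x f \<in> graded {r. r - 1 \<in> S \<or> r + 1 \<in> S} n"
proof (rule gradedI)
  show "lie_der (brk R) x f \<in> cochains R n"
    by (intro cochains_lie_der graded_cochains[OF assms(1)])
  have p: "lie_der (brk R) x f Ws = 0"
    if "f \<in> graded S n" "set Ws \<subseteq> ppart R" "1 \<notin> S" for f S n Ws
    using that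
  proof (induction Ws arbitrary: f n)
    case (Cons w Ws)
    then show ?case
      using gradedD[OF Cons.prems(1), of "[brk R w x]" Ws] assms(2) graded_contract_ppart
      by (force simp: lie_der_Cons kpart_ppart_brk)
  qed simp
  fix Us Ws assume "set Us \<subseteq> kpart R" "set Ws \<subseteq> ppart R"
    and "int (length Us) \<notin> {r. r - 1 \<in> S \<or> r + 1 \<in> S}"
  then show "lie_der (brk R) x f (Us @ Ws) = 0"
    using assms(1)
  proof (induction Us arbitrary: f S n)
    case (Cons u Us)
    have "lie_der (brk R) x (contract u f) (Us @ Ws) = 0"
      using Cons.prems by (intro Cons.IH[OF _ _ _ graded_contract_kpart[OF Cons.prems(4)]]) (auto simp: add.commute)
    \<comment> \<open>The bracket lies in \<open>ppart\<close> but stands before the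
      \<open>kpart\<close> arguments; contracting with it avoids reordering the list.\<close>
    moreover have "contract (brk R u x) f \<in> graded S (n - 1)"
      using Cons.prems assms(2) by (intro graded_contract_ppart kpart_ppart_brk) auto
    then have "contract (brk R u x) f (Us @ Ws) = 0"
      using Cons.prems by (intro gradedD[of _ S "n - 1"]) auto
    ultimately show ?case
      by (simp add: lie_der_Cons contract_def)
  qed (simp add: p)
qed

lemma contract_bidegree_part:
  "contract x (bidegree_part R p f) =
    bidegree_part R (p - 1) (contract ((1 / 2) *\<^sub>R (x + theta R x)) f) +
    bidegree_part R p (contract ((1 / 2) *\<^sub>R (x - theta R x)) f)"
  by (simp add: contract_def fun_eq_iff)

lemma bidegree_part_cscale: "bidegree_part R p (cscale R c f) = cscale R c (bidegree_part R p f)"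
proof
  show "bidegree_part R p (cscale R c f) Ws = cscale R c (bidegree_part R p f) Ws" for Ws
  proof (induction Ws arbitrary: p f)
    case (Cons x Ws)
    then show ?case
      by (simp only: bidegree_part.simps contract_cscale) (simp only: cscale_def bidegree_part.simps V.scale_right_distrib)
  qed (simp add: cscale_def)
qed

lemma cochains_bidegree_part: "f \<in> cochains R n \<Longrightarrow> bidegree_part R p f \<in> cochains R n"
proof (induction n arbitrary: p f)
  case 0
  have "contract x (bidegree_part R p f) = 0" for x
    by (simp only: contract_bidegree_part V.alt_forms_0_contract[OF 0] bidegree_part_zero add_0_left)
  then have "bidegree_part R p f (x # Ws) = 0" for x Ws
    by (metis contract_def zero_fun_apply)
  then have "bidegree_part R p f Ws = 0" if "Ws \<noteq> []" for Ws
    using that by (cases Ws) auto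
  then show ?case by (auto simp: alt_forms_def)
next
  case (Suc n)
  let ?K = "\<lambda>x. (1 / 2) *\<^sub>R (x + theta R x)" and ?P = "\<lambda>x. (1 / 2) *\<^sub>R (x - theta R x)"
  show ?case
  proof (rule V.alt_forms_SucI)
    show "bidegree_part R p f [] = 0"
      using V.alt_formsD_length[OF Suc.prems, of "[]"] by simp
    show "contract x (bidegree_part R p f) \<in> cochains R n" for x
      unfolding contract_bidegree_part by (intro V.alt_forms_plus Suc.IH V.alt_forms_contract[OF Suc.prems])
    show "contract (a *\<^sub>R x + b *\<^sub>R y) (bidegree_part R p f) Ws =
      scl R (complex_of_real a) (contract x (bidegree_part R p f) Ws) +
      scl R (complex_of_real b) (contract y (bidegree_part R p f) Ws)" for a x b y Ws
    proof -
      have K: "?K (a *\<^sub>R x + b *\<^sub>R y) = a *\<^sub>R ?K x + b *\<^sub>R ?K y"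
        and P: "?P (a *\<^sub>R x + b *\<^sub>R y) = a *\<^sub>R ?P x + b *\<^sub>R ?P y"
        by (simp_all add: linear_add[OF linear_theta] linear_scale[OF linear_theta] algebra_simps)
      have c: "contract (a *\<^sub>R u + b *\<^sub>R v) f =
          cscale R (complex_of_real a) (contract u f) + cscale R (complex_of_real b) (contract v f)" for u v
        using V.alt_forms_contract_linear[OF Suc.prems] by (simp add: cscale_def fun_eq_iff)
      show ?thesis
        by (simp only: contract_bidegree_part K P c bidegree_part_add bidegree_part_cscale plus_fun_apply)
          (simp add: cscale_def V.scale_right_distrib)
    qed
    show "contract x (contract x (bidegree_part R p f)) = 0" for x
    proof -
      have "contract x (contract x (bidegree_part R p f)) =
          bidegree_part R (p - 1 - 1) (contract (?K x) (contract (?K x) f)) +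
          bidegree_part R (p - 1) (contract (?P x) (contract (?K x) f) + contract (?K x) (contract (?P x) f)) +
          bidegree_part R p (contract (?P x) (contract (?P x) f))"
        by (simp only: contract_bidegree_part contract_plus bidegree_part_add ac_simps)
      \<comment> \<open>The middle degree collects both orders of the two components, and
        contractions anticommute.\<close>
      also have "contract (?P x) (contract (?K x) f) + contract (?K x) (contract (?P x) f) = 0"
        using V.alt_forms_contract_swap[OF Suc.prems, of "?P x" "?K x"] by (simp only: left_minus)
      finally show ?thesis
        by (simp only: V.alt_forms_contract_contract_self[OF Suc.prems] bidegree_part_zero add_0_left)
    qed
  qed
qed

text \<open>On arguments of pure type one of the two components is 0 at every step, so the recursion
  follows a single branch that counts the elements of \<open>kpart\<close>.\<close>

lemma bidegree_part_apply:
  assumes "f \<in> cochains R n" "set Us \<subseteq> kpart R" "set Ws \<subseteq> ppart R"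
  shows "bidegree_part R p f (Us @ Ws) = (if p = int (length Us) then f (Us @ Ws) else 0)"
proof -
  have zero: "contract 0 f = 0" if "f \<in> cochains R n" for f n
    using V.alt_forms_contract_linear[OF that, of 0 0 0 0] by auto
  have k: "(1 / 2) *\<^sub>R (x + theta R x) = x" "x - theta R x = 0" if "x \<in> kpart R" for x
    using that by (auto simp: kpart_def simp flip: scaleR_2)
  have p: "(1 / 2) *\<^sub>R (x - theta R x) = x" "x + theta R x = 0" if "x \<in> ppart R" for x
    using that by (auto simp: ppart_def simp flip: scaleR_2)
  have Nil: "bidegree_part R p f Ws = (if p = 0 then f Ws else 0)"
    if "f \<in> cochains R n" "set Ws \<subseteq> ppart R" for f Ws n p
    using that
  proof (induction Ws arbitrary: f n p)
    case (Cons w Ws)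
    have "bidegree_part R p (contract w f) Ws = (if p = 0 then contract w f Ws else 0)"
      using Cons.prems by (intro Cons.IH[OF cochains_contract_pred]) auto
    then show ?case
      using Cons.prems
      by (simp only: bidegree_part.simps p list.simps insert_subset scaleR_zero_right zero bidegree_part_zero
          zero_fun_apply add_0_left) (simp add: contract_def)
  qed simp
  show ?thesis
    using assms
  proof (induction Us arbitrary: f n p)
    case (Cons u Us)
    have "bidegree_part R (p - 1) (contract u f) (Us @ Ws) =
        (if p - 1 = int (length Us) then contract u f (Us @ Ws) else 0)"
      using Cons.prems by (intro Cons.IH[OF cochains_contract_pred]) auto
    then show ?case
      using Cons.prems
      by (simp only: append_Cons bidegree_part.simps k list.simps insert_subset scaleR_zero_right zero
          bidegree_part_zero zero_fun_apply add_0_right) (auto simp: contract_def)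
  qed (simp add: Nil)
qed

lemma graded_bidegree_part: "f \<in> cochains R n \<Longrightarrow> bidegree_part R p f \<in> graded {p} n"
  by (intro gradedI cochains_bidegree_part) (auto simp: bidegree_part_apply)

lemma graded_decompose:
  assumes "f \<in> graded S n" "finite S"
  shows "f = (\<Sum>r\<in>S. bidegree_part R r f)"
proof -
  note f = graded_cochains[OF assms(1)]
  have "f - (\<Sum>r\<in>S. bidegree_part R r f) \<in> graded {} n"
  proof (rule gradedI)
    fix Us Ws assume UW: "set Us \<subseteq> kpart R" "set Ws \<subseteq> ppart R"
    then have "(\<Sum>r\<in>S. bidegree_part R r f) (Us @ Ws) = (if int (length Us) \<in> S then f (Us @ Ws) else 0)"
      using assms(2) by (simp add: sum_fun_apply bidegree_part_apply[OF f])
    then show "(f - (\<Sum>r\<in>S. bidegree_part R r f)) (Us @ Ws) = 0"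
      using gradedD[OF assms(1) UW] by simp
  qed (intro V.alt_forms_diff V.alt_forms_sum cochains_bidegree_part f)
  then show ?thesis
    using graded_empty by (metis right_minus_eq)
qed

end

section \<open>Exterior products\<close>

lemma complex_space_times: "complex_space ((*) :: complex \<Rightarrow> complex \<Rightarrow> complex)"
  by unfold_locales (simp_all add: algebra_simps)

text \<open>In an exterior product one factor reads the positions \<open>l\<close> to
  \<open>u - 1\<close> of the permuted list. Changing argument \<open>\<sigma> a\<close> changes
  position \<open>a\<close> alone, by injectivity, so at most one factor notices it.\<close>

lemma map_list_update_permutes:
  assumes "\<sigma> permutes {..<n}" "length Ws = n" "a < n" "u \<le> n"
  shows "map (\<lambda>i. Ws[\<sigma> a := x] ! \<sigma> i) [l..<u] =
    (if l \<le> a \<and> a < u then (map (\<lambda>i. Ws ! \<sigma> i) [l..<u])[a - l := x] else map (\<lambda>i. Ws ! \<sigma> i) [l..<u])"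
proof -
  have "\<sigma> i < n" if "i < n" for i
    using permutes_in_image[OF assms(1), of i] that by simp
  moreover have "\<sigma> a = \<sigma> i \<longleftrightarrow> a = i" for i
    using permutes_inj[OF assms(1)] by (auto dest: injD)
  ultimately show ?thesis
    using assms(2-4) by (auto intro!: nth_equalityI simp: nth_list_update)
qed

lemma sum_lessThan_add: "(\<Sum>i<p + q. f i) = (\<Sum>i<p. f i) + (\<Sum>i<q. f (p + i :: nat))"
  by (induction q) (simp_all add: add.assoc)

context complex_space
begin

lemma alt_forms_wedge:
  assumes \<omega>: "\<omega> \<in> alt_forms (*) p" and g: "g \<in> alt_forms sc q"
  shows "wedge sc sc p q \<omega> g \<in> alt_forms sc (p + q)"
proof -
  interpret C: complex_space "(*) :: complex \<Rightarrow> complex \<Rightarrow> complex"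
    by (rule complex_space_times)
  define E where "E Ws \<sigma> = sc (\<omega> (map (\<lambda>i. Ws ! \<sigma> i) [0..<p])) (g (map (\<lambda>i. Ws ! \<sigma> i) [p..<p + q]))"
    for Ws and \<sigma> :: "nat \<Rightarrow> nat"
  have wedge: "wedge sc sc p q \<omega> g Ws = sc (1 / (fact p * fact q))
      (\<Sum>\<sigma> | \<sigma> permutes {..<p + q}. sc (of_int (sign \<sigma>)) (E Ws \<sigma>))" if "length Ws = p + q" for Ws
    using that by (simp add: wedge_def E_def)
  have E_update: "E (Ws[\<sigma> k := a *\<^sub>R x + b *\<^sub>R y]) \<sigma> =
      sc (complex_of_real a) (E (Ws[\<sigma> k := x]) \<sigma>) + sc (complex_of_real b) (E (Ws[\<sigma> k := y]) \<sigma>)"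
    if "\<sigma> permutes {..<p + q}" "length Ws = p + q" "k < p + q" for Ws \<sigma> a b x y k
    using that C.alt_formsD_linear[OF \<omega>, of k] alt_formsD_linear[OF g, of "k - p"]
    by (auto simp: E_def map_list_update_permutes scale_left_distrib scale_right_distrib mult.commute)
  have linear: "wedge sc sc p q \<omega> g (Ws[i := a *\<^sub>R x + b *\<^sub>R y]) =
      sc (complex_of_real a) (wedge sc sc p q \<omega> g (Ws[i := x])) +
      sc (complex_of_real b) (wedge sc sc p q \<omega> g (Ws[i := y]))"
    if "length Ws = p + q" "i < p + q" for Ws i a b x y
  proof -
    have "E (Ws[i := a *\<^sub>R x + b *\<^sub>R y]) \<sigma> =
        sc (complex_of_real a) (E (Ws[i := x]) \<sigma>) + sc (complex_of_real b) (E (Ws[i := y]) \<sigma>)"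
      if "\<sigma> permutes {..<p + q}" for \<sigma>
    proof -
      \<comment> \<open>The permuted list reads argument \<open>i\<close> at position
        \<open>inv \<sigma> i\<close>.\<close>
      have "inv \<sigma> i < p + q"
        using permutes_in_image[OF permutes_inv[OF that], of i] \<open>i < p + q\<close> by simp
      then show ?thesis
        using E_update[OF that \<open>length Ws = p + q\<close>, of "inv \<sigma> i"] permutes_inverses(1)[OF that] by simp
    qed
    then show ?thesis
      using that(1) by (simp add: wedge scale_right_distrib sum.distrib scale_sum_right mult.commute
          mult.left_commute)
  qed
  have alternating: "wedge sc sc p q \<omega> g Ws = 0" if "length Ws = p + q" "\<not> distinct Ws" for Ws
  proof -
    obtain a b where ab: "a < p + q" "b < p + q" "a \<noteq> b" "Ws ! a = Ws ! b"
      using \<open>\<not> distinct Ws\<close> \<open>length Ws = p + q\<close> unfolding distinct_conv_nth by auto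
    let ?t = "transpose a b" and ?S = "\<Sum>\<sigma> | \<sigma> permutes {..<p + q}. sc (of_int (sign \<sigma>)) (E Ws \<sigma>)"
    have t: "?t permutes {..<p + q}"
      using ab by (intro permutes_swap_id) simp_all
    have "Ws ! ?t i = Ws ! i" for i
      using ab(4) by (simp add: transpose_def)
    then have E: "E Ws (?t \<circ> \<sigma>) = E Ws \<sigma>" for \<sigma>
      by (simp add: E_def)
    have "sign (?t \<circ> \<sigma>) = - sign \<sigma>" if "\<sigma> permutes {..<p + q}" for \<sigma>
      using sign_compose[of ?t \<sigma>] permutation_permutes that t ab(3)
      by (metis finite_lessThan mult_minus1 sign_swap_id)
    \<comment> \<open>Composing with the transposition of the two equal arguments permutes the
      summands and flips every sign.\<close>
    then have "?S = (\<Sum>\<sigma> | \<sigma> permutes {..<p + q}. - sc (of_int (sign \<sigma>)) (E Ws \<sigma>))"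
      by (subst setum_permutations_compose_left[OF t]) (simp add: E)
    then have "?S = - ?S"
      by (simp only: sum_negf)
    then have "?S + ?S = 0"
      by (simp only: eq_neg_iff_add_eq_0)
    then have "sc 2 ?S = 0"
      using scale_left_distrib[of 1 1 ?S] by simp
    then have "?S = 0"
      by (simp only: scale_eq_0_iff) simp
    then show ?thesis
      using that(1) by (simp add: wedge)
  qed
  show ?thesis
    unfolding alt_forms_def using linear alternating by (auto simp: wedge_def)
qed

end

context hermitian_lie_module
begin

text \<open>Moves the vector into the second factor, so that the product falls under
  \<open>alt_forms_wedge\<close>.\<close>

lemma tensor_wedge: "tensor R v (wedge (*) (*) p q \<omega>1 \<omega>2) = wedge (scl R) (scl R) p q \<omega>1 (tensor R v \<omega>2)"
proof
  show "tensor R v (wedge (*) (*) p q \<omega>1 \<omega>2) Ws = wedge (scl R) (scl R) p q \<omega>1 (tensor R v \<omega>2) Ws" for Ws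
    by (simp add: tensor_def wedge_def V.scale_sum_left V.scale_sum_right mult.assoc sum_divide_distrib)
qed

lemma cochains_tensor: "\<omega> \<in> alt_forms (*) q \<Longrightarrow> tensor R v \<omega> \<in> cochains R q"
  by (auto simp: alt_forms_def tensor_def V.scale_left_distrib)

text \<open>\<open>box_circ_apply\<close> alters one argument at a time, and in the summand of a
  given permutation that argument enters exactly one factor. The other factor contributes a scalar,
  which commutes with \<tau>.\<close>

lemma box_circ_wedge:
  assumes \<omega>1: "\<omega>1 \<in> alt_forms (*) p" and \<omega>2: "\<omega>2 \<in> alt_forms (*) q"
  shows "box_circ R (p + q) (tensor R v (wedge (*) (*) p q \<omega>1 \<omega>2)) =
    wedge (scl R) (\<lambda>u c. scl R c u) p q (box_circ R p (tensor R v \<omega>1)) \<omega>2 +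
    wedge (scl R) (scl R) p q \<omega>1 (box_circ R q (tensor R v \<omega>2))"
proof
  fix Ws :: "'g list"
  let ?P = "{\<sigma>. \<sigma> permutes {..<p + q}}"
  define A where "A Vs \<sigma> = map (\<lambda>i. Vs ! \<sigma> i) [0..<p]" for Vs :: "'g list" and \<sigma> :: "nat \<Rightarrow> nat"
  define B where "B Vs \<sigma> = map (\<lambda>i. Vs ! \<sigma> i) [p..<p + q]" for Vs :: "'g list" and \<sigma> :: "nat \<Rightarrow> nat"
  define E where "E As Bs = scl R (\<omega>1 As) (scl R (\<omega>2 Bs) v)" for As Bs
  let ?c = "1 / (fact p * fact q)"
  have "tensor R v (wedge (*) (*) p q \<omega>1 \<omega>2) \<in> cochains R (p + q)"
    unfolding tensor_wedge by (intro V.alt_forms_wedge \<omega>1 cochains_tensor \<omega>2)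
  note box = box_circ_apply[OF this] box_circ_apply[OF cochains_tensor[OF \<omega>1]]
    box_circ_apply[OF cochains_tensor[OF \<omega>2]]
  show "box_circ R (p + q) (tensor R v (wedge (*) (*) p q \<omega>1 \<omega>2)) Ws =
    (wedge (scl R) (\<lambda>u c. scl R c u) p q (box_circ R p (tensor R v \<omega>1)) \<omega>2 +
    wedge (scl R) (scl R) p q \<omega>1 (box_circ R q (tensor R v \<omega>2))) Ws"
  proof (cases "length Ws = p + q")
    case False
    then show ?thesis
      unfolding box by (simp add: tensor_def wedge_def)
  next
    case True
    define h where "h \<sigma> i = (\<Sum>j\<in>idx R. tau R (brk R (Ws ! i) (bas R j))
        (E (A (Ws[i := bas R j]) \<sigma>) (B (Ws[i := bas R j]) \<sigma>)))" for \<sigma> i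
    have tw: "tensor R v (wedge (*) (*) p q \<omega>1 \<omega>2) (Ws[i := x]) =
        scl R ?c (\<Sum>\<sigma>\<in>?P. scl R (of_int (sign \<sigma>)) (E (A (Ws[i := x]) \<sigma>) (B (Ws[i := x]) \<sigma>)))" for i x
      unfolding tensor_wedge using True by (simp add: wedge_def A_def B_def E_def tensor_def)
    have lhs: "box_circ R (p + q) (tensor R v (wedge (*) (*) p q \<omega>1 \<omega>2)) Ws =
        scl R ?c (\<Sum>\<sigma>\<in>?P. scl R (of_int (sign \<sigma>)) (- (\<Sum>i<p + q. h \<sigma> i)))"
    proof -
      have "box_circ R (p + q) (tensor R v (wedge (*) (*) p q \<omega>1 \<omega>2)) Ws =
          - (\<Sum>i<p + q. \<Sum>j\<in>idx R. \<Sum>\<sigma>\<in>?P. scl R ?c (scl R (of_int (sign \<sigma>))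
            (tau R (brk R (Ws ! i) (bas R j)) (E (A (Ws[i := bas R j]) \<sigma>) (B (Ws[i := bas R j]) \<sigma>)))))"
        unfolding box tw True by (simp only: tau_scale tau_sum V.scale_sum_right)
      also have "\<dots> = - (\<Sum>\<sigma>\<in>?P. \<Sum>i<p + q. \<Sum>j\<in>idx R. scl R ?c (scl R (of_int (sign \<sigma>))
            (tau R (brk R (Ws ! i) (bas R j)) (E (A (Ws[i := bas R j]) \<sigma>) (B (Ws[i := bas R j]) \<sigma>)))))"
        by (simp only: sum.swap[of _ ?P])
      finally show ?thesis
        by (simp only: h_def V.scale_sum_right V.scale_minus_right sum_negf)
    qed
    have split: "- (\<Sum>i<p + q. h \<sigma> i) =
        scl R (\<omega>2 (B Ws \<sigma>)) (box_circ R p (tensor R v \<omega>1) (A Ws \<sigma>)) +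
        scl R (\<omega>1 (A Ws \<sigma>)) (box_circ R q (tensor R v \<omega>2) (B Ws \<sigma>))"
      if "\<sigma> \<in> ?P" for \<sigma>
    proof -
      have \<sigma>: "\<sigma> permutes {..<p + q}" using that by simp
      \<comment> \<open>Summing over positions instead of arguments separates the factors: the first
        \<open>p\<close> positions belong to \<open>\<omega>1\<close>, the last \<open>q\<close> to
        \<open>\<omega>2\<close>.\<close>
      have "(\<Sum>i<p + q. h \<sigma> i) = (\<Sum>i<p + q. h \<sigma> (\<sigma> i))"
        using sum.permute[OF \<sigma>, of "h \<sigma>"] by (simp add: comp_def)
      also have "\<dots> = (\<Sum>i<p. h \<sigma> (\<sigma> i)) + (\<Sum>i<q. h \<sigma> (\<sigma> (p + i)))"
        by (rule sum_lessThan_add)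
      also have "(\<Sum>i<p. h \<sigma> (\<sigma> i)) = - scl R (\<omega>2 (B Ws \<sigma>)) (box_circ R p (tensor R v \<omega>1) (A Ws \<sigma>))"
      proof -
        have "h \<sigma> (\<sigma> i) = (\<Sum>j\<in>idx R. scl R (\<omega>2 (B Ws \<sigma>)) (tau R (brk R (A Ws \<sigma> ! i) (bas R j))
            (tensor R v \<omega>1 ((A Ws \<sigma>)[i := bas R j]))))" if "i < p" for i
          using that by (simp add: h_def A_def B_def E_def tensor_def tau_scale
              map_list_update_permutes[OF \<sigma> True] mult.commute)
        moreover have "length (A Ws \<sigma>) = p" by (simp add: A_def)
        ultimately show ?thesis
          unfolding box by (simp add: V.scale_sum_right)
      qed
      also have "(\<Sum>i<q. h \<sigma> (\<sigma> (p + i))) = - scl R (\<omega>1 (A Ws \<sigma>)) (box_circ R q (tensor R v \<omega>2) (B Ws \<sigma>))"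
      proof -
        have "h \<sigma> (\<sigma> (p + i)) = (\<Sum>j\<in>idx R. scl R (\<omega>1 (A Ws \<sigma>)) (tau R (brk R (B Ws \<sigma> ! i) (bas R j))
            (tensor R v \<omega>2 ((B Ws \<sigma>)[i := bas R j]))))" if "i < q" for i
          using that by (simp add: h_def A_def B_def E_def tensor_def tau_scale
              map_list_update_permutes[OF \<sigma> True])
        moreover have "length (B Ws \<sigma>) = q" by (simp add: B_def)
        ultimately show ?thesis
          unfolding box by (simp add: V.scale_sum_right)
      qed
      finally show ?thesis by simp
    qed
    have "box_circ R (p + q) (tensor R v (wedge (*) (*) p q \<omega>1 \<omega>2)) Ws =
        scl R ?c (\<Sum>\<sigma>\<in>?P. scl R (of_int (sign \<sigma>)) (
          scl R (\<omega>2 (B Ws \<sigma>)) (box_circ R p (tensor R v \<omega>1) (A Ws \<sigma>)) +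
          scl R (\<omega>1 (A Ws \<sigma>)) (box_circ R q (tensor R v \<omega>2) (B Ws \<sigma>))))"
      unfolding lhs using split by simp
    also have "\<dots> = scl R ?c (\<Sum>\<sigma>\<in>?P. scl R (of_int (sign \<sigma>))
          (scl R (\<omega>2 (B Ws \<sigma>)) (box_circ R p (tensor R v \<omega>1) (A Ws \<sigma>)))) +
        scl R ?c (\<Sum>\<sigma>\<in>?P. scl R (of_int (sign \<sigma>))
          (scl R (\<omega>1 (A Ws \<sigma>)) (box_circ R q (tensor R v \<omega>2) (B Ws \<sigma>))))"
      by (simp only: V.scale_right_distrib sum.distrib)
    also have "\<dots> = (wedge (scl R) (\<lambda>u c. scl R c u) p q (box_circ R p (tensor R v \<omega>1)) \<omega>2 +
        wedge (scl R) (scl R) p q \<omega>1 (box_circ R q (tensor R v \<omega>2))) Ws"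
      using True by (simp only: wedge_def A_def B_def plus_fun_apply refl not_True_eq_False if_False)
    finally show ?thesis .
  qed
qed

section \<open>The bigrading and the operators on one-cochains\<close>

lemma graded_update_ppart:
  assumes f: "f \<in> graded {int n} n" and "y \<in> ppart R" "i < length Ws"
  shows "f (Ws[i := y]) = 0"
proof -
  have "contract y f = 0"
  \<comment> \<open>Contraction leaves n - 1 arguments while n of them would have to lie in
    \<open>kpart\<close>. For n = 0 the subtraction truncates, so this case is separate.\<close>
  proof (cases n)
    case 0
    then show ?thesis
      using V.alt_forms_0_contract[of f y] graded_cochains[OF f] by simp
  next
    case (Suc m)
    show ?thesis
      by (rule graded_empty, rule graded_restrict, rule graded_contract_ppart[OF f \<open>y \<in> ppart R\<close>])
        (simp add: Suc)
  qed
  then show ?thesis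
    using V.alt_forms_move_sign[OF graded_cochains[OF f] assms(3), of y] by (metis contract_def V.scale_zero_right zero_fun_apply)
qed

lemma graded_update_kpart:
  assumes f: "f \<in> graded {0} n" and "y \<in> kpart R" "i < length Ws"
  shows "f (Ws[i := y]) = 0"
proof -
  have "contract y f = 0"
    by (rule graded_empty, rule graded_restrict, rule graded_contract_kpart[OF f \<open>y \<in> kpart R\<close>]) auto
  then show ?thesis
    using V.alt_forms_move_sign[OF graded_cochains[OF f] assms(3), of y] by (metis contract_def V.scale_zero_right zero_fun_apply)
qed

lemma box_circ_kpart:
  assumes f: "f \<in> graded {int n} n"
  shows "box_circ R n f = (\<Sum>j\<in>idx R. tau_ext R (bas R j) (coad_star_ext R (bas R j) f))"
proof
  fix Ws
  have "tau R (brk R (Ws ! i) (bas R j)) (f (Ws[i := bas R j])) =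
      tau R (brk R (Ws ! i) (theta R (bas R j))) (f (Ws[i := bas R j]))"
    if "i < length Ws" "j \<in> idx R" for i j
    using that graded_update_ppart[OF f bas_ppart, of j i Ws] by (auto simp: theta_bas_k)
  then show "box_circ R n f Ws = (\<Sum>j\<in>idx R. tau_ext R (bas R j) (coad_star_ext R (bas R j) f)) Ws"
    unfolding tau_coad_star_apply[OF graded_cochains[OF f]] box_circ_apply[OF graded_cochains[OF f]]
    by (simp del: Un_iff)
qed

lemma box_circ_ppart:
  assumes f: "f \<in> graded {0} n"
  shows "box_circ R n f = - (\<Sum>j\<in>idx R. tau_ext R (bas R j) (coad_star_ext R (bas R j) f))"
proof
  fix Ws
  have "brk R x (- y) = - brk R x y" for x y
    using lie_algebraD(2)[OF lie, of x "- 1" y 0 0] by simp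
  then have "tau R (brk R (Ws ! i) (bas R j)) (f (Ws[i := bas R j])) =
      - tau R (brk R (Ws ! i) (theta R (bas R j))) (f (Ws[i := bas R j]))"
    if "i < length Ws" "j \<in> idx R" for i j
    using that graded_update_kpart[OF f bas_kpart, of j i Ws] by (auto simp: theta_bas_p tau_uminus_left)
  then show "box_circ R n f Ws = (- (\<Sum>j\<in>idx R. tau_ext R (bas R j) (coad_star_ext R (bas R j) f))) Ws"
    unfolding fun_Compl_def tau_coad_star_apply[OF graded_cochains[OF f]] box_circ_apply[OF graded_cochains[OF f]]
    by (simp del: Un_iff add: sum_negf)
qed

section \<open>The operators in the matrices and their bidegrees\<close>

lemma sum_idx:
  fixes g :: "'i \<Rightarrow> 'b::comm_monoid_add"
  shows "(\<Sum>j\<in>idx R. g j) = (\<Sum>j\<in>idx_k R. g j) + (\<Sum>j\<in>idx_p R. g j)"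
  using adapted_basis by (intro sum.union_disjoint) (auto simp: adapted_basis_def)

lemma tau_coad_star_eq: "(\<Sum>j\<in>idx R. tau_ext R (bas R j) (coad_star_ext R (bas R j) f)) = B_k R f + C_p R f"
  unfolding B_k_def C_p_def by (rule sum_idx)

lemma B_k_eq:
  "f \<in> cochains R n \<Longrightarrow> B_k R f = (\<Sum>k\<in>idx_k R. tau_ext R (bas R k) (lie_der (brk R) (bas R k) f))"
  unfolding B_k_def by (intro sum.cong refl) (simp only: coad_star_ext_eq theta_bas_k)

lemma C_p_eq:
  assumes "f \<in> cochains R n"
  shows "C_p R f = - (\<Sum>\<alpha>\<in>idx_p R. tau_ext R (bas R \<alpha>) (lie_der (brk R) (bas R \<alpha>) f))"
  unfolding C_p_def sum_negf[symmetric]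
  by (intro sum.cong refl)
    (simp only: coad_star_ext_eq[OF assms] theta_bas_p V.lie_der_uminus_left[OF lie assms] tau_ext_uminus)

lemma tau_coad_eq:
  assumes "f \<in> cochains R n"
  shows "(\<Sum>j\<in>idx R. tau_ext R (bas R j) (lie_der (brk R) (bas R j) f)) = B_k R f - C_p R f"
  unfolding B_k_eq[OF assms] C_p_eq[OF assms] sum_idx by (simp only: diff_minus_eq_add)

lemma A_g_graded: "f \<in> graded S n \<Longrightarrow> A_g R f \<in> graded S n"
  unfolding A_g_def tau_Omega_bar_def quad_action_def by (intro graded_uminus graded_sum graded_tau_ext)

lemma B_k_graded:
  assumes "f \<in> graded S n"
  shows "B_k R f \<in> graded S n"
  unfolding B_k_eq[OF graded_cochains[OF assms]]
  by (intro graded_sum graded_tau_ext graded_lie_der_kpart[OF assms] bas_kpart)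

lemma C_p_graded:
  assumes "f \<in> graded S n"
  shows "C_p R f \<in> graded {r. r - 1 \<in> S \<or> r + 1 \<in> S} n"
  unfolding C_p_eq[OF graded_cochains[OF assms]]
  by (intro graded_uminus graded_sum graded_tau_ext graded_lie_der_ppart[OF assms] bas_ppart)

text \<open>A basis vector in \<open>ppart\<close> acts twice, each time shifting by 1 or -1, which
  gives total shifts -2, 0 and 2.\<close>

lemma D_g_graded:
  assumes dual: "dual_bases R J Z Z'" and f: "f \<in> graded S n"
  shows "D_g R J Z Z' f \<in> graded {r. r - 2 \<in> S \<or> r \<in> S \<or> r + 2 \<in> S} n"
proof -
  let ?L = "lie_der (brk R)" and ?T = "{r. r - 2 \<in> S \<or> r \<in> S \<or> r + 2 \<in> S}"
  have "?L (theta R (bas R j)) (?L (bas R j) f) \<in> graded ?T n" if "j \<in> idx R" for j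
  proof (cases "j \<in> idx_k R")
    case True
    have "?L (bas R j) (?L (bas R j) f) \<in> graded S n"
      by (intro graded_lie_der_kpart f bas_kpart True)
    then show ?thesis
      unfolding theta_bas_k[OF True] by (rule graded_mono) auto
  next
    case False
    then have j: "bas R j \<in> ppart R" "theta R (bas R j) \<in> ppart R"
      using that bas_ppart[of j] by (auto simp: ppart_def linear_neg[OF linear_theta])
    show ?thesis
      by (rule graded_mono[OF graded_lie_der_ppart[OF graded_lie_der_ppart[OF f j(1)] j(2)]])
        (auto simp: add.commute)
  qed
  then show ?thesis
    unfolding D_g_eq[OF dual graded_cochains[OF f]] by (intro graded_cscale graded_sum)
qed

lemma A_g_add: "A_g R (f + g) = A_g R f + A_g R g"
  unfolding A_g_def tau_Omega_bar_def quad_action_def tau_ext_add sum.distrib minus_add_distrib ..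

lemma B_k_add:
  assumes "f \<in> cochains R n" "g \<in> cochains R n"
  shows "B_k R (f + g) = B_k R f + B_k R g"
  unfolding B_k_eq[OF assms(1)] B_k_eq[OF assms(2)] B_k_eq[OF V.alt_forms_plus[OF assms]]
    lie_der_plus tau_ext_add sum.distrib ..

lemma C_p_add:
  assumes "f \<in> cochains R n" "g \<in> cochains R n"
  shows "C_p R (f + g) = C_p R f + C_p R g"
  unfolding C_p_eq[OF assms(1)] C_p_eq[OF assms(2)] C_p_eq[OF V.alt_forms_plus[OF assms]]
    lie_der_plus tau_ext_add sum.distrib minus_add_distrib ..

lemma D_g_add:
  assumes dual: "dual_bases R J Z Z'" and "f \<in> cochains R n" "g \<in> cochains R n"
  shows "D_g R J Z Z' (f + g) = D_g R J Z Z' f + D_g R J Z Z' g"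
proof -
  have "cscale R c (g + h) = cscale R c g + cscale R c h" for c g h
    by (auto simp: cscale_def V.scale_right_distrib)
  then show ?thesis
    unfolding D_g_eq[OF dual assms(2)] D_g_eq[OF dual assms(3)] D_g_eq[OF dual V.alt_forms_plus[OF assms(2,3)]]
      lie_der_plus sum.distrib .
qed

lemma box_circ_add:
  assumes "f \<in> cochains R n" "g \<in> cochains R n"
  shows "box_circ R n (f + g) = box_circ R n f + box_circ R n g"
  unfolding box_circ_eq[OF assms(1)] box_circ_eq[OF assms(2)] box_circ_eq[OF V.alt_forms_plus[OF assms]]
    contract_plus tau_ext_add V.antisymm_plus sum.distrib minus_add_distrib ..

lemma lap_circ_eq: "lap_circ R n f = A_g R f + box_circ R n f"
  by (simp add: box_circ_def A_g_def fun_eq_iff)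

lemma bigrading:
  assumes f: "f \<in> cochains R n"
  shows "\<exists>!g :: nat \<Rightarrow> 'g list \<Rightarrow> 'v.
    (\<forall>p\<le>n. g p \<in> bicochains R (int p) (int (n - p))) \<and> (\<forall>p>n. g p = 0) \<and> f = (\<Sum>p\<le>n. g p)"
proof -
  have bi: "bicochains R (int p) (int (n - p)) = graded {int p} n" if "p \<le> n" for p
    using that bicochains_eq_graded[of "int p" "int (n - p)"] by (simp add: of_nat_diff)
  have eval: "(\<Sum>p\<le>n. g p) (Us @ Ws) = (if length Us \<le> n then g (length Us) (Us @ Ws) else 0)"
    if "\<And>p. p \<le> n \<Longrightarrow> g p \<in> graded {int p} n" "set Us \<subseteq> kpart R" "set Ws \<subseteq> ppart R"
    for g :: "nat \<Rightarrow> 'g list \<Rightarrow> 'v" and Us Ws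
  proof -
    have "(\<Sum>p\<le>n. g p) (Us @ Ws) = (\<Sum>p\<le>n. if p = length Us then g p (Us @ Ws) else 0)"
      unfolding sum_fun_apply using gradedD[OF that] by (intro sum.cong) auto
    then show ?thesis by simp
  qed
  \<comment> \<open>The value 0 beyond \<open>n\<close> is the convention that makes the family
    unique as a function on all naturals.\<close>
  define g where "g p = (if p \<le> n then bidegree_part R (int p) f else 0)" for p
  have g: "g p \<in> graded {int p} n" if "p \<le> n" for p
    using graded_bidegree_part[OF f] that by (simp add: g_def)
  have uniq: "h p = bidegree_part R (int p) f"
    if h: "\<And>p. p \<le> n \<Longrightarrow> h p \<in> graded {int p} n" "f = (\<Sum>p\<le>n. h p)" and "p \<le> n" for h p
  proof -
    have "h p - bidegree_part R (int p) f \<in> graded {} n"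
    proof (rule gradedI)
      fix Us Ws assume UW: "set Us \<subseteq> kpart R" "set Ws \<subseteq> ppart R"
      show "(h p - bidegree_part R (int p) f) (Us @ Ws) = 0"
        using bidegree_part_apply[OF f UW, of "int p"] gradedD[OF h(1)[OF \<open>p \<le> n\<close>] UW]
          eval[OF h(1) UW] \<open>p \<le> n\<close> fun_cong[OF h(2), of "Us @ Ws"]
        by (cases "length Us = p") auto
    qed (intro V.alt_forms_diff cochains_bidegree_part f graded_cochains[OF h(1)] \<open>p \<le> n\<close>)
    then show ?thesis
      using graded_empty by (metis right_minus_eq)
  qed
  have "f - (\<Sum>p\<le>n. g p) \<in> graded {} n"
  proof (rule gradedI)
    fix Us Ws assume UW: "set Us \<subseteq> kpart R" "set Ws \<subseteq> ppart R"
    show "(f - (\<Sum>p\<le>n. g p)) (Us @ Ws) = 0"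
      using eval[OF g UW] bidegree_part_apply[OF f UW, of "int (length Us)"]
        V.alt_formsD_length[OF f, of "Us @ Ws"]
      by (cases "length Us \<le> n") (simp_all add: g_def)
  qed (intro V.alt_forms_diff V.alt_forms_sum f graded_cochains[OF g], simp)
  then have f_eq: "f = (\<Sum>p\<le>n. g p)"
    using graded_empty by (metis right_minus_eq)
  show ?thesis
  proof (rule ex1I[of _ g], intro conjI allI impI)
    show "g p \<in> bicochains R (int p) (int (n - p))" if "p \<le> n" for p
      using g[OF that] by (simp only: bi[OF that])
    show "g p = 0" if "n < p" for p
      using that by (simp only: g_def not_le[symmetric] if_False)
    show "f = (\<Sum>p\<le>n. g p)" by (rule f_eq)
  next
    fix h :: "nat \<Rightarrow> 'g list \<Rightarrow> 'v"
    assume h: "(\<forall>p\<le>n. h p \<in> bicochains R (int p) (int (n - p))) \<and> (\<forall>p>n. h p = 0) \<and> f = (\<Sum>p\<le>n. h p)"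
    have h_graded: "h p \<in> graded {int p} n" if "p \<le> n" for p
      using h that bi by blast
    show "h = g"
    proof
      show "h p = g p" for p
      proof (cases "p \<le> n")
        case True
        then show ?thesis
          using uniq[OF h_graded _ True] h by (simp only: g_def if_True)
      next
        case False
        then have "h p = 0" using h not_le by blast
        then show ?thesis
          by (simp only: g_def False if_False)
      qed
    qed
  qed
qed

lemma bicochains_1: "bicochains R 1 0 = graded {1} 1" "bicochains R 0 1 = graded {0} 1"
  using bicochains_eq_graded[of 1 0] bicochains_eq_graded[of 0 1] by simp_all

lemma C_p_swap: "f \<in> graded {1} 1 \<Longrightarrow> C_p R f \<in> graded {0} 1" "g \<in> graded {0} 1 \<Longrightarrow> C_p R g \<in> graded {1} 1"
  by (auto intro: graded_restrict[OF C_p_graded])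

text \<open>In degree at most one a shift by 2 leaves the range of possible degrees, so the bidegree
  is preserved.\<close>

lemma D_g_graded_1:
  assumes "dual_bases R J Z Z'" "f \<in> graded {r} n" "0 \<le> r" "r \<le> int n" "n \<le> 1"
  shows "D_g R J Z Z' f \<in> graded {r} n"
  by (rule graded_restrict[OF D_g_graded[OF assms(1,2)]]) (use assms(3-5) in auto)

lemma lap_1:
  assumes dual: "dual_bases R J Z Z'" and f: "f \<in> graded {1} 1" and g: "g \<in> graded {0} 1"
  shows "lap_circ R 1 (f + g) = A_g R f + A_g R g + (B_k R f + C_p R f + - (B_k R g + C_p R g))"
    and "lap_wedge R 1 (f + g) = D_g R J Z Z' f + D_g R J Z Z' g"
    and "lap_circ_wedge R 1 (f + g) = - (B_k R f + B_k R g + (C_p R f + C_p R g))"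
    and "lap_wedge_circ R 1 (f + g) = - (B_k R f + B_k R g - (C_p R f + C_p R g))"
    and "laplacian R 1 (f + g) = lap_circ R 1 (f + g) + lap_wedge R 1 (f + g) +
      lap_circ_wedge R 1 (f + g) + lap_wedge_circ R 1 (f + g)"
proof -
  have fg: "f \<in> cochains R 1" "g \<in> cochains R 1"
    using f g graded_cochains by auto
  note sum = V.alt_forms_plus[OF fg]
  have f1: "f \<in> graded {int 1} 1" using f by simp
  show "lap_circ R 1 (f + g) = A_g R f + A_g R g + (B_k R f + C_p R f + - (B_k R g + C_p R g))"
    unfolding lap_circ_eq A_g_add box_circ_add[OF fg] box_circ_kpart[OF f1] box_circ_ppart[OF g]
      tau_coad_star_eq ..
  show "lap_wedge R 1 (f + g) = D_g R J Z Z' f + D_g R J Z Z' g"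
    unfolding lap_wedge_eq[OF sum] D_g_eq[OF dual sum, symmetric] by (rule D_g_add[OF dual fg])
  show "lap_circ_wedge R 1 (f + g) = - (B_k R f + B_k R g + (C_p R f + C_p R g))"
    unfolding lap_circ_wedge_1[OF sum] tau_coad_star_eq B_k_add[OF fg] C_p_add[OF fg] ..
  show "lap_wedge_circ R 1 (f + g) = - (B_k R f + B_k R g - (C_p R f + C_p R g))"
    unfolding lap_wedge_circ_1[OF sum] tau_coad_eq[OF sum] B_k_add[OF fg] C_p_add[OF fg] ..
  show "laplacian R 1 (f + g) = lap_circ R 1 (f + g) + lap_wedge R 1 (f + g) +
      lap_circ_wedge R 1 (f + g) + lap_wedge_circ R 1 (f + g)"
    by (rule laplacian_eq[OF sum])
qed

text \<open>The last premise is pointwise so that terms are rearranged in the module itself and not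
  in a function space.\<close>

lemma acts_by_matrixI:
  assumes "\<And>f. f \<in> graded {1} 1 \<Longrightarrow> a f \<in> graded {1} 1" "\<And>g. g \<in> graded {0} 1 \<Longrightarrow> b g \<in> graded {1} 1"
    and "\<And>f. f \<in> graded {1} 1 \<Longrightarrow> c f \<in> graded {0} 1" "\<And>g. g \<in> graded {0} 1 \<Longrightarrow> d g \<in> graded {0} 1"
    and "\<And>f g Ws. f \<in> graded {1} 1 \<Longrightarrow> g \<in> graded {0} 1 \<Longrightarrow>
      T (f + g) Ws = ((a f + b g) + (c f + d g)) Ws"
  shows "acts_by_matrix R T a b c d"
  unfolding acts_by_matrix_def bicochains_1 using assms by (intro ballI conjI ext)

text \<open>The terms in \<open>lap_1\<close> are sorted by bidegree, \<open>C_p\<close> being the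
  only operator that exchanges the two summands. In the total the mixed Laplacians add
  \<open>- 2 B_k\<close> on the diagonal, turning \<open>B_k\<close> into \<open>- B_k\<close> and
  \<open>- B_k\<close> into \<open>- 3 B_k\<close>.\<close>

lemma one_cochain_matrices:
  assumes dual: "dual_bases R J Z Z'"
  shows "acts_by_matrix R (lap_circ R 1) (A_g R + B_k R) (- C_p R) (C_p R) (A_g R - B_k R)"
    and "acts_by_matrix R (lap_wedge R 1) (D_g R J Z Z') 0 0 (D_g R J Z Z')"
    and "acts_by_matrix R (lap_circ_wedge R 1) (- B_k R) (- C_p R) (- C_p R) (- B_k R)"
    and "acts_by_matrix R (lap_wedge_circ R 1) (- B_k R) (C_p R) (C_p R) (- B_k R)"
    and "acts_by_matrix R (laplacian R 1) (A_g R - B_k R + D_g R J Z Z') (- C_p R)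
      (C_p R) (A_g R - (cscale R 3 \<circ> B_k R) + D_g R J Z Z')"
proof -
  have D: "f \<in> graded {0} 1 \<Longrightarrow> D_g R J Z Z' f \<in> graded {0} 1"
    "f \<in> graded {1} 1 \<Longrightarrow> D_g R J Z Z' f \<in> graded {1} 1" for f
    by (auto intro: D_g_graded_1[OF dual])
  have three: "cscale R 3 u = u + u + u" for u
    using V.scale_left_distrib[of 2 1] V.scale_left_distrib[of 1 1] by (simp add: cscale_def fun_eq_iff)
  have op_apply: "(F + G) f = F f + G f" "(F - G) f = F f - G f" "(- F) f = - F f" "0 f = 0"
    "(cscale R 3 \<circ> F) f = F f + F f + F f"
    for F G :: "('g list \<Rightarrow> 'v) \<Rightarrow> 'g list \<Rightarrow> 'v" and f
    by (simp_all add: three del: plus_fun_apply) (simp add: plus_fun_def)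
  note closed = graded_add graded_diff graded_uminus graded_zero A_g_graded B_k_graded C_p_swap D
  show "acts_by_matrix R (lap_circ R 1) (A_g R + B_k R) (- C_p R) (C_p R) (A_g R - B_k R)"
    by (rule acts_by_matrixI; (simp only: op_apply lap_1[OF dual])?)
      (blast intro: closed | simp add: algebra_simps)+
  show "acts_by_matrix R (lap_wedge R 1) (D_g R J Z Z') 0 0 (D_g R J Z Z')"
    by (rule acts_by_matrixI; (simp only: op_apply lap_1[OF dual])?)
      (blast intro: closed | simp add: algebra_simps)+
  show "acts_by_matrix R (lap_circ_wedge R 1) (- B_k R) (- C_p R) (- C_p R) (- B_k R)"
    by (rule acts_by_matrixI; (simp only: op_apply lap_1[OF dual])?)
      (blast intro: closed | simp add: algebra_simps)+
  show "acts_by_matrix R (lap_wedge_circ R 1) (- B_k R) (C_p R) (C_p R) (- B_k R)"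
    by (rule acts_by_matrixI; (simp only: op_apply lap_1[OF dual])?)
      (blast intro: closed | simp add: algebra_simps)+
  show "acts_by_matrix R (laplacian R 1) (A_g R - B_k R + D_g R J Z Z') (- C_p R)
      (C_p R) (A_g R - (cscale R 3 \<circ> B_k R) + D_g R J Z Z')"
    by (rule acts_by_matrixI; (simp only: op_apply lap_1[OF dual])?)
      (blast intro: closed | simp add: algebra_simps)+
qed

lemma bidegrees:
  fixes p q :: nat
  assumes dual: "dual_bases R J Z Z'" and f: "f \<in> bicochains R (int p) (int q)"
  shows "A_g R f \<in> bicochains R (int p) (int q)"
    and "B_k R f \<in> bicochains R (int p) (int q)"
    and "C_p R f \<in> bicochains R (int p - 1) (int q + 1) + bicochains R (int p + 1) (int q - 1)"
    and "p + q \<le> 1 \<Longrightarrow> D_g R J Z Z' f \<in> bicochains R (int p) (int q)"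
    and "D_g R J Z Z' f \<in> bicochains R (int p - 2) (int q + 2) + bicochains R (int p) (int q) +
          bicochains R (int p + 2) (int q - 2)"
proof -
  \<comment> \<open>Negative \<open>r\<close> or \<open>s\<close> occur at the edges of the
    bigrading; only the total degree has to stay fixed.\<close>
  have bi: "bicochains R r s = graded {r} (p + q)" if "r + s = int p + int q" for r s
    using bicochains_eq_graded[of r s] that by (simp add: nat_add_distrib)
  note f = f[unfolded bi[OF refl]]
  show "A_g R f \<in> bicochains R (int p) (int q)" "B_k R f \<in> bicochains R (int p) (int q)"
    unfolding bi[OF refl] by (intro A_g_graded B_k_graded f)+
  have C: "C_p R f \<in> graded {int p - 1, int p + 1} (p + q)"
    by (rule graded_mono[OF C_p_graded[OF f]]) auto
  have "C_p R f = bidegree_part R (int p - 1) (C_p R f) + bidegree_part R (int p + 1) (C_p R f)"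
    using graded_decompose[OF C] by simp
  then show "C_p R f \<in> bicochains R (int p - 1) (int q + 1) + bicochains R (int p + 1) (int q - 1)"
    using graded_cochains[OF C_p_graded[OF f]]
    by (subst bi, simp, subst bi, simp) (metis graded_bidegree_part set_plus_intro)
  show "D_g R J Z Z' f \<in> bicochains R (int p) (int q)" if "p + q \<le> 1"
    unfolding bi[OF refl] using that by (intro D_g_graded_1[OF dual f]) auto
  have D: "D_g R J Z Z' f \<in> graded {int p - 2, int p, int p + 2} (p + q)"
    by (rule graded_mono[OF D_g_graded[OF dual f]]) auto
  let ?D = "D_g R J Z Z' f"
  have "?D = bidegree_part R (int p - 2) ?D + bidegree_part R (int p) ?D + bidegree_part R (int p + 2) ?D"
    using graded_decompose[OF D] by (simp add: add.assoc)
  then show "?D \<in> bicochains R (int p - 2) (int q + 2) + bicochains R (int p) (int q) +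
          bicochains R (int p + 2) (int q - 2)"
    using graded_cochains[OF D]
    by (subst bi, simp, subst bi, simp, subst bi, simp) (metis graded_bidegree_part set_plus_intro)
qed

end

theorem corollary3p5:
  fixes R :: "('g::real_vector, 'v::ab_group_add, 'i) lie_data"
    and J :: "'j set" and Z Z' :: "'j \<Rightarrow> 'g"
  assumes "reductive_data R"
    and "adapted_basis R"
    and "hermitian_module R"
    and "dual_bases R J Z Z'"
  shows
    \<comment> \<open>bigrading\<close>
    "(\<forall>n. \<forall>f\<in>cochains R n. \<exists>!g :: nat \<Rightarrow> 'g list \<Rightarrow> 'v.
        (\<forall>p\<le>n. g p \<in> bicochains R (int p) (int (n - p))) \<and> (\<forall>p>n. g p = 0) \<and>
        f = (\<Sum>p\<le>n. g p)) \<and>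
     \<comment> \<open>(I)\<close>
     (\<forall>n. \<forall>f\<in>cochains R n. lap_circ R n f = - tau_Omega_bar R f + box_circ R n f) \<and>
     (\<forall>p. \<forall>f\<in>bicochains R (int p) 0. box_circ R p f =
        (\<Sum>j\<in>idx R. tau_ext R (bas R j) (coad_star_ext R (bas R j) f))) \<and>
     (\<forall>q. \<forall>f\<in>bicochains R 0 (int q). box_circ R q f =
        - (\<Sum>j\<in>idx R. tau_ext R (bas R j) (coad_star_ext R (bas R j) f))) \<and>
     (\<forall>p q v. \<forall>\<omega>1\<in>biforms R (*) (int p) 0. \<forall>\<omega>2\<in>biforms R (*) 0 (int q).
        box_circ R (p + q) (tensor R v (wedge (*) (*) p q \<omega>1 \<omega>2)) =
          wedge (scl R) (\<lambda>u c. scl R c u) p q (box_circ R p (tensor R v \<omega>1)) \<omega>2 +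
          wedge (scl R) (scl R) p q \<omega>1 (box_circ R q (tensor R v \<omega>2))) \<and>
     \<comment> \<open>(II)\<close>
     (\<forall>n. \<forall>f\<in>cochains R n. lap_wedge R n f =
        cscale R (- 1 / 2) (\<Sum>j\<in>idx R. coad_star_ext R (bas R j) (coad_ext R (bas R j) f))) \<and>
     \<comment> \<open>bidegrees of the operators\<close>
     (\<forall>p q :: nat. \<forall>f\<in>bicochains R (int p) (int q).
        A_g R f \<in> bicochains R (int p) (int q) \<and>
        B_k R f \<in> bicochains R (int p) (int q) \<and>
        C_p R f \<in> bicochains R (int p - 1) (int q + 1) + bicochains R (int p + 1) (int q - 1) \<and>
        (p + q \<le> 1 \<longrightarrow> D_g R J Z Z' f \<in> bicochains R (int p) (int q)) \<and>
        D_g R J Z Z' f \<in> bicochains R (int p - 2) (int q + 2) + bicochains R (int p) (int q) +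
          bicochains R (int p + 2) (int q - 2)) \<and>
     \<comment> \<open>the operators on one-cochains\<close>
     acts_by_matrix R (lap_circ R 1)
       (A_g R + B_k R) (- C_p R)
       (C_p R) (A_g R - B_k R) \<and>
     acts_by_matrix R (lap_wedge R 1)
       (D_g R J Z Z') 0
       0 (D_g R J Z Z') \<and>
     acts_by_matrix R (lap_circ_wedge R 1)
       (- B_k R) (- C_p R)
       (- C_p R) (- B_k R) \<and>
     acts_by_matrix R (lap_wedge_circ R 1)
       (- B_k R) (C_p R)
       (C_p R) (- B_k R) \<and>
     acts_by_matrix R (laplacian R 1)
       (A_g R - B_k R + D_g R J Z Z') (- C_p R)
       (C_p R) (A_g R - (cscale R 3 \<circ> B_k R) + D_g R J Z Z')"
proof -
  interpret hermitian_lie_module R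
    using assms(1-3) by unfold_locales
  have pure: "bicochains R (int n) 0 = graded {int n} n" "bicochains R 0 (int n) = graded {0} n" for n
    using bicochains_eq_graded[of "int n" 0] bicochains_eq_graded[of 0 "int n"] by simp_all
  have "\<forall>n. \<forall>f\<in>cochains R n. lap_circ R n f = - tau_Omega_bar R f + box_circ R n f"
    by (simp only: lap_circ_eq A_g_def) simp
  moreover have "\<forall>n. \<forall>f\<in>cochains R n. lap_wedge R n f =
        cscale R (- 1 / 2) (\<Sum>j\<in>idx R. coad_star_ext R (bas R j) (coad_ext R (bas R j) f))"
    by (intro allI ballI)
      (simp only: lap_wedge_eq coad_ext_eq coad_star_ext_eq[OF cochains_lie_der])
  moreover have "\<forall>p q v. \<forall>\<omega>1\<in>biforms R (*) (int p) 0. \<forall>\<omega>2\<in>biforms R (*) 0 (int q).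
        box_circ R (p + q) (tensor R v (wedge (*) (*) p q \<omega>1 \<omega>2)) =
          wedge (scl R) (\<lambda>u c. scl R c u) p q (box_circ R p (tensor R v \<omega>1)) \<omega>2 +
          wedge (scl R) (scl R) p q \<omega>1 (box_circ R q (tensor R v \<omega>2))"
    by (intro allI ballI box_circ_wedge) (simp_all add: biforms_def)
  ultimately show ?thesis
    unfolding pure
    by (intro conjI allI ballI impI bigrading box_circ_kpart box_circ_ppart
        bidegrees[OF assms(4)] one_cochain_matrices[OF assms(4)]) blast+
qed

end
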